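(* Let $p$ be a prime, $n$ a natural number and $G=\mathbb{Z}^n\ltimes \mathrm{UT}_n(\mathbb{Z}[1/p])$. Let $\mu$ be a probability measure on $G$ that has finite first moment with respect to word length and such that the group generated by $\operatorname{supp}\mu$ is non-abelian. For $1\le i\le n$ let $\mu_i$ be the pushforward of $\mu$ under the map $(x,f)\mapsto x_i$ from $G$ to $\mathbb{Z}$. Suppose that the random walk $(\mathbb{Z},\mu_i)$ is recurrent for every natural number $i\le n$. Then the Poisson boundary of $(G,\mu)$ is trivial.
   Context: $\mathrm{UT}_n(R)$ is the group of upper unitriangular $n\times n$ matrices over $R$. The product in $G$ is $(x,f)(y,g)=(x+y,\,f\,XgX^{-1})$, where $X=\operatorname{diag}(p^{x_1},\dots,p^{x_n})$ for $x=(x_1,\dots,x_n)\in\mathbb{Z}^n$. $G$ is a finitely generated discrete group; word length $|\cdot|$ is taken with respect to a finite generating set, and finite first moment means $\int_G|g|\,d\mu(g)<\infty$. Let $R_m$ be the right random walk on $G$, the product of $m$ independent increments of law $\mu$. A $\mu$-boundary is a second countable $G$-space $B$ (a topological space with a continuous $G$-action) with a $\mu$-stationary probability measure $\nu$ ($\mu*\nu=\nu$) for which there is a random variable $\mathbf{bnd}$ from path space to $B$ with $R_m(\omega)\cdot\nu\to\delta_{\mathbf{bnd}(\omega)}$ in the weak* topology for almost every path $\omega$. The Poisson boundary of $(G,\mu)$ is the maximal $\mu$-boundary: every $\mu$-boundary is an equivariant image of it, and its Poisson transform $P_\nu(\varphi)(g)=\int_B\varphi(gb)\,d\nu(b)$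 is an isometric isomorphism from $L^\infty(B,\nu)$ onto the space of bounded $\mu$-harmonic functions. It is trivial if it is a one-point space.
   Formalization: The Poisson boundary of (G,μ) is taken over the subgroup generated by supp μ (over G, indicators of its cosets are non-constant harmonic functions), and μ-boundaries are required to be metrizable (without separation, e.g. the cofinite topology, the claim fails). *)

theory Defs
  imports
    "HOL-Probability.Probability"
    "HOL-Algebra.Elementary_Groups"
    "HOL-Algebra.Group_Action"
    "Jordan_Normal_Form.Matrix"
begin

(* Both libraries use the infix $; below it is indexing of vectors of type 'a Matrix.vec. *)
no_notation Finite_Cartesian_Product.vec_nth (infixl "$" 90)

definition Z_inv :: "nat \<Rightarrow> rat set" where
  "Z_inv p = {of_int a / of_nat p ^ k | (a::int) (k::nat). True}"

definition UT :: "nat \<Rightarrow> rat set \<Rightarrow> rat mat set" where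
  "UT n R = {f \<in> carrier_mat n n. upper_triangular f \<and>
     (\<forall>i<n. f $$ (i, i) = 1) \<and> (\<forall>i<n. \<forall>j<n. f $$ (i, j) \<in> R)}"

definition p_diag :: "nat \<Rightarrow> nat \<Rightarrow> int Matrix.vec \<Rightarrow> rat mat" where
  "p_diag p n x = mat_diag n (\<lambda>i. of_nat p powi (x $ i))"

(* p_diag p n (- x) is the inverse of the matrix p_diag p n x (for p > 0).
   Vector and matrix entries are indexed from 0. *)
definition semidirect_UT :: "nat \<Rightarrow> nat \<Rightarrow> (int Matrix.vec \<times> rat mat) monoid" where
  "semidirect_UT p n =
     \<lparr>carrier = carrier_vec n \<times> UT n (Z_inv p),
      monoid.mult = (\<lambda>(x, f) (y, g). (x + y, f * (p_diag p n x * g * p_diag p n (- x)))),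
      one = (0\<^sub>v n, 1\<^sub>m n)\<rparr>"

definition word_length :: "('g, 'm) monoid_scheme \<Rightarrow> 'g set \<Rightarrow> 'g \<Rightarrow> nat" where
  "word_length G S g =
     (LEAST k. \<exists>ws. length ws = k \<and> set ws \<subseteq> S \<union> m_inv G ` S \<and>
        foldr (monoid.mult G) ws \<one>\<^bsub>G\<^esub> = g)"

definition finite_first_moment :: "('g, 'm) monoid_scheme \<Rightarrow> 'g set \<Rightarrow> 'g pmf \<Rightarrow> bool" where
  "finite_first_moment G S \<mu> \<longleftrightarrow>
     integrable (measure_pmf \<mu>) (\<lambda>g. real (word_length G S g))"

(* Path space is represented by the space of increments: a path of the right random walk
   started at the identity is random_walk G \<omega> for a sequence \<omega> of i.i.d. increments. *)
definition increments :: "'g pmf \<Rightarrow> (nat \<Rightarrow> 'g) measure" where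
  "increments \<mu> = PiM UNIV (\<lambda>_. measure_pmf \<mu>)"

primrec random_walk :: "('g, 'm) monoid_scheme \<Rightarrow> (nat \<Rightarrow> 'g) \<Rightarrow> nat \<Rightarrow> 'g" where
  "random_walk G \<omega> 0 = \<one>\<^bsub>G\<^esub>"
| "random_walk G \<omega> (Suc m) = random_walk G \<omega> m \<otimes>\<^bsub>G\<^esub> \<omega> m"

definition recurrent_walk :: "('g, 'm) monoid_scheme \<Rightarrow> 'g pmf \<Rightarrow> bool" where
  "recurrent_walk G \<mu> \<longleftrightarrow>
     (AE \<omega> in increments \<mu>. \<exists>\<^sub>\<infinity>m. random_walk G \<omega> m = \<one>\<^bsub>G\<^esub>)"

definition borel_on :: "'b topology \<Rightarrow> 'b measure" where
  "borel_on B = sigma (topspace B) {U. openin B U}"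

(* G is discrete, so an action is jointly continuous iff each element acts continuously.
   The spaces are separable metrizable (equivalently second countable, regular and
   Hausdorff): without a separation axiom bounded continuous functions need not separate
   Borel probability measures, and weak* convergence to a point mass may carry
   no information. *)
definition G_space :: "('g, 'm) monoid_scheme \<Rightarrow> 'b topology \<Rightarrow> ('g \<Rightarrow> 'b \<Rightarrow> 'b) \<Rightarrow> bool" where
  "G_space G B act \<longleftrightarrow>
     metrizable_space B \<and> second_countable B \<and>
     group_action G (topspace B) act \<and>
     (\<forall>g\<in>carrier G. continuous_map B B (act g))"

definition stationary :: "'g pmf \<Rightarrow> ('g \<Rightarrow> 'b \<Rightarrow> 'b) \<Rightarrow> 'b measure \<Rightarrow> bool" where
  "stationary \<mu> act \<nu> \<longleftrightarrow>
     (\<forall>A\<in>sets \<nu>. (\<integral>\<^sup>+g. emeasure (distr \<nu> \<nu> (act g)) A \<partial>measure_pmf \<mu>) = emeasure \<nu> A)"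

definition mu_boundary ::
  "('g, 'm) monoid_scheme \<Rightarrow> 'g pmf \<Rightarrow> 'b topology \<Rightarrow> ('g \<Rightarrow> 'b \<Rightarrow> 'b) \<Rightarrow> 'b measure \<Rightarrow> bool" where
  "mu_boundary G \<mu> B act \<nu> \<longleftrightarrow>
     G_space G B act \<and> sets \<nu> = sets (borel_on B) \<and> prob_space \<nu> \<and> stationary \<mu> act \<nu> \<and>
     (\<exists>bnd \<in> increments \<mu> \<rightarrow>\<^sub>M borel_on B.
        AE \<omega> in increments \<mu>. \<forall>\<phi>::'b \<Rightarrow> real.
          continuous_map B euclideanreal \<phi> \<and> bounded (\<phi> ` topspace B) \<longrightarrow>
          (\<lambda>m. \<integral>b. \<phi> (act (random_walk G \<omega> m) b) \<partial>\<nu>) \<longlonglongrightarrow> \<phi> (bnd \<omega>))"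

definition equivariant_image ::
  "('g, 'm) monoid_scheme \<Rightarrow> ('g \<Rightarrow> 'b \<Rightarrow> 'b) \<Rightarrow> 'b measure \<Rightarrow> ('g \<Rightarrow> 'c \<Rightarrow> 'c) \<Rightarrow> 'c measure \<Rightarrow> bool" where
  "equivariant_image G act \<nu> act' \<nu>' \<longleftrightarrow>
     (\<exists>\<pi> \<in> \<nu> \<rightarrow>\<^sub>M \<nu>'. distr \<nu> \<nu>' \<pi> = \<nu>' \<and>
        (\<forall>g\<in>carrier G. AE b in \<nu>. \<pi> (act g b) = act' g (\<pi> b)))"

(* Functions on G are normalised to be undefined outside of the carrier. *)
definition bounded_harmonic :: "('g, 'm) monoid_scheme \<Rightarrow> 'g pmf \<Rightarrow> ('g \<Rightarrow> real) set" where
  "bounded_harmonic G \<mu> =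
     {h \<in> extensional (carrier G). bounded (h ` carrier G) \<and>
        (\<forall>g\<in>carrier G. (\<integral>s. h (g \<otimes>\<^bsub>G\<^esub> s) \<partial>measure_pmf \<mu>) = h g)}"

definition Linf_norm :: "'b measure \<Rightarrow> ('b \<Rightarrow> real) \<Rightarrow> ereal" where
  "Linf_norm \<nu> \<phi> = esssup \<nu> (\<lambda>b. ereal \<bar>\<phi> b\<bar>)"

definition Linf :: "'b measure \<Rightarrow> ('b \<Rightarrow> real) set" where
  "Linf \<nu> = {\<phi> \<in> borel_measurable \<nu>. Linf_norm \<nu> \<phi> < \<infinity>}"

definition poisson_transform ::
  "('g, 'm) monoid_scheme \<Rightarrow> ('g \<Rightarrow> 'b \<Rightarrow> 'b) \<Rightarrow> 'b measure \<Rightarrow> ('b \<Rightarrow> real) \<Rightarrow> 'g \<Rightarrow> real" where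
  "poisson_transform G act \<nu> \<phi> = (\<lambda>g\<in>carrier G. \<integral>b. \<phi> (act g b) \<partial>\<nu>)"

(* Linf consists of functions rather than of classes modulo null sets. The isometry condition
   is stated for differences, so it contains independence of the representative. *)
definition poisson_transform_isometric_iso ::
  "('g, 'm) monoid_scheme \<Rightarrow> 'g pmf \<Rightarrow> ('g \<Rightarrow> 'b \<Rightarrow> 'b) \<Rightarrow> 'b measure \<Rightarrow> bool" where
  "poisson_transform_isometric_iso G \<mu> act \<nu> \<longleftrightarrow>
     (let P = poisson_transform G act \<nu> in
       P ` Linf \<nu> = bounded_harmonic G \<mu> \<and>
       (\<forall>\<phi>\<in>Linf \<nu>. \<forall>\<psi>\<in>Linf \<nu>. \<forall>a. \<forall>g\<in>carrier G.
          P (\<lambda>b. a * \<phi> b + \<psi> b) g = a * P \<phi> g + P \<psi> g) \<and>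
       (\<forall>\<phi>\<in>Linf \<nu>. \<forall>\<psi>\<in>Linf \<nu>.
          (SUP g\<in>carrier G. ereal \<bar>P \<phi> g - P \<psi> g\<bar>) = Linf_norm \<nu> (\<lambda>b. \<phi> b - \<psi> b)))"

(* Maximality is tested against boundaries whose points lie in the type 'c. *)
definition poisson_boundary ::
  "'c itself \<Rightarrow> ('g, 'm) monoid_scheme \<Rightarrow> 'g pmf \<Rightarrow>
   'b topology \<Rightarrow> ('g \<Rightarrow> 'b \<Rightarrow> 'b) \<Rightarrow> 'b measure \<Rightarrow> bool" where
  "poisson_boundary _ G \<mu> B act \<nu> \<longleftrightarrow>
     mu_boundary G \<mu> B act \<nu> \<and>
     (\<forall>(C :: 'c topology) act' \<nu>'.
        mu_boundary G \<mu> C act' \<nu>' \<longrightarrow> equivariant_image G act \<nu> act' \<nu>') \<and>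
     poisson_transform_isometric_iso G \<mu> act \<nu>"

(* The Poisson boundary of (G, \<mu>) is that of (H, \<mu>), where H is the subgroup generated by the
   support of \<mu>. If H is a proper subgroup, every bounded function of the coset g H
   is \<mu>-harmonic on G, and the coset H is a point mass \<mu>-boundary in the G-space G/H; so over G
   a one-point space would never satisfy the definition, for a trivial reason. *)
definition poisson_boundary_trivial :: "'c itself \<Rightarrow> ('g, 'm) monoid_scheme \<Rightarrow> 'g pmf \<Rightarrow> bool" where
  "poisson_boundary_trivial T G \<mu> \<longleftrightarrow>
     (\<exists>(B :: unit topology) act \<nu>.
        topspace B = {()} \<and>
        poisson_boundary T (subgroup_generated G (set_pmf \<mu>)) \<mu> B act \<nu>)"

end

theory Submission
  imports Defs
begin

text \<open>Let \<open>W\<^sub>m\<close> be the law of \<open>R\<^sub>m\<close> and \<open>H\<close> the Shannon entropy. The increment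
  \<open>H(W\<^bsub>m+1\<^esub>) - H(W\<^sub>m)\<close> is the average over \<open>x \<sim> \<mu>\<close> of the Kullback--Leibler divergence of
  \<open>x W\<^sub>m\<close> from \<open>W\<^bsub>m+1\<^esub>\<close>, and a bounded harmonic function \<open>h\<close> with \<open>h(g x) \<noteq> h(g)\<close> bounds it
  away from 0. So \<open>H(W\<^sub>m) = o(m)\<close> along a subsequence forces the Liouville property.

  To bound the entropy, embed \<open>(x, f) \<mapsto> f X\<close> into triangular matrices over \<open>\<int>[1/p]\<close> and measure entries
  by their real plus their \<open>p\<close>-adic size. The logarithm of the norm is subadditive, balls in this norm grow
  polynomially, and finite first moment makes the logarithm integrable. Conjugation by
  \<open>diag(1, t, t\<^sup>2, \<dots>)\<close> with \<open>t \<rightarrow> 0\<close> suppresses the entries off the diagonal, so for a block of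
  length \<open>N\<close> the expected logarithm is at most a constant plus \<open>ln p \<cdot> \<Sum>\<^sub>i E|S\<^bsub>N,i\<^esub>|\<close>. Recurrent integrable
  walks on \<open>\<int>\<close> are centred, so this is \<open>o(N)\<close>, and subadditivity extends the bound to all times.\<close>

section \<open>Entropy and harmonic functions\<close>

text \<open>Entries off the diagonal of a product of \<open>N\<close> matrices can be large even
  when the diagonal is small, so the coordinates alone do not control the norm. The remedy lies in
  the order of the choices: \<open>N\<close> comes first, from the centring of the coordinates, then
  \<open>t\<close> depending on \<open>N\<close>, then the number of blocks. Passing between the
  norms for \<open>t\<close> and for 1 costs \<open>n * ln (1 / t)\<close>, whatever the group
  element, so this is paid once and not once per block. The two sizes have to be added:
  \<open>p ^ k\<close> is large in the real sense for k > 0 and in the p-adic sense for k < 0, which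
  is why absolute values of the coordinates appear. Moreover Z[1/p] is dense in the reals but
  discrete for both sizes together, which makes balls finite. The divergence enters only through its
  variational lower bound, with the test function \<open>s * d x * d z\<close> built from the
  increments \<open>d\<close> of h. This bounds all entropy increments below by the same constant,
  and H(W_0) = 0, so a single time with small enough entropy per step refutes a positive
  constant.\<close>

lemma integral_pair_pmf_bounded:
  fixes f :: "'a \<times> 'b \<Rightarrow> real"
  assumes bnd: "\<And>x y. x \<in> set_pmf A \<Longrightarrow> y \<in> set_pmf B \<Longrightarrow> \<bar>f (x, y)\<bar> \<le> c"
  shows "measure_pmf.expectation (pair_pmf A B) f
       = measure_pmf.expectation A (\<lambda>x. measure_pmf.expectation B (\<lambda>y. f (x, y)))"
proof -
  \<comment> \<open>\<open>integral_bind\<close> asks for a bound at every point, but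
    \<open>f\<close> is bounded on the support only; hence the truncation to 0 elsewhere.\<close>
  define f' where "f' z = (if z \<in> set_pmf (pair_pmf A B) then f z else 0)" for z
  have f'_bnd: "\<bar>f' z\<bar> \<le> \<bar>c\<bar>" for z
    using bnd[of "fst z" "snd z"] by (auto simp: f'_def)
  have "measure_pmf.expectation (pair_pmf A B) f = measure_pmf.expectation (pair_pmf A B) f'"
    by (intro integral_cong_AE) (auto simp: AE_measure_pmf_iff f'_def)
  also have "\<dots> = measure_pmf.expectation A (\<lambda>x. measure_pmf.expectation (map_pmf (Pair x) B) f')"
    unfolding pair_pmf_def map_pmf_def[of "Pair _", symmetric] measure_pmf_bind
    by (rule integral_bind[where K="count_space UNIV" and B="\<bar>c\<bar>" and B'=1])
       (use f'_bnd measure_pmf.emeasure_le_1 in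
         \<open>auto simp: space_subprob_algebra measure_pmf.subprob_space_axioms\<close>)
  also have "\<dots> = measure_pmf.expectation A (\<lambda>x. measure_pmf.expectation B (\<lambda>y. f' (x, y)))"
    by simp
  also have "\<dots> = measure_pmf.expectation A (\<lambda>x. measure_pmf.expectation B (\<lambda>y. f (x, y)))"
    by (intro integral_cong_AE) (auto simp: AE_measure_pmf_iff f'_def intro!: integral_cong_AE)
  finally show ?thesis .
qed

text \<open>A Bochner integral is 0 if its integrand is not integrable, so the value is meaningful
  only together with integrability of \<open>ln (pmf W x)\<close>, which is carried along as a
  separate statement.\<close>

definition pmf_entropy :: "'a pmf \<Rightarrow> real" where
  "pmf_entropy W = measure_pmf.expectation W (\<lambda>x. - ln (pmf W x))"

text \<open>The new increment is multiplied on the left, while \<open>random_walk\<close> multiplies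
  on the right; for i.i.d. increments the law is the same. The left form exposes the first
  increment, on which the entropy step conditions.\<close>

primrec conv_power :: "('g, 'm) monoid_scheme \<Rightarrow> 'g pmf \<Rightarrow> nat \<Rightarrow> 'g pmf" where
  "conv_power G \<mu> 0 = return_pmf \<one>\<^bsub>G\<^esub>"
| "conv_power G \<mu> (Suc m) = map_pmf (\<lambda>(x, y). x \<otimes>\<^bsub>G\<^esub> y) (pair_pmf \<mu> (conv_power G \<mu> m))"

lemma (in monoid) set_conv_power:
  assumes "set_pmf \<mu> \<subseteq> carrier G"
  shows "set_pmf (conv_power G \<mu> m) \<subseteq> carrier G"
  using assms by (induction m) auto

lemma bounded_integrable_pmf:
  fixes f :: "'a \<Rightarrow> real"
  assumes "\<And>x. x \<in> set_pmf W \<Longrightarrow> \<bar>f x\<bar> \<le> c"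
  shows "integrable (measure_pmf W) f"
  by (rule measure_pmf.integrable_const_bound[where B=c]) (use assms in \<open>auto simp: AE_measure_pmf_iff\<close>)

text \<open>The Donsker--Varadhan inequality, averaged over the first increment: the entropy increment
  is the mean Kullback--Leibler divergence of the translates of \<open>V\<close> from \<open>\<mu> * V\<close>.\<close>

lemma (in group) expectation_le_entropy_increment:
  fixes F :: "'a \<Rightarrow> 'a \<Rightarrow> real"
  assumes \<mu>: "set_pmf \<mu> \<subseteq> carrier G" and V: "set_pmf V \<subseteq> carrier G"
    and W: "W = map_pmf (\<lambda>(x, y). x \<otimes> y) (pair_pmf \<mu> V)"
    and intV: "integrable (measure_pmf V) (\<lambda>x. ln (pmf V x))"
    and intW: "integrable (measure_pmf W) (\<lambda>x. ln (pmf W x))"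
    and F: "\<And>x z. x \<in> set_pmf \<mu> \<Longrightarrow> z \<in> set_pmf W \<Longrightarrow> \<bar>F x z\<bar> \<le> c"
    and K: "\<And>x. x \<in> set_pmf \<mu> \<Longrightarrow> measure_pmf.expectation W (\<lambda>z. exp (F x z)) \<le> K"
  shows "measure_pmf.expectation (pair_pmf \<mu> V) (\<lambda>(x, y). F x (x \<otimes> y))
         \<le> pmf_entropy W - pmf_entropy V + K - 1"
proof -
  let ?P = "pair_pmf \<mu> V"
  \<comment> \<open>The logarithm of \<open>r\<close> is the integrand
    \<open>F + ln W - ln V\<close> of the claim, so \<open>ln r \<le> r - 1\<close> reduces
    everything to the bound \<open>K\<close> for the mean of \<open>r\<close>.\<close>
  define r where "r = (\<lambda>(x, y). pmf W (x \<otimes> y) * exp (F x (x \<otimes> y)) / pmf V y)"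
  have r_nonneg: "r z \<ge> 0" for z
    by (auto simp: r_def split: prod.split)
  have Wsupp: "x \<otimes> y \<in> set_pmf W" if "x \<in> set_pmf \<mu>" "y \<in> set_pmf V" for x y
    using that by (auto simp: W)
  have K_nonneg: "K \<ge> 0"
  proof -
    obtain x where "x \<in> set_pmf \<mu>" using set_pmf_not_empty by fast
    then show ?thesis using K[of x] by (smt (verit) Bochner_Integration.integral_nonneg exp_ge_zero)
  qed
  have inner: "(\<integral>\<^sup>+y. ennreal (r (x, y)) \<partial>V) \<le> ennreal K" if x: "x \<in> set_pmf \<mu>" for x
  proof -
    have xG: "x \<in> carrier G" using x \<mu> by auto
    have bij: "bij_betw (\<lambda>y. x \<otimes> y) (carrier G) (carrier G)"
      by (rule bij_betw_byWitness[where f'="\<lambda>y. inv x \<otimes> y"])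
         (use xG in \<open>auto simp: m_assoc[symmetric]\<close>)
    let ?h = "\<lambda>z. ennreal (pmf W z) * ennreal (exp (F x z))"
    have "(\<integral>\<^sup>+y. ennreal (r (x, y)) \<partial>V) = (\<integral>\<^sup>+y. ennreal (pmf V y) * ennreal (r (x, y)) \<partial>count_space UNIV)"
      by (rule nn_integral_measure_pmf)
    \<comment> \<open>\<open>pmf V y\<close> cancels the denominator of \<open>r\<close>, and off
      the support of \<open>V\<close> the left side is 0. What remains depends on
      \<open>x \<otimes> y\<close> only, and translation by \<open>x\<close> permutes the
      carrier.\<close>
    also have "\<dots> \<le> (\<integral>\<^sup>+y. ?h (x \<otimes> y) * indicator (carrier G) y \<partial>count_space UNIV)"
    proof (rule nn_integral_mono)
      fix y
      show "ennreal (pmf V y) * ennreal (r (x, y)) \<le> ?h (x \<otimes> y) * indicator (carrier G) y"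
      proof (cases "y \<in> set_pmf V")
        case True
        then have "pmf V y > 0" by (simp add: pmf_positive)
        then show ?thesis using True V
          by (auto simp: r_def ennreal_mult'[symmetric] indicator_def intro!: ennreal_leI)
      qed (simp add: set_pmf_iff)
    qed
    also have "\<dots> = (\<integral>\<^sup>+y. ?h (x \<otimes> y) \<partial>count_space (carrier G))"
      by (simp add: nn_integral_count_space_indicator)
    also have "\<dots> = (\<integral>\<^sup>+z. ?h z \<partial>count_space (carrier G))"
      by (rule nn_integral_bij_count_space[OF bij])
    also have "\<dots> = (\<integral>\<^sup>+z. ?h z * indicator (carrier G) z \<partial>count_space UNIV)"
      by (simp add: nn_integral_count_space_indicator)
    also have "\<dots> \<le> (\<integral>\<^sup>+z. ?h z \<partial>count_space UNIV)"
      by (intro nn_integral_mono) (simp add: indicator_def)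
    also have "\<dots> = (\<integral>\<^sup>+z. ennreal (exp (F x z)) \<partial>W)"
      by (rule nn_integral_measure_pmf[symmetric])
    also have "\<dots> = ennreal (measure_pmf.expectation W (\<lambda>z. exp (F x z)))"
      by (intro nn_integral_eq_integral bounded_integrable_pmf[where c="exp c"])
         (use F[OF x] in \<open>auto simp: abs_le_iff\<close>)
    also have "\<dots> \<le> ennreal K" using K[OF x] by (rule ennreal_leI)
    finally show ?thesis .
  qed
  have "(\<integral>\<^sup>+z. ennreal (r z) \<partial>?P) = (\<integral>\<^sup>+x. \<integral>\<^sup>+y. ennreal (r (x, y)) \<partial>V \<partial>\<mu>)"
    by (rule nn_integral_pair_pmf')
  also have "\<dots> \<le> (\<integral>\<^sup>+x. ennreal K \<partial>\<mu>)"
    by (intro nn_integral_mono_AE) (auto simp: AE_measure_pmf_iff inner)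
  also have "\<dots> = ennreal K" by simp
  finally have rK: "(\<integral>\<^sup>+z. ennreal (r z) \<partial>?P) \<le> ennreal K" .
  have int_r: "integrable ?P r"
    by (rule integrableI_nonneg) (use rK in \<open>auto simp: r_nonneg top.not_eq_extremum[symmetric] top_unique\<close>)
  have Er: "measure_pmf.expectation ?P r \<le> K"
    using rK K_nonneg by (subst (asm) nn_integral_eq_integral[OF int_r]) (auto simp: r_nonneg)
  have int_F: "integrable ?P (\<lambda>(x, y). F x (x \<otimes> y))"
    by (rule bounded_integrable_pmf[where c=c]) (auto intro!: F Wsupp)
  have int_W': "integrable ?P (\<lambda>z. ln (pmf W (fst z \<otimes> snd z)))"
    using intW unfolding W integrable_map_pmf_eq by (simp add: case_prod_beta')
  have int_V': "integrable ?P (\<lambda>z. ln (pmf V (snd z)))"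
    using intV by (subst (asm) map_snd_pair_pmf[symmetric, of _ \<mu>]) (simp del: map_snd_pair_pmf)
  have EW: "measure_pmf.expectation ?P (\<lambda>z. ln (pmf W (fst z \<otimes> snd z))) = - pmf_entropy W"
    using integral_map_pmf[of "\<lambda>(x, y). x \<otimes> y" ?P "\<lambda>z. ln (pmf W z)"]
    unfolding W[symmetric] by (simp add: pmf_entropy_def case_prod_beta' del: integral_map_pmf)
  have EV: "measure_pmf.expectation ?P (\<lambda>z. ln (pmf V (snd z))) = - pmf_entropy V"
    by (simp add: pmf_entropy_def expectation_pair_pmf_snd[of \<mu> V "\<lambda>x. ln (pmf V x)"])
  let ?l = "\<lambda>z. (case z of (x, y) \<Rightarrow> F x (x \<otimes> y)) + ln (pmf W (fst z \<otimes> snd z)) - ln (pmf V (snd z))"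
  have "measure_pmf.expectation ?P ?l \<le> measure_pmf.expectation ?P (\<lambda>z. r z - 1)"
  proof (rule integral_mono_AE)
    show "AE z in ?P. ?l z \<le> r z - 1"
    proof (clarsimp simp: AE_measure_pmf_iff)
      fix x y assume xy: "x \<in> set_pmf \<mu>" "y \<in> set_pmf V"
      have pos: "pmf W (x \<otimes> y) > 0" "pmf V y > 0" using xy Wsupp by (auto simp: pmf_positive)
      then have "ln (r (x, y)) \<le> r (x, y) - 1"
        by (intro ln_le_minus_one) (simp add: r_def)
      moreover have "ln (r (x, y)) = F x (x \<otimes> y) + ln (pmf W (x \<otimes> y)) - ln (pmf V y)"
        using pos by (simp add: r_def ln_div ln_mult)
      ultimately show "F x (x \<otimes> y) + ln (pmf W (x \<otimes> y)) - ln (pmf V y) \<le> r (x, y) - 1" by simp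
    qed
  qed (use int_r int_F int_W' int_V' in auto)
  then show ?thesis
    using Er EW EV int_F int_W' int_V' int_r by simp
qed


lemma (in group) expectation_harmonic_conv_power:
  fixes h :: "'a \<Rightarrow> real"
  assumes \<mu>: "set_pmf \<mu> \<subseteq> carrier G"
    and bnd: "\<And>g. g \<in> carrier G \<Longrightarrow> \<bar>h g\<bar> \<le> B"
    and harm: "\<And>g. g \<in> carrier G \<Longrightarrow> measure_pmf.expectation \<mu> (\<lambda>s. h (g \<otimes> s)) = h g"
    and g: "g \<in> carrier G"
  shows "measure_pmf.expectation (conv_power G \<mu> m) (\<lambda>z. h (g \<otimes> z)) = h g"
  using g
proof (induction m arbitrary: g)
  case 0
  then show ?case by simp
next
  case (Suc m)
  let ?V = "conv_power G \<mu> m"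
  have V: "set_pmf ?V \<subseteq> carrier G" by (rule set_conv_power[OF \<mu>])
  have "measure_pmf.expectation (conv_power G \<mu> (Suc m)) (\<lambda>z. h (g \<otimes> z))
      = measure_pmf.expectation (pair_pmf \<mu> ?V) (\<lambda>(x, y). h (g \<otimes> (x \<otimes> y)))"
    by (simp add: case_prod_beta')
  also have "\<dots> = measure_pmf.expectation \<mu> (\<lambda>x. measure_pmf.expectation ?V (\<lambda>y. h (g \<otimes> (x \<otimes> y))))"
    by (subst integral_pair_pmf_bounded[where c=B]) (use \<mu> V Suc.prems in \<open>auto intro!: bnd\<close>)
  also have "\<dots> = measure_pmf.expectation \<mu> (\<lambda>x. h (g \<otimes> x))"
  proof (intro integral_cong_AE)
    show "AE x in \<mu>. measure_pmf.expectation ?V (\<lambda>y. h (g \<otimes> (x \<otimes> y))) = h (g \<otimes> x)"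
    proof (simp add: AE_measure_pmf_iff, intro ballI)
      fix x assume "x \<in> set_pmf \<mu>"
      then have x: "x \<in> carrier G" using \<mu> by auto
      have "measure_pmf.expectation ?V (\<lambda>y. h (g \<otimes> (x \<otimes> y)))
          = measure_pmf.expectation ?V (\<lambda>y. h (g \<otimes> x \<otimes> y))"
        by (intro integral_cong_AE) (use V x Suc.prems in \<open>auto simp: AE_measure_pmf_iff m_assoc\<close>)
      then show "measure_pmf.expectation ?V (\<lambda>y. h (g \<otimes> (x \<otimes> y))) = h (g \<otimes> x)"
        using Suc.IH[of "g \<otimes> x"] x Suc.prems by simp
    qed
  qed auto
  also have "\<dots> = h g" by (rule harm[OF Suc.prems])
  finally show ?case .
qed

lemma exp_le_quadratic:
  fixes x :: real
  assumes "\<bar>x\<bar> \<le> 1"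
  shows "exp x \<le> 1 + x + x\<^sup>2"
proof (cases "x \<ge> 0")
  case True
  then show ?thesis using assms exp_bound[of x] by auto
next
  case False
  have "1 - x \<le> exp (- x)" using exp_ge_add_one_self[of "- x"] by simp
  then have "exp x \<le> 1 / (1 - x)"
    using False by (simp add: exp_minus field_simps)
  also have "\<dots> \<le> 1 + x + x\<^sup>2"
  proof -
    have "x ^ 3 \<le> 0" using False by (simp add: power_le_zero_eq)
    moreover have "(1 + x + x\<^sup>2) * (1 - x) = 1 - x ^ 3" by (simp add: power2_eq_square power3_eq_cube algebra_simps)
    ultimately show ?thesis using False by (subst pos_divide_le_eq) auto
  qed
  finally show ?thesis .
qed

text \<open>Test the divergence with \<open>F x z = s * d x * d z\<close>. For fixed x it has mean 0
  under the law of the next position, so its exponential moment is 1 + O(s^2). Under the joint law,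
  harmonicity at \<open>g \<otimes> x\<close> makes \<open>d x\<close> the conditional mean of
  \<open>d (x \<otimes> y)\<close>, so F has mean \<open>s * D\<close>. Every entropy increment is
  therefore at least \<open>s * D\<close> - O(s^2), uniformly in m. Sublinear entropy gives D =
  O(s), hence D = 0.\<close>

lemma (in group) harmonic_right_invariant:
  fixes h :: "'a \<Rightarrow> real"
  assumes \<mu>: "set_pmf \<mu> \<subseteq> carrier G"
    and int: "\<And>m. integrable (measure_pmf (conv_power G \<mu> m)) (\<lambda>x. ln (pmf (conv_power G \<mu> m) x))"
    and sublinear: "\<And>\<epsilon>. \<epsilon> > 0 \<Longrightarrow> \<exists>m\<ge>1. pmf_entropy (conv_power G \<mu> m) \<le> \<epsilon> * real m"
    and bnd: "\<And>g. g \<in> carrier G \<Longrightarrow> \<bar>h g\<bar> \<le> B"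
    and harm: "\<And>g. g \<in> carrier G \<Longrightarrow> measure_pmf.expectation \<mu> (\<lambda>s. h (g \<otimes> s)) = h g"
    and g: "g \<in> carrier G" and x: "x \<in> set_pmf \<mu>"
  shows "h (g \<otimes> x) = h g"
proof -
  define d where "d x = h (g \<otimes> x) - h g" for x
  define D where "D = measure_pmf.expectation \<mu> (\<lambda>x. (d x)\<^sup>2)"
  let ?W = "conv_power G \<mu>"
  have d_bnd: "\<bar>d z\<bar> \<le> 2 * B" if "z \<in> carrier G" for z
    using bnd[of "g \<otimes> z"] bnd[of g] g that by (auto simp: d_def)
  have B: "B \<ge> 0" using bnd[OF g] by simp
  have Wc: "set_pmf (?W m) \<subseteq> carrier G" for m by (rule set_conv_power[OF \<mu>])
  \<comment> \<open>Since \<open>\<bar>d z\<bar> \<le> 2 * B\<close>, the test function is at most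
    \<open>4 * B\<^sup>2 * s\<close> in absolute value. The condition on s puts it into the range of
    \<open>exp_le_quadratic\<close>, and \<open>16 * B ^ 4 * s\<^sup>2\<close> is the square of this
    bound.\<close>
  have step: "s * D - 16 * B ^ 4 * s\<^sup>2 \<le> pmf_entropy (?W (Suc m)) - pmf_entropy (?W m)"
    if s: "s > 0" "4 * B\<^sup>2 * s \<le> 1" for s m
  proof -
    define F where "F x z = s * d x * d z" for x z
    have dd: "\<bar>d x * d z\<bar> \<le> 4 * B\<^sup>2" if "x \<in> carrier G" "z \<in> carrier G" for x z
      using mult_mono[OF d_bnd[OF that(1)] d_bnd[OF that(2)]] B
      by (simp add: abs_mult power2_eq_square)
    have F_bnd: "\<bar>F x z\<bar> \<le> 4 * B\<^sup>2 * s" if "x \<in> carrier G" "z \<in> carrier G" for x z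
      using mult_left_mono[OF dd[OF that], of s] s by (simp add: F_def abs_mult mult_ac)
    have Ed: "measure_pmf.expectation (?W m) d = 0" for m
    proof -
      have "integrable (?W m) (\<lambda>z. h (g \<otimes> z))"
        by (rule bounded_integrable_pmf[where c=B]) (use Wc g in \<open>auto intro!: bnd\<close>)
      then show ?thesis
        using expectation_harmonic_conv_power[OF \<mu> bnd harm g, of m] by (simp add: d_def[abs_def])
    qed
    have K: "measure_pmf.expectation (?W (Suc m)) (\<lambda>z. exp (F x z)) \<le> 1 + 16 * B ^ 4 * s\<^sup>2"
      if "x \<in> set_pmf \<mu>" for x
    proof -
      have xG: "x \<in> carrier G" using that \<mu> by auto
      have intF: "integrable (?W (Suc m)) (F x)"
        by (rule bounded_integrable_pmf[where c="4 * B\<^sup>2 * s"]) (use Wc xG in \<open>blast intro: F_bnd\<close>)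
      have "measure_pmf.expectation (?W (Suc m)) (\<lambda>z. exp (F x z))
          \<le> measure_pmf.expectation (?W (Suc m)) (\<lambda>z. (1 + 16 * B ^ 4 * s\<^sup>2) + F x z)"
      proof (rule integral_mono_AE)
        show "integrable (?W (Suc m)) (\<lambda>z. exp (F x z))"
        proof (rule bounded_integrable_pmf[where c="exp 1"])
          fix z assume "z \<in> set_pmf (?W (Suc m))"
          then have "\<bar>F x z\<bar> \<le> 1" using F_bnd[OF xG, of z] Wc s by fastforce
          then show "\<bar>exp (F x z)\<bar> \<le> exp 1" by simp
        qed
        show "AE z in ?W (Suc m). exp (F x z) \<le> (1 + 16 * B ^ 4 * s\<^sup>2) + F x z"
        proof (simp only: AE_measure_pmf_iff, intro ballI)
          fix z assume "z \<in> set_pmf (?W (Suc m))"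
          then have zG: "z \<in> carrier G" using Wc by blast
          have "\<bar>F x z\<bar> \<le> 1" using F_bnd[OF xG zG] s by linarith
          then have "exp (F x z) \<le> 1 + F x z + (F x z)\<^sup>2" by (rule exp_le_quadratic)
          moreover have "(F x z)\<^sup>2 \<le> (4 * B\<^sup>2 * s)\<^sup>2"
            using F_bnd[OF xG zG] by (simp add: abs_le_square_iff[symmetric] abs_mult s less_imp_le)
          moreover have "(4 * B\<^sup>2 * s)\<^sup>2 = 16 * B ^ 4 * s\<^sup>2"
            by (simp add: power_mult_distrib power_mult[symmetric])
          ultimately show "exp (F x z) \<le> (1 + 16 * B ^ 4 * s\<^sup>2) + F x z" by linarith
        qed
      qed (use intF in auto)
      also have "\<dots> = 1 + 16 * B ^ 4 * s\<^sup>2 + measure_pmf.expectation (?W (Suc m)) (F x)"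
        using intF by simp
      also have "measure_pmf.expectation (?W (Suc m)) (F x) = s * d x * measure_pmf.expectation (?W (Suc m)) d"
        unfolding F_def by simp
      also have "\<dots> = 0" by (simp only: Ed)
      finally show ?thesis by simp
    qed
    have "measure_pmf.expectation (pair_pmf \<mu> (?W m)) (\<lambda>(x, y). F x (x \<otimes> y))
        \<le> pmf_entropy (?W (Suc m)) - pmf_entropy (?W m) + (1 + 16 * B ^ 4 * s\<^sup>2) - 1"
    proof (rule expectation_le_entropy_increment[where c="4 * B\<^sup>2 * s", OF \<mu> Wc _ int int _ K])
      show "?W (Suc m) = map_pmf (\<lambda>(x, y). x \<otimes> y) (pair_pmf \<mu> (?W m))" by simp
      show "\<bar>F x z\<bar> \<le> 4 * B\<^sup>2 * s" if "x \<in> set_pmf \<mu>" "z \<in> set_pmf (?W (Suc m))" for x z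
        using that \<mu> Wc by (blast intro: F_bnd)
    qed
    moreover have "measure_pmf.expectation (pair_pmf \<mu> (?W m)) (\<lambda>(x, y). F x (x \<otimes> y)) = s * D"
    proof -
      have "measure_pmf.expectation (pair_pmf \<mu> (?W m)) (\<lambda>(x, y). F x (x \<otimes> y))
          = measure_pmf.expectation \<mu> (\<lambda>x. measure_pmf.expectation (?W m) (\<lambda>y. F x (x \<otimes> y)))"
        by (subst integral_pair_pmf_bounded[where c="4 * B\<^sup>2 * s"])
           (use \<mu> Wc in \<open>auto intro!: F_bnd m_closed\<close>)
      also have "\<dots> = measure_pmf.expectation \<mu> (\<lambda>x. s * (d x)\<^sup>2)"
      proof (intro integral_cong_AE)
        show "AE x in \<mu>. measure_pmf.expectation (?W m) (\<lambda>y. F x (x \<otimes> y)) = s * (d x)\<^sup>2"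
        proof (simp only: AE_measure_pmf_iff, intro ballI)
          fix x assume "x \<in> set_pmf \<mu>"
          then have xG: "x \<in> carrier G" using \<mu> by auto
          have "integrable (?W m) (\<lambda>z. h (g \<otimes> x \<otimes> z))"
            by (rule bounded_integrable_pmf[where c=B]) (use Wc g xG in \<open>auto intro!: bnd\<close>)
          then have *: "measure_pmf.expectation (?W m) (\<lambda>y. h (g \<otimes> x \<otimes> y) - h g) = d x"
            using expectation_harmonic_conv_power[OF \<mu> bnd harm, of "g \<otimes> x" m] g xG by (simp add: d_def)
          have "measure_pmf.expectation (?W m) (\<lambda>y. F x (x \<otimes> y))
             = measure_pmf.expectation (?W m) (\<lambda>y. s * d x * (h (g \<otimes> x \<otimes> y) - h g))"
            by (intro integral_cong_AE)
               (use Wc g xG in \<open>auto simp: F_def AE_measure_pmf_iff d_def[of "x \<otimes> _"] m_assoc subset_iff\<close>)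
          also have "\<dots> = s * d x * d x" by (simp only: integral_mult_right_zero *)
          finally show "measure_pmf.expectation (?W m) (\<lambda>y. F x (x \<otimes> y)) = s * (d x)\<^sup>2"
            by (simp add: power2_eq_square)
        qed
      qed auto
      finally show ?thesis by (simp add: D_def)
    qed
    ultimately show ?thesis by simp
  qed
  have D_small: "D \<le> 16 * B ^ 4 * s" if s: "s > 0" "4 * B\<^sup>2 * s \<le> 1" for s
  proof -
    let ?c = "s * D - 16 * B ^ 4 * s\<^sup>2"
    \<comment> \<open>The increments telescope from \<open>conv_power G \<mu> 0\<close>, a point
      mass with entropy 0.\<close>
    have "real m * ?c \<le> pmf_entropy (?W m)" for m
    proof (induction m)
      case 0
      then show ?case by (simp add: pmf_entropy_def)
    next
      case (Suc m)
      have "real (Suc m) * ?c = real m * ?c + ?c" by (simp add: algebra_simps)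
      then show ?case using Suc step[OF s, of m] by linarith
    qed
    then have c_le: "?c \<le> \<epsilon>" if "\<epsilon> > 0" for \<epsilon>
    proof -
      obtain m where m: "m \<ge> 1" "pmf_entropy (?W m) \<le> \<epsilon> * real m" using sublinear[OF \<open>\<epsilon> > 0\<close>] by blast
      have "real m * ?c \<le> real m * \<epsilon>"
        using \<open>real m * ?c \<le> pmf_entropy (?W m)\<close> m(2) by (simp add: mult.commute)
      then show ?thesis by (rule mult_left_le_imp_le) (use m(1) in simp)
    qed
    have "?c \<le> 0"
    proof (rule field_le_epsilon)
      show "?c \<le> 0 + e" if "e > 0" for e using c_le[OF that] by simp
    qed
    moreover have "s * (16 * B ^ 4 * s) = 16 * B ^ 4 * s\<^sup>2" by (simp add: power2_eq_square)
    ultimately have "s * D \<le> s * (16 * B ^ 4 * s)" by linarith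
    then show ?thesis using s by simp
  qed
  have "D \<le> 0"
  proof (rule field_le_epsilon)
    fix e :: real assume e: "e > 0"
    \<comment> \<open>The first entry of the minimum makes s admissible, the second makes the error
      at most e. The summands 1 keep the denominators positive when B = 0.\<close>
    define s where "s = min (1 / (4 * B\<^sup>2 + 1)) (e / (16 * B ^ 4 + 1))"
    have pos: "4 * B\<^sup>2 + 1 > 0" "16 * B ^ 4 + 1 > 0"
      using zero_le_power2[of B] B by (auto intro!: add_nonneg_pos)
    have s: "s > 0" using e pos by (simp add: s_def)
    have "(4 * B\<^sup>2 + 1) * s \<le> (4 * B\<^sup>2 + 1) * (1 / (4 * B\<^sup>2 + 1))"
      by (rule mult_left_mono) (use pos in \<open>auto simp: s_def\<close>)
    then have 1: "4 * B\<^sup>2 * s \<le> 1" using pos s by (simp add: algebra_simps)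
    have "(16 * B ^ 4 + 1) * s \<le> (16 * B ^ 4 + 1) * (e / (16 * B ^ 4 + 1))"
      by (rule mult_left_mono) (use pos in \<open>auto simp: s_def\<close>)
    also have "\<dots> = e" using pos by simp
    finally have 2: "16 * B ^ 4 * s \<le> e" using s by (simp add: algebra_simps)
    show "D \<le> 0 + e" using D_small[OF s 1] 2 by simp
  qed
  moreover have "integrable \<mu> (\<lambda>x. (d x)\<^sup>2)"
  proof (rule bounded_integrable_pmf[where c="(2 * B)\<^sup>2"])
    fix x assume "x \<in> set_pmf \<mu>"
    then have "\<bar>d x\<bar> \<le> 2 * B" using \<mu> d_bnd by auto
    then show "\<bar>(d x)\<^sup>2\<bar> \<le> (2 * B)\<^sup>2"
      using B by (simp only: abs_power2 power2_le_iff_abs_le)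
  qed
  ultimately have "AE x in \<mu>. (d x)\<^sup>2 = 0"
    by (subst integral_nonneg_eq_0_iff_AE[symmetric]) (auto simp: D_def intro!: antisym)
  then show ?thesis using x by (auto simp: AE_measure_pmf_iff d_def)
qed

section \<open>Entropy bounds from polynomial growth\<close>

lemma nn_integral_fibre_card:
  fixes Q :: "nat \<Rightarrow> real" and T :: "'a \<Rightarrow> nat"
  assumes fin: "\<And>t. finite {x \<in> A. T x = t}"
    and Q: "\<And>t. Q t \<ge> 0"
  shows "(\<integral>\<^sup>+x. ennreal (Q (T x)) \<partial>count_space A)
       = (\<Sum>t. ennreal (real (card {x \<in> A. T x = t}) * Q t))"
proof -
  have "(\<integral>\<^sup>+x. ennreal (Q (T x)) \<partial>count_space A)
      = (\<integral>\<^sup>+x. (\<Sum>t. ennreal (Q t) * indicator {x \<in> A. T x = t} x) \<partial>count_space A)"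
  proof (rule nn_integral_cong)
    fix x assume "x \<in> space (count_space A)"
    then have "(\<lambda>t. ennreal (Q t) * indicator {x \<in> A. T x = t} x) = (\<lambda>t. if t = T x then ennreal (Q t) else 0)"
      by (auto simp: indicator_def)
    moreover have "(\<lambda>t. if t = T x then ennreal (Q t) else 0) sums ennreal (Q (T x))"
      by (rule sums_single)
    ultimately show "ennreal (Q (T x)) = (\<Sum>t. ennreal (Q t) * indicator {x \<in> A. T x = t} x)"
      by (simp add: sums_iff)
  qed
  also have "\<dots> = (\<Sum>t. \<integral>\<^sup>+x. ennreal (Q t) * indicator {x \<in> A. T x = t} x \<partial>count_space A)"
    by (rule nn_integral_suminf) simp
  also have "\<dots> = (\<Sum>t. ennreal (real (card {x \<in> A. T x = t}) * Q t))"
  proof (intro suminf_cong)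
    fix t
    have "(\<integral>\<^sup>+x. ennreal (Q t) * indicator {x \<in> A. T x = t} x \<partial>count_space A)
        = ennreal (Q t) * emeasure (count_space A) {x \<in> A. T x = t}"
      by (rule nn_integral_cmult_indicator) simp
    also have "emeasure (count_space A) {x \<in> A. T x = t} = ennreal (real (card {x \<in> A. T x = t}))"
      using fin[of t] by (subst emeasure_count_space_finite) (auto simp: ennreal_of_nat_eq_real_of_nat)
    finally show "(\<integral>\<^sup>+x. ennreal (Q t) * indicator {x \<in> A. T x = t} x \<partial>count_space A)
        = ennreal (real (card {x \<in> A. T x = t}) * Q t)"
      using Q[of t] by (simp add: ennreal_mult mult.commute)
  qed
  finally show ?thesis .
qed

text \<open>Gibbs' inequality against the weight \<open>1 / (c T\<^sup>r\<^sup>+\<^sup>2)\<close>, which is summable over \<open>A\<close>.\<close>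

lemma pmf_entropy_le_expectation_ln:
  fixes T :: "'a \<Rightarrow> nat" and c :: real
  assumes c: "c > 0" and T1: "\<And>x. x \<in> A \<Longrightarrow> T x \<ge> 1"
    and fin: "\<And>t. finite {x \<in> A. T x = t}"
    and card: "\<And>t. t \<ge> 1 \<Longrightarrow> real (card {x \<in> A. T x = t}) \<le> c * real t ^ r"
  obtains C where "\<And>W. set_pmf W \<subseteq> A \<Longrightarrow> integrable (measure_pmf W) (\<lambda>x. ln (real (T x))) \<Longrightarrow>
      integrable (measure_pmf W) (\<lambda>x. ln (pmf W x)) \<and>
      pmf_entropy W \<le> (real r + 2) * measure_pmf.expectation W (\<lambda>x. ln (real (T x))) + C"
proof
  \<comment> \<open>The at most \<open>c * t ^ r\<close> elements of a fibre have total weight at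
    most 1 / t^2. At t = 0 division by zero gives weight 0.\<close>
  define Q :: "nat \<Rightarrow> real" where "Q t = 1 / (c * real t ^ (r + 2))" for t
  define S :: real where "S = (\<Sum>t. 1 / real t ^ 2)"
  have Q_nonneg: "Q t \<ge> 0" for t using c by (simp add: Q_def)
  have summ: "summable (\<lambda>t. 1 / real t ^ 2)"
    using inverse_power_summable[of 2, where 'a=real] by (simp add: inverse_eq_divide)
  have S: "S \<ge> 0" unfolding S_def by (rule suminf_nonneg[OF summ]) simp
  have sumQ: "(\<integral>\<^sup>+x. ennreal (Q (T x)) \<partial>count_space A) \<le> ennreal S"
  proof -
    have "(\<integral>\<^sup>+x. ennreal (Q (T x)) \<partial>count_space A)
        = (\<Sum>t. ennreal (real (card {x \<in> A. T x = t}) * Q t))"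
      by (rule nn_integral_fibre_card[OF fin Q_nonneg])
    also have "\<dots> \<le> (\<Sum>t. ennreal (1 / real t ^ 2))"
    proof (intro suminf_le ennreal_leI)
      fix t
      show "real (card {x \<in> A. T x = t}) * Q t \<le> 1 / real t ^ 2"
      proof (cases "t = 0")
        case False
        then have "real (card {x \<in> A. T x = t}) * Q t \<le> (c * real t ^ r) * Q t"
          by (intro mult_right_mono card Q_nonneg) simp
        also have "\<dots> = 1 / real t ^ 2" using c False by (simp add: Q_def power_add power2_eq_square)
        finally show ?thesis .
      qed (simp add: Q_def)
    qed auto
    also have "\<dots> = ennreal S" unfolding S_def by (rule suminf_ennreal2[OF _ summ]) simp
    finally show ?thesis .
  qed
  fix W :: "'a pmf"
  assume W: "set_pmf W \<subseteq> A" and intT: "integrable (measure_pmf W) (\<lambda>x. ln (real (T x)))"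
  define u where "u x = Q (T x) / pmf W x" for x
  have u_nonneg: "u x \<ge> 0" for x by (simp add: u_def Q_nonneg)
  have "(\<integral>\<^sup>+x. ennreal (u x) \<partial>W) = (\<integral>\<^sup>+x. ennreal (pmf W x) * ennreal (u x) \<partial>count_space UNIV)"
    by (rule nn_integral_measure_pmf)
  also have "\<dots> \<le> (\<integral>\<^sup>+x. ennreal (Q (T x)) * indicator A x \<partial>count_space UNIV)"
  proof (rule nn_integral_mono)
    fix x
    show "ennreal (pmf W x) * ennreal (u x) \<le> ennreal (Q (T x)) * indicator A x"
      by (cases "x \<in> set_pmf W")
         (use W in \<open>auto simp: u_def set_pmf_iff indicator_def ennreal_mult'[symmetric]\<close>)
  qed
  also have "\<dots> = (\<integral>\<^sup>+x. ennreal (Q (T x)) \<partial>count_space A)"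
    by (simp add: nn_integral_count_space_indicator)
  also note sumQ
  finally have uS: "(\<integral>\<^sup>+x. ennreal (u x) \<partial>W) \<le> ennreal S" .
  have int_u: "integrable W u"
    by (rule integrableI_nonneg)
       (use uS in \<open>auto simp: u_nonneg top.not_eq_extremum[symmetric] top_unique\<close>)
  have Eu: "measure_pmf.expectation W u \<le> S"
    using uS S by (subst (asm) nn_integral_eq_integral[OF int_u]) (auto simp: u_nonneg)
  \<comment> \<open>This is \<open>- ln (Q (T x)) + (u x - 1)\<close>. By
    \<open>ln u \<le> u - 1\<close> for the likelihood ratio u it dominates
    \<open>- ln (pmf W x)\<close> pointwise, which yields integrability and the bound on the mean at
    once.\<close>
  let ?b = "\<lambda>x. ln c + (real r + 2) * ln (real (T x)) + u x - 1"
  have int_b: "integrable W ?b" using int_u intT by simp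
  have le: "AE x in W. 0 \<le> - ln (pmf W x) \<and> - ln (pmf W x) \<le> ?b x"
  proof (simp only: AE_measure_pmf_iff, intro ballI conjI)
    fix x assume x: "x \<in> set_pmf W"
    have pos: "pmf W x > 0" using x by (simp add: pmf_positive)
    show "0 \<le> - ln (pmf W x)" using pos pmf_le_1[of W x] by simp
    have t: "T x \<ge> 1" using T1 W x by auto
    have Qpos: "Q (T x) > 0" using t c by (simp add: Q_def)
    have "ln (u x) \<le> u x - 1" using pos Qpos by (intro ln_le_minus_one) (simp add: u_def)
    moreover have "ln (u x) = ln (Q (T x)) - ln (pmf W x)"
      using pos Qpos by (simp add: u_def ln_div)
    moreover have "ln (Q (T x)) = - (ln c + (real r + 2) * ln (real (T x)))"
      using c t by (simp add: Q_def ln_div ln_mult ln_realpow del: power_Suc power_Suc2)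
    ultimately show "- ln (pmf W x) \<le> ?b x" by simp
  qed
  have int: "integrable W (\<lambda>x. ln (pmf W x))"
  proof (rule Bochner_Integration.integrable_bound[OF int_b])
    show "AE x in W. norm (ln (pmf W x)) \<le> norm (?b x)" using le by eventually_elim auto
  qed simp
  have "pmf_entropy W \<le> measure_pmf.expectation W ?b"
    unfolding pmf_entropy_def
  proof (rule integral_mono_AE)
    show "AE x in W. - ln (pmf W x) \<le> ?b x" using le by eventually_elim auto
  qed (use int int_b in auto)
  also have "\<dots> = (real r + 2) * measure_pmf.expectation W (\<lambda>x. ln (real (T x))) + (ln c - 1)
      + measure_pmf.expectation W u"
    using int_u intT by simp
  finally show "integrable (measure_pmf W) (\<lambda>x. ln (pmf W x)) \<and>
      pmf_entropy W \<le> (real r + 2) * measure_pmf.expectation W (\<lambda>x. ln (real (T x))) + (ln c - 1 + S)"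
    using Eu int by simp
qed

section \<open>Sums of independent integrable variables\<close>

lemma replicate_pmf_Suc_pair:
  "replicate_pmf (Suc n) p = map_pmf (\<lambda>(x, xs). x # xs) (pair_pmf p (replicate_pmf n p))"
  by (simp add: pair_pmf_def map_bind_pmf)

lemma expectation_sum_list_replicate_pmf:
  fixes g :: "'a \<Rightarrow> real"
  assumes g: "integrable (measure_pmf p) g"
  shows "integrable (measure_pmf (replicate_pmf n p)) (\<lambda>xs. sum_list (map g xs))"
    and "measure_pmf.expectation (replicate_pmf n p) (\<lambda>xs. sum_list (map g xs))
         = real n * measure_pmf.expectation p g"
proof -
  have "integrable (measure_pmf (replicate_pmf n p)) (\<lambda>xs. sum_list (map g xs)) \<and>
    measure_pmf.expectation (replicate_pmf n p) (\<lambda>xs. sum_list (map g xs))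
         = real n * measure_pmf.expectation p g"
  proof (induction n)
    case 0
    then show ?case by (simp add: integrable_measure_pmf_finite)
  next
    case (Suc n)
    let ?P = "pair_pmf p (replicate_pmf n p)"
    have 1: "integrable ?P (\<lambda>z. g (fst z))"
      using g integrable_map_pmf_eq[of fst ?P g] by (simp add: map_fst_pair_pmf)
    have 2: "integrable ?P (\<lambda>z. sum_list (map g (snd z)))"
      using Suc integrable_map_pmf_eq[of snd ?P "\<lambda>xs. sum_list (map g xs)"] by (simp add: map_snd_pair_pmf)
    have 3: "measure_pmf.expectation ?P (\<lambda>z. sum_list (map g (snd z))) = real n * measure_pmf.expectation p g"
      using Suc expectation_pair_pmf_snd[of p "replicate_pmf n p" "\<lambda>xs. sum_list (map g xs)"] by simp
    show ?case
      unfolding replicate_pmf_Suc_pair using 1 2 3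
      by (simp add: case_prod_beta' algebra_simps)
  qed
  then show "integrable (measure_pmf (replicate_pmf n p)) (\<lambda>xs. sum_list (map g xs))"
    and "measure_pmf.expectation (replicate_pmf n p) (\<lambda>xs. sum_list (map g xs))
         = real n * measure_pmf.expectation p g" by blast+
qed

lemma abs_sum_list_le:
  fixes Y :: "'a \<Rightarrow> real"
  assumes "\<And>x. x \<in> set xs \<Longrightarrow> \<bar>Y x\<bar> \<le> B"
  shows "\<bar>sum_list (map Y xs)\<bar> \<le> real (length xs) * B"
  using assms
proof (induction xs)
  case (Cons x xs)
  then have "\<bar>Y x\<bar> \<le> B" "\<bar>sum_list (map Y xs)\<bar> \<le> real (length xs) * B" by auto
  then show ?case by (simp add: algebra_simps)
qed simp

lemma second_moment_sum_list_replicate_pmf: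
  fixes Y :: "'a \<Rightarrow> real"
  assumes B: "\<And>x. x \<in> set_pmf p \<Longrightarrow> \<bar>Y x\<bar> \<le> B" and EY: "measure_pmf.expectation p Y = 0"
  shows "measure_pmf.expectation (replicate_pmf n p) (\<lambda>xs. (sum_list (map Y xs))\<^sup>2) \<le> real n * B\<^sup>2"
proof (induction n)
  case 0
  then show ?case by simp
next
  case (Suc n)
  let ?R = "replicate_pmf n p"
  let ?S = "\<lambda>xs. sum_list (map Y xs)"
  have intY: "integrable p Y" by (rule bounded_integrable_pmf[OF B])
  have sq: "(Y x)\<^sup>2 \<le> B\<^sup>2" if "x \<in> set_pmf p" for x
    using B[OF that] by (metis abs_ge_zero abs_le_square_iff abs_of_nonneg order_trans)
  have S_bnd: "\<bar>?S xs\<bar> \<le> real n * B" if "xs \<in> set_pmf ?R" for xs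
    using that abs_sum_list_le[of xs Y B] B by (auto simp: set_replicate_pmf)
  have intS: "integrable ?R ?S" by (rule expectation_sum_list_replicate_pmf[OF intY])
  have ES: "measure_pmf.expectation ?R ?S = 0"
    by (simp add: expectation_sum_list_replicate_pmf[OF intY] EY)
  have intS2: "integrable ?R (\<lambda>xs. (?S xs)\<^sup>2)"
  proof (rule bounded_integrable_pmf[where c="(real n * B)\<^sup>2"])
    fix xs assume "xs \<in> set_pmf ?R"
    from S_bnd[OF this] show "\<bar>(?S xs)\<^sup>2\<bar> \<le> (real n * B)\<^sup>2"
      by (metis abs_ge_zero abs_le_square_iff abs_of_nonneg order_trans abs_power2)
  qed
  have "measure_pmf.expectation (replicate_pmf (Suc n) p) (\<lambda>xs. (?S xs)\<^sup>2)
      = measure_pmf.expectation (pair_pmf p ?R) (\<lambda>(x, xs). (Y x + ?S xs)\<^sup>2)"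
    unfolding replicate_pmf_Suc_pair by (simp add: case_prod_beta')
  also have "\<dots> = measure_pmf.expectation p (\<lambda>x. measure_pmf.expectation ?R (\<lambda>xs. (Y x + ?S xs)\<^sup>2))"
  proof (subst integral_pair_pmf_bounded[where c="(B + real n * B)\<^sup>2"])
    fix x xs assume "x \<in> set_pmf p" "xs \<in> set_pmf ?R"
    then have "\<bar>Y x + ?S xs\<bar> \<le> B + real n * B" using B[of x] S_bnd[of xs] by linarith
    then show "\<bar>case (x, xs) of (x, xs) \<Rightarrow> (Y x + ?S xs)\<^sup>2\<bar> \<le> (B + real n * B)\<^sup>2"
      by (simp only: prod.case abs_power2) (metis abs_ge_zero abs_le_square_iff abs_of_nonneg order_trans)
  qed simp
  also have "\<dots> = measure_pmf.expectation p (\<lambda>x. (Y x)\<^sup>2 + measure_pmf.expectation ?R (\<lambda>xs. (?S xs)\<^sup>2))"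
  proof (intro Bochner_Integration.integral_cong refl)
    fix x
    have "measure_pmf.expectation ?R (\<lambda>xs. (Y x + ?S xs)\<^sup>2)
        = measure_pmf.expectation ?R (\<lambda>xs. (Y x)\<^sup>2 + 2 * Y x * ?S xs + (?S xs)\<^sup>2)"
      by (simp add: power2_sum algebra_simps)
    also have "\<dots> = (Y x)\<^sup>2 + 2 * Y x * measure_pmf.expectation ?R ?S
        + measure_pmf.expectation ?R (\<lambda>xs. (?S xs)\<^sup>2)"
      using intS intS2 by simp
    finally show "measure_pmf.expectation ?R (\<lambda>xs. (Y x + ?S xs)\<^sup>2)
        = (Y x)\<^sup>2 + measure_pmf.expectation ?R (\<lambda>xs. (?S xs)\<^sup>2)" by (simp add: ES)
  qed
  also have "\<dots> \<le> measure_pmf.expectation p (\<lambda>x. B\<^sup>2 + real n * B\<^sup>2)"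
  proof (rule integral_mono_AE)
    have "integrable p (\<lambda>x. (Y x)\<^sup>2)"
      by (rule bounded_integrable_pmf[where c="B\<^sup>2"]) (simp add: sq)
    then show "integrable p (\<lambda>x. (Y x)\<^sup>2 + measure_pmf.expectation ?R (\<lambda>xs. (?S xs)\<^sup>2))" by simp
  qed (use sq Suc in \<open>auto simp: AE_measure_pmf_iff intro!: add_mono\<close>)
  also have "\<dots> = real (Suc n) * B\<^sup>2" by (simp add: algebra_simps)
  finally show ?case .
qed

lemma expectation_truncation_tail_small:
  fixes X :: "'a \<Rightarrow> real"
  assumes X: "integrable (measure_pmf p) X" and e: "\<epsilon> > 0"
  obtains M where "M > 0" "measure_pmf.expectation p (\<lambda>x. if \<bar>X x\<bar> \<le> M then 0 else \<bar>X x\<bar>) \<le> \<epsilon>"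
proof -
  have "(\<lambda>k. measure_pmf.expectation p (\<lambda>x. if \<bar>X x\<bar> \<le> real k then 0 else \<bar>X x\<bar>))
      \<longlonglongrightarrow> measure_pmf.expectation p (\<lambda>x. 0)"
  proof (rule integral_dominated_convergence[where w="\<lambda>x. \<bar>X x\<bar>"])
    show "AE x in p. (\<lambda>k. if \<bar>X x\<bar> \<le> real k then 0 else \<bar>X x\<bar>) \<longlonglongrightarrow> 0"
    proof (rule AE_I2)
      fix x
      obtain k0 :: nat where "\<bar>X x\<bar> \<le> real k0" using real_arch_simple by blast
      then have "\<forall>\<^sub>F k in sequentially. (if \<bar>X x\<bar> \<le> real k then 0 else \<bar>X x\<bar>) = 0"
        by (intro eventually_sequentiallyI[of k0]) auto
      then show "(\<lambda>k. if \<bar>X x\<bar> \<le> real k then 0 else \<bar>X x\<bar>) \<longlonglongrightarrow> 0"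
        by (rule tendsto_eventually)
    qed
  qed (use X in auto)
  then have "\<forall>\<^sub>F k in sequentially. measure_pmf.expectation p (\<lambda>x. if \<bar>X x\<bar> \<le> real k then 0 else \<bar>X x\<bar>) < \<epsilon>"
    using e by (intro order_tendstoD(2)) auto
  then obtain k0 where "\<And>k. k \<ge> k0 \<Longrightarrow> measure_pmf.expectation p (\<lambda>x. if \<bar>X x\<bar> \<le> real k then 0 else \<bar>X x\<bar>) < \<epsilon>"
    by (auto simp: eventually_sequentially)
  from this[of "Suc k0"] show ?thesis by (intro that[of "real (Suc k0)"]) auto
qed

text \<open>This is the law of large numbers in L1, by truncation at M. The bounded part is
  controlled by its second moment, the tail by its small first moment. The mean m of the truncated
  part is moved to the tail, so that \<open>Y'\<close> is centred.\<close>

lemma expectation_abs_sum_list_sublinear: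
  fixes X :: "'a \<Rightarrow> real"
  assumes X: "integrable (measure_pmf p) X" and EX: "measure_pmf.expectation p X = 0" and e: "\<epsilon> > 0"
  obtains n0 where "\<And>n. n \<ge> n0 \<Longrightarrow>
      measure_pmf.expectation (replicate_pmf n p) (\<lambda>xs. \<bar>sum_list (map X xs)\<bar>) \<le> \<epsilon> * real n"
proof -
  obtain M where M: "M > 0" "measure_pmf.expectation p (\<lambda>x. if \<bar>X x\<bar> \<le> M then 0 else \<bar>X x\<bar>) \<le> \<epsilon> / 4"
    using expectation_truncation_tail_small[OF X, of "\<epsilon> / 4"] e by auto
  define Y where "Y x = (if \<bar>X x\<bar> \<le> M then X x else 0)" for x
  define Z where "Z x = (if \<bar>X x\<bar> \<le> M then 0 else X x)" for x
  define m where "m = measure_pmf.expectation p Y"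
  define Y' where "Y' x = Y x - m" for x
  define Z' where "Z' x = Z x + m" for x
  have intY: "integrable p Y"
    by (rule bounded_integrable_pmf[where c=M]) (use M in \<open>auto simp: Y_def\<close>)
  have XYZ: "X x = Y x + Z x" and XYZ': "X x = Y' x + Z' x" for x
    by (auto simp: Y_def Z_def Y'_def Z'_def)
  have intZ: "integrable p Z"
  proof -
    have "Z = (\<lambda>x. X x - Y x)" using XYZ by auto
    then show ?thesis using X intY by simp
  qed
  have EZ: "measure_pmf.expectation p Z = - m"
    using EX intY intZ unfolding XYZ[abs_def] m_def by simp
  have absZ: "measure_pmf.expectation p (\<lambda>x. \<bar>Z x\<bar>) \<le> \<epsilon> / 4"
  proof -
    have "(\<lambda>x. \<bar>Z x\<bar>) = (\<lambda>x. if \<bar>X x\<bar> \<le> M then 0 else \<bar>X x\<bar>)" by (auto simp: Z_def)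
    then show ?thesis using M by simp
  qed
  have m_le: "\<bar>m\<bar> \<le> \<epsilon> / 4"
    using absZ integral_abs_bound[of p Z] EZ by simp
  have absZ': "measure_pmf.expectation p (\<lambda>x. \<bar>Z' x\<bar>) \<le> \<epsilon> / 2"
  proof -
    have "measure_pmf.expectation p (\<lambda>x. \<bar>Z' x\<bar>) \<le> measure_pmf.expectation p (\<lambda>x. \<bar>Z x\<bar> + \<bar>m\<bar>)"
      by (rule integral_mono_AE) (use intZ in \<open>auto simp: Z'_def[abs_def]\<close>)
    also have "\<dots> = measure_pmf.expectation p (\<lambda>x. \<bar>Z x\<bar>) + \<bar>m\<bar>" using intZ by simp
    finally show ?thesis using absZ m_le by simp
  qed
  have intZ': "integrable p (\<lambda>x. \<bar>Z' x\<bar>)" using intZ by (simp add: Z'_def[abs_def])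
  define B where "B = M + \<bar>m\<bar>"
  have Y'_bnd: "\<bar>Y' x\<bar> \<le> B" for x using M by (auto simp: Y'_def Y_def B_def)
  have EY': "measure_pmf.expectation p Y' = 0" using intY by (simp add: Y'_def[abs_def] m_def)
  obtain n1 :: nat where n1: "B\<^sup>2 * 16 / \<epsilon>\<^sup>2 \<le> real n1" using real_arch_simple by blast
  show ?thesis
  proof (rule that)
    fix n assume n: "n \<ge> Suc n1"
    \<comment> \<open>With this weight, \<bar>S\<bar> \<le> S^2 / (2 a) + a / 2 leaves two terms of
      mean at most \<open>\<epsilon> * real n / 4\<close> each, once n exceeds the bound on
      \<open>n1\<close>. The tail accounts for the remaining half of
      \<open>\<epsilon> * real n\<close>.\<close>
    define a where "a = \<epsilon> * real n / 2"
    have a: "a > 0" using e n by (simp add: a_def)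
    let ?R = "replicate_pmf n p"
    let ?SY = "\<lambda>xs. sum_list (map Y' xs)"
    let ?SZ = "\<lambda>xs. sum_list (map (\<lambda>x. \<bar>Z' x\<bar>) xs)"
    have SY_bnd: "\<bar>?SY xs\<bar> \<le> real n * B" if "xs \<in> set_pmf ?R" for xs
      using that abs_sum_list_le[of xs Y' B] Y'_bnd by (auto simp: set_replicate_pmf)
    have intSY2: "integrable ?R (\<lambda>xs. (?SY xs)\<^sup>2)"
    proof (rule bounded_integrable_pmf[where c="(real n * B)\<^sup>2"])
      fix xs assume "xs \<in> set_pmf ?R"
      from SY_bnd[OF this] show "\<bar>(?SY xs)\<^sup>2\<bar> \<le> (real n * B)\<^sup>2"
        by (metis abs_ge_zero abs_le_square_iff abs_of_nonneg order_trans abs_power2)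
    qed
    note intSZ = expectation_sum_list_replicate_pmf[OF intZ', of n]
    have pw: "\<bar>sum_list (map X xs)\<bar> \<le> (?SY xs)\<^sup>2 / (2 * a) + a / 2 + ?SZ xs" for xs
    proof -
      have "sum_list (map X xs) = ?SY xs + sum_list (map Z' xs)"
        unfolding XYZ'[abs_def] by (simp add: sum_list_addf)
      moreover have "\<bar>sum_list (map Z' xs)\<bar> \<le> ?SZ xs"
        using sum_list_abs[of "map Z' xs"] by (simp add: o_def)
      moreover have "\<bar>?SY xs\<bar> \<le> (?SY xs)\<^sup>2 / (2 * a) + a / 2"
      proof -
        have "0 \<le> (\<bar>?SY xs\<bar> - a)\<^sup>2" by simp
        then have "\<bar>?SY xs\<bar> * (2 * a) \<le> (?SY xs)\<^sup>2 + a\<^sup>2"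
          by (simp add: power2_diff)
        then have "\<bar>?SY xs\<bar> \<le> ((?SY xs)\<^sup>2 + a\<^sup>2) / (2 * a)"
          using a by (subst pos_le_divide_eq) auto
        also have "\<dots> = (?SY xs)\<^sup>2 / (2 * a) + a / 2"
          using a by (simp add: add_divide_distrib power2_eq_square)
        finally show ?thesis .
      qed
      ultimately show ?thesis by linarith
    qed
    have "measure_pmf.expectation ?R (\<lambda>xs. \<bar>sum_list (map X xs)\<bar>)
        \<le> measure_pmf.expectation ?R (\<lambda>xs. (?SY xs)\<^sup>2 / (2 * a) + a / 2 + ?SZ xs)"
      by (rule integral_mono_AE)
         (use pw intSY2 intSZ(1) expectation_sum_list_replicate_pmf(1)[OF X, of n] in auto)
    also have "\<dots> = measure_pmf.expectation ?R (\<lambda>xs. (?SY xs)\<^sup>2) / (2 * a) + a / 2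
        + measure_pmf.expectation ?R ?SZ"
      using intSY2 intSZ(1) by simp
    also have "\<dots> \<le> real n * B\<^sup>2 / (2 * a) + a / 2 + real n * (\<epsilon> / 2)"
    proof (intro add_mono divide_right_mono order_refl)
      show "measure_pmf.expectation ?R ?SZ \<le> real n * (\<epsilon> / 2)"
        unfolding intSZ(2) by (rule mult_left_mono[OF absZ']) simp
      show "measure_pmf.expectation ?R (\<lambda>xs. (?SY xs)\<^sup>2) \<le> real n * B\<^sup>2"
        by (rule second_moment_sum_list_replicate_pmf) (use Y'_bnd EY' in auto)
    qed (use a in auto)
    also have "real n * B\<^sup>2 / (2 * a) \<le> a / 2"
    proof -
      have "B\<^sup>2 * 16 / \<epsilon>\<^sup>2 \<le> real n" using n1 n by linarith
      then have "B\<^sup>2 * 16 \<le> real n * \<epsilon>\<^sup>2" using e by (simp add: pos_divide_le_eq)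
      then have "4 * B\<^sup>2 \<le> real n * \<epsilon>\<^sup>2" using zero_le_power2[of B] by linarith
      then have "4 * B\<^sup>2 * real n \<le> (real n * \<epsilon>\<^sup>2) * real n"
        by (rule mult_right_mono) simp
      also have "\<dots> = 4 * a\<^sup>2" by (simp add: a_def power2_eq_square)
      finally have "real n * B\<^sup>2 \<le> a / 2 * (2 * a)" by (simp add: power2_eq_square mult_ac)
      then show ?thesis using a by (subst pos_divide_le_eq) auto
    qed
    finally show "measure_pmf.expectation ?R (\<lambda>xs. \<bar>sum_list (map X xs)\<bar>) \<le> \<epsilon> * real n"
      by (simp add: a_def)
  qed
qed

section \<open>Recurrent integrable walks on the integers are centred\<close>

lemma prob_space_increments: "prob_space (increments \<mu>)"
  unfolding increments_def by (intro prob_space_PiM) (rule measure_pmf.prob_space_axioms)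

lemma space_increments [simp]: "space (increments \<mu>) = UNIV"
  by (simp add: increments_def space_PiM PiE_def)

lemma measurable_increments_component: "(\<lambda>\<omega>. f (\<omega> i)) \<in> borel_measurable (increments \<mu>)"
proof -
  have "(\<lambda>\<omega>. \<omega> i) \<in> measurable (increments \<mu>) (measure_pmf \<mu>)"
    unfolding increments_def by (rule measurable_component_singleton) simp
  from measurable_comp[OF this, of f borel] show ?thesis by (simp add: o_def)
qed

lemma measurable_increments_shift [measurable]:
  "(\<lambda>\<omega> k. \<omega> (Suc k)) \<in> measurable (increments \<mu>) (increments \<mu>)"
  unfolding increments_def by (rule measurable_PiM_single') (auto simp: space_PiM)

lemma distr_increments_shift: "distr (increments \<mu>) (increments \<mu>) (\<lambda>\<omega> k. \<omega> (Suc k)) = increments \<mu>"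
  using distr_PiM_reindex[of UNIV "\<lambda>_. measure_pmf \<mu>" Suc UNIV]
  by (simp add: increments_def measure_pmf.prob_space_axioms restrict_UNIV)

lemma increments_component:
  fixes z :: "'a \<Rightarrow> real"
  assumes z: "integrable (measure_pmf \<mu>) z"
  shows "integrable (increments \<mu>) (\<lambda>\<omega>. z (\<omega> i))"
    and "(\<integral>\<omega>. z (\<omega> i) \<partial>increments \<mu>) = measure_pmf.expectation \<mu> z"
proof -
  have d: "distr (increments \<mu>) (measure_pmf \<mu>) (\<lambda>\<omega>. \<omega> i) = measure_pmf \<mu>"
    unfolding increments_def by (rule distr_PiM_component) (auto intro: measure_pmf.prob_space_axioms)
  have m: "(\<lambda>\<omega>. \<omega> i) \<in> measurable (increments \<mu>) (measure_pmf \<mu>)"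
    unfolding increments_def by (rule measurable_component_singleton) simp
  show "integrable (increments \<mu>) (\<lambda>\<omega>. z (\<omega> i))"
    using z by (subst (asm) d[symmetric]) (simp add: integrable_distr_eq[OF m])
  show "(\<integral>\<omega>. z (\<omega> i) \<partial>increments \<mu>) = measure_pmf.expectation \<mu> z"
    using integral_distr[OF m, of z] by (simp add: d)
qed

text \<open>Running maximum \<open>max (0, T\<^sub>1, \<dots>, T\<^sub>m)\<close> of the partial sums \<open>T\<^sub>k = z \<omega>\<^sub>0 + \<dots> + z \<omega>\<^bsub>k-1\<^esub>\<close>,
  unfolded from the first step on.\<close>

primrec running_max :: "('a \<Rightarrow> real) \<Rightarrow> nat \<Rightarrow> (nat \<Rightarrow> 'a) \<Rightarrow> real" where
  "running_max z 0 \<omega> = 0"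
| "running_max z (Suc m) \<omega> = max 0 (z (\<omega> 0) + running_max z m (\<lambda>k. \<omega> (Suc k)))"

lemma running_max_nonneg: "running_max z m \<omega> \<ge> 0"
  by (cases m) auto

lemma running_max_mono: "running_max z m \<omega> \<le> running_max z (Suc m) \<omega>"
proof (induction m arbitrary: \<omega>)
  case (Suc m)
  let ?\<theta> = "\<lambda>k. \<omega> (Suc k)"
  have "max 0 (z (\<omega> 0) + running_max z m ?\<theta>) \<le> max 0 (z (\<omega> 0) + running_max z (Suc m) ?\<theta>)"
    by (intro max.mono add_left_mono Suc order_refl)
  then show ?case by (simp only: running_max.simps(2))
qed simp

lemma running_max_mono': "m \<le> m' \<Longrightarrow> running_max z m \<omega> \<le> running_max z m' \<omega>"
  by (rule lift_Suc_mono_le[of "\<lambda>m. running_max z m \<omega>"]) (rule running_max_mono)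

lemma sum_le_running_max: "(\<Sum>j<k. z (\<omega> j)) \<le> running_max z k \<omega>"
proof (induction k arbitrary: \<omega>)
  case (Suc k)
  have "(\<Sum>j<Suc k. z (\<omega> j)) = z (\<omega> 0) + (\<Sum>j<k. z (\<omega> (Suc j)))"
    by (rule sum.lessThan_Suc_shift)
  then show ?case using Suc[of "\<lambda>k. \<omega> (Suc k)"] by simp
qed simp

lemma integrable_running_max:
  assumes z: "integrable (measure_pmf \<mu>) z"
  shows "integrable (increments \<mu>) (running_max z m)"
proof (induction m)
  case 0
  interpret prob_space "increments \<mu>" by (rule prob_space_increments)
  show ?case by simp
next
  case (Suc m)
  have "integrable (distr (increments \<mu>) (increments \<mu>) (\<lambda>\<omega> k. \<omega> (Suc k))) (running_max z m)"
    using Suc by (simp add: distr_increments_shift)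
  then have "integrable (increments \<mu>) (\<lambda>\<omega>. running_max z m (\<lambda>k. \<omega> (Suc k)))"
    by (subst (asm) integrable_distr_eq) (use Suc in auto)
  then show ?case
    using increments_component(1)[OF z] by (simp add: running_max.simps(2)[abs_def])
qed

text \<open>Garsia's maximal inequality: with \<open>\<theta>\<close> the shift, \<open>M\<^sub>m - M\<^sub>m \<circ> \<theta> \<le> z \<omega>\<^sub>0\<close> where \<open>M\<^sub>m > 0\<close>, and the
  left-hand side has mean 0.\<close>

lemma expectation_running_max_pos_nonneg:
  assumes z: "integrable (measure_pmf \<mu>) z"
  shows "0 \<le> (\<integral>\<omega>. (if running_max z m \<omega> > 0 then z (\<omega> 0) else 0) \<partial>increments \<mu>)"
proof -
  let ?\<theta> = "\<lambda>\<omega>::nat \<Rightarrow> 'a. \<lambda>k. \<omega> (Suc k)"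
  let ?M = "running_max z m"
  note int = integrable_running_max[OF z, of m]
  have [measurable]: "?M \<in> borel_measurable (increments \<mu>)" using int by auto
  have shift: "integrable (increments \<mu>) (\<lambda>\<omega>. ?M (?\<theta> \<omega>))"
      "(\<integral>\<omega>. ?M (?\<theta> \<omega>) \<partial>increments \<mu>) = (\<integral>\<omega>. ?M \<omega> \<partial>increments \<mu>)"
    using integrable_distr_eq[of ?\<theta> "increments \<mu>" "increments \<mu>" ?M]
      integral_distr[of ?\<theta> "increments \<mu>" "increments \<mu>" ?M] int
    by (simp_all add: distr_increments_shift)
  have "0 = (\<integral>\<omega>. ?M \<omega> - ?M (?\<theta> \<omega>) \<partial>increments \<mu>)"
    using shift int by simp
  also have "\<dots> \<le> (\<integral>\<omega>. (if ?M \<omega> > 0 then z (\<omega> 0) else 0) \<partial>increments \<mu>)"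
  proof (rule integral_mono)
    show "integrable (increments \<mu>) (\<lambda>\<omega>. ?M \<omega> - ?M (?\<theta> \<omega>))" using shift int by simp
    show "integrable (increments \<mu>) (\<lambda>\<omega>. if ?M \<omega> > 0 then z (\<omega> 0) else 0)"
    proof (rule Bochner_Integration.integrable_bound[OF increments_component(1)[OF z, of 0]])
      show "(\<lambda>\<omega>. if ?M \<omega> > 0 then z (\<omega> 0) else 0) \<in> borel_measurable (increments \<mu>)"
        by (intro measurable_If measurable_increments_component) measurable
    qed auto
    fix \<omega>
    show "?M \<omega> - ?M (?\<theta> \<omega>) \<le> (if ?M \<omega> > 0 then z (\<omega> 0) else 0)"
    proof (cases "?M \<omega> > 0")
      case True
      then obtain m' where m': "m = Suc m'" by (cases m) auto
      then have "?M \<omega> = z (\<omega> 0) + running_max z m' (?\<theta> \<omega>)" using True by (auto split: if_splits simp: max_def)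
      also have "running_max z m' (?\<theta> \<omega>) \<le> ?M (?\<theta> \<omega>)" unfolding m' by (rule running_max_mono)
      finally show ?thesis using True by simp
    next
      case False
      then show ?thesis using running_max_nonneg[of z m \<omega>] running_max_nonneg[of z m "?\<theta> \<omega>"] by simp
    qed
  qed
  finally show ?thesis .
qed

text \<open>The events \<open>running_max z m \<omega> > 0\<close> increase with m to almost all of
  path space, so the nonnegative integrals in the maximal inequality converge to the mean of
  z.\<close>

lemma expectation_nonneg_of_AE_pos_partial_sum:
  fixes z :: "'a \<Rightarrow> real"
  assumes z: "integrable (measure_pmf \<mu>) z"
    and pos: "AE \<omega> in increments \<mu>. \<exists>k. (\<Sum>j<k. z (\<omega> j)) > 0"
  shows "measure_pmf.expectation \<mu> z \<ge> 0"
proof -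
  have [measurable]: "running_max z m \<in> borel_measurable (increments \<mu>)" for m
    using integrable_running_max[OF z, of m] by auto
  have "(\<lambda>m. \<integral>\<omega>. (if running_max z m \<omega> > 0 then z (\<omega> 0) else 0) \<partial>increments \<mu>)
      \<longlonglongrightarrow> (\<integral>\<omega>. z (\<omega> 0) \<partial>increments \<mu>)"
  proof (rule integral_dominated_convergence[where w="\<lambda>\<omega>. \<bar>z (\<omega> 0)\<bar>"])
    show "AE \<omega> in increments \<mu>. (\<lambda>m. if running_max z m \<omega> > 0 then z (\<omega> 0) else 0) \<longlonglongrightarrow> z (\<omega> 0)"
      using pos
    proof eventually_elim
      case (elim \<omega>)
      then obtain k where k: "(\<Sum>j<k. z (\<omega> j)) > 0" by blast
      have "\<forall>\<^sub>F m in sequentially. (if running_max z m \<omega> > 0 then z (\<omega> 0) else 0) = z (\<omega> 0)"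
      proof (rule eventually_sequentiallyI[of k])
        fix m assume "k \<le> m"
        then have "running_max z m \<omega> > 0"
          using k sum_le_running_max[of z \<omega> k] running_max_mono'[of k m z \<omega>] by linarith
        then show "(if running_max z m \<omega> > 0 then z (\<omega> 0) else 0) = z (\<omega> 0)" by simp
      qed
      then show ?case by (rule tendsto_eventually)
    qed
    show "(\<lambda>\<omega>. z (\<omega> 0)) \<in> borel_measurable (increments \<mu>)"
      by (rule measurable_increments_component)
    show "integrable (increments \<mu>) (\<lambda>\<omega>. \<bar>z (\<omega> 0)\<bar>)"
      using increments_component(1)[OF z, of 0] by (rule integrable_abs)
    fix m
    show "(\<lambda>\<omega>. if running_max z m \<omega> > 0 then z (\<omega> 0) else 0) \<in> borel_measurable (increments \<mu>)"
      by (intro measurable_If measurable_increments_component) measurable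
    show "AE \<omega> in increments \<mu>. norm (if running_max z m \<omega> > 0 then z (\<omega> 0) else 0) \<le> \<bar>z (\<omega> 0)\<bar>"
      by (rule AE_I2) simp
  qed
  then have "0 \<le> (\<integral>\<omega>. z (\<omega> 0) \<partial>increments \<mu>)"
    by (rule LIMSEQ_le_const) (use expectation_running_max_pos_nonneg[OF z] in auto)
  then show ?thesis by (simp add: increments_component(2)[OF z])
qed

lemma random_walk_integer_group: "random_walk integer_group \<omega> m = (\<Sum>j<m. \<omega> j)"
  by (induction m) auto

text \<open>Suppose the mean a is nonzero and let c be its sign. The steps
  \<open>z x = c * a / 2 - c * x\<close> have negative mean \<open>- c * a / 2\<close>, but when the
  walk is back at 0 at a time k their sum is \<open>k * (c * a / 2) > 0\<close>. This contradicts
  the preceding lemma.\<close>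

lemma recurrent_walk_expectation_eq_0:
  fixes \<mu> :: "int pmf"
  assumes rec: "recurrent_walk integer_group \<mu>"
    and int: "integrable (measure_pmf \<mu>) real_of_int"
  shows "measure_pmf.expectation \<mu> real_of_int = 0"
proof -
  define a where "a = measure_pmf.expectation \<mu> real_of_int"
  \<comment> \<open>Time 0 is always a return and contributes the empty sum, so a return at a time k
    \<ge> 1 has to be extracted.\<close>
  have ret: "AE \<omega> in increments \<mu>. \<exists>k\<ge>1. (\<Sum>j<k. \<omega> j) = 0"
    using rec unfolding recurrent_walk_def
  proof eventually_elim
    case (elim \<omega>)
    then obtain k where "k \<ge> 1" "random_walk integer_group \<omega> k = \<one>\<^bsub>integer_group\<^esub>"
      unfolding INFM_nat_le by blast
    then show ?case by (auto simp: random_walk_integer_group)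
  qed
  have key: "c * a \<le> 0" if "c = 1 \<or> c = -1" for c
  proof (rule ccontr)
    assume "\<not> c * a \<le> 0"
    then have ca: "c * a > 0" by simp
    define z where "z x = c * a / 2 - c * real_of_int x" for x
    have intz: "integrable \<mu> z" using int by (simp add: z_def[abs_def])
    have "AE \<omega> in increments \<mu>. \<exists>k. (\<Sum>j<k. z (\<omega> j)) > 0"
      using ret
    proof eventually_elim
      case (elim \<omega>)
      then obtain k where k: "k \<ge> 1" "(\<Sum>j<k. \<omega> j) = 0" by blast
      have "(\<Sum>j<k. z (\<omega> j)) = real k * (c * a / 2) - c * real_of_int (\<Sum>j<k. \<omega> j)"
        by (simp add: z_def sum_subtractf sum_distrib_left)
      also have "\<dots> > 0" using k ca by simp
      finally show ?case by blast
    qed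
    then have "0 \<le> measure_pmf.expectation \<mu> z"
      by (rule expectation_nonneg_of_AE_pos_partial_sum[OF intz])
    also have "\<dots> = c * a / 2 - c * a" using int by (simp add: z_def[abs_def] a_def)
    finally show False using ca by linarith
  qed
  show ?thesis using key[of 1] key[of "-1"] by (simp add: a_def)
qed

section \<open>Subadditive functions along a random walk\<close>

lemma (in group) foldr_mult_closed:
  "set ws \<subseteq> carrier G \<Longrightarrow> foldr (\<otimes>) ws \<one> \<in> carrier G"
  by (induction ws) auto

lemma (in group) foldr_mult_append:
  assumes "set xs \<subseteq> carrier G" "set ys \<subseteq> carrier G"
  shows "foldr (\<otimes>) (xs @ ys) \<one> = foldr (\<otimes>) xs \<one> \<otimes> foldr (\<otimes>) ys \<one>"
  using assms
proof (induction xs)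
  case Nil
  then show ?case by (simp add: foldr_mult_closed)
next
  case (Cons x xs)
  then show ?case using foldr_mult_closed[of xs] foldr_mult_closed[of ys] by (simp add: m_assoc)
qed

lemma (in group) generate_word:
  assumes S: "S \<subseteq> carrier G" and g: "g \<in> generate G S"
  shows "\<exists>ws. set ws \<subseteq> S \<union> m_inv G ` S \<and> foldr (\<otimes>) ws \<one> = g"
  using g
proof (induction rule: generate.induct)
  case one
  show ?case by (rule exI[of _ "[]"]) simp
next
  case (incl h)
  then show ?case using S by (intro exI[of _ "[h]"]) auto
next
  case (inv h)
  then show ?case using S by (intro exI[of _ "[inv h]"]) auto
next
  case (eng h1 h2)
  then obtain xs ys where xy: "set xs \<subseteq> S \<union> m_inv G ` S" "foldr (\<otimes>) xs \<one> = h1"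
    "set ys \<subseteq> S \<union> m_inv G ` S" "foldr (\<otimes>) ys \<one> = h2" by blast
  have "S \<union> m_inv G ` S \<subseteq> carrier G" using S by auto
  then have "set xs \<subseteq> carrier G" "set ys \<subseteq> carrier G" using xy by blast+
  then have "foldr (\<otimes>) (xs @ ys) \<one> = h1 \<otimes> h2" using xy foldr_mult_append[of xs ys] by simp
  then show ?case using xy by (intro exI[of _ "xs @ ys"]) auto
qed

text \<open>Along a shortest word each letter adds at most a constant. This is how the finite first
  moment of the word length makes the logarithm of the matrix norm integrable. The term
  \<open>L \<one>\<close> comes from the empty word, where L need not vanish.\<close>

lemma (in group) subadditive_le_word_length:
  fixes L :: "'a \<Rightarrow> real"
  assumes S: "finite S" "S \<subseteq> carrier G" "generate G S = carrier G"
    and sub: "\<And>g h. g \<in> carrier G \<Longrightarrow> h \<in> carrier G \<Longrightarrow> L (g \<otimes> h) \<le> L g + L h"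
  obtains C where "\<And>g. g \<in> carrier G \<Longrightarrow> L g \<le> C * real (word_length G S g) + L \<one>"
proof
  let ?T = "S \<union> m_inv G ` S"
  \<comment> \<open>The inserted 0 keeps \<open>Max\<close> meaningful for an empty generating
    set.\<close>
  define C where "C = Max (insert 0 (L ` ?T))"
  have T: "?T \<subseteq> carrier G" using S by auto
  have LC: "L s \<le> C" if "s \<in> ?T" for s
    unfolding C_def using that S(1) by (intro Max_ge) auto
  fix g assume g: "g \<in> carrier G"
  have "\<exists>ws. set ws \<subseteq> ?T \<and> foldr (\<otimes>) ws \<one> = g"
    using generate_word[OF S(2)] g S(3) by simp
  then have "\<exists>k ws. length ws = k \<and> set ws \<subseteq> ?T \<and> foldr (\<otimes>) ws \<one> = g" by blast
  then have "\<exists>ws. length ws = word_length G S g \<and> set ws \<subseteq> ?T \<and> foldr (\<otimes>) ws \<one> = g"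
    unfolding word_length_def by (rule LeastI_ex)
  then obtain ws where ws: "length ws = word_length G S g" "set ws \<subseteq> ?T" "foldr (\<otimes>) ws \<one> = g" by blast
  have "L (foldr (\<otimes>) ws \<one>) \<le> C * real (length ws) + L \<one>"
    using ws(2)
  proof (induction ws)
    case (Cons s ws)
    have "L (s \<otimes> foldr (\<otimes>) ws \<one>) \<le> L s + L (foldr (\<otimes>) ws \<one>)"
      using Cons.prems T foldr_mult_closed[of ws] by (intro sub) auto
    moreover have "L s \<le> C" using Cons.prems by (intro LC) auto
    moreover have "L (foldr (\<otimes>) ws \<one>) \<le> C * real (length ws) + L \<one>"
      using Cons.prems by (intro Cons.IH) auto
    ultimately show ?case by (simp add: algebra_simps)
  qed simp
  then show "L g \<le> C * real (word_length G S g) + L \<one>" using ws by simp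
qed

lemma (in group) conv_power_add:
  assumes \<mu>: "set_pmf \<mu> \<subseteq> carrier G"
  shows "map_pmf (\<lambda>(x, y). x \<otimes> y) (pair_pmf (conv_power G \<mu> a) (conv_power G \<mu> b)) = conv_power G \<mu> (a + b)"
proof (induction a)
  case 0
  have "map_pmf (\<lambda>y. \<one> \<otimes> y) (conv_power G \<mu> b) = conv_power G \<mu> b"
    by (rule map_pmf_idI) (use set_conv_power[OF \<mu>, of b] in auto)
  then show ?case by (simp add: pair_return_pmf1 map_pmf_comp)
next
  case (Suc a)
  let ?W = "conv_power G \<mu>"
  have "map_pmf (\<lambda>(x, y). x \<otimes> y) (pair_pmf (?W (Suc a)) (?W b))
      = map_pmf (\<lambda>(x, y, z). x \<otimes> y \<otimes> z) (pair_pmf \<mu> (pair_pmf (?W a) (?W b)))"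
    by (simp add: pair_map_pmf1 pair_pair_pmf map_pmf_comp case_prod_beta')
  also have "\<dots> = map_pmf (\<lambda>(x, y, z). x \<otimes> (y \<otimes> z)) (pair_pmf \<mu> (pair_pmf (?W a) (?W b)))"
    using \<mu> set_conv_power[OF \<mu>] by (intro map_pmf_cong refl) (auto simp: subset_iff m_assoc)
  also have "\<dots> = map_pmf (\<lambda>(x, w). x \<otimes> w) (pair_pmf \<mu> (map_pmf (\<lambda>(y, z). y \<otimes> z) (pair_pmf (?W a) (?W b))))"
    by (simp add: pair_map_pmf2 map_pmf_comp case_prod_beta')
  also have "\<dots> = ?W (Suc a + b)" by (simp add: Suc)
  finally show ?case .
qed

text \<open>In this form a coordinate of the walk at time m becomes a sum over an i.i.d. list, to
  which the law of large numbers applies.\<close>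

lemma conv_power_replicate_pmf:
  "conv_power G \<mu> m = map_pmf (\<lambda>ws. foldr (monoid.mult G) ws \<one>\<^bsub>G\<^esub>) (replicate_pmf m \<mu>)"
proof (induction m)
  case (Suc m)
  then show ?case
    by (simp add: replicate_pmf_Suc_pair pair_map_pmf2 map_pmf_comp case_prod_beta' del: replicate_pmf.simps)
qed simp

lemma (in group) expectation_subadditive_conv:
  fixes L :: "'a \<Rightarrow> real"
  assumes V: "set_pmf V \<subseteq> carrier G" and V': "set_pmf V' \<subseteq> carrier G"
    and nonneg: "\<And>g. L g \<ge> 0"
    and sub: "\<And>g h. g \<in> carrier G \<Longrightarrow> h \<in> carrier G \<Longrightarrow> L (g \<otimes> h) \<le> L g + L h"
    and int: "integrable (measure_pmf V) L" "integrable (measure_pmf V') L"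
  shows "integrable (measure_pmf (map_pmf (\<lambda>(x, y). x \<otimes> y) (pair_pmf V V'))) L"
    and "measure_pmf.expectation (map_pmf (\<lambda>(x, y). x \<otimes> y) (pair_pmf V V')) L
         \<le> measure_pmf.expectation V L + measure_pmf.expectation V' L"
proof -
  let ?P = "pair_pmf V V'"
  have 1: "integrable ?P (\<lambda>z. L (fst z))"
    using int integrable_map_pmf_eq[of fst ?P L] by (simp add: map_fst_pair_pmf)
  have 2: "integrable ?P (\<lambda>z. L (snd z))"
    using int integrable_map_pmf_eq[of snd ?P L] by (simp add: map_snd_pair_pmf)
  have le: "AE z in ?P. L (fst z \<otimes> snd z) \<le> L (fst z) + L (snd z)"
    using V V' by (auto simp: AE_measure_pmf_iff intro!: sub)
  have 3: "integrable ?P (\<lambda>z. L (fst z \<otimes> snd z))"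
  proof (rule Bochner_Integration.integrable_bound)
    show "integrable ?P (\<lambda>z. L (fst z) + L (snd z))" using 1 2 by simp
    show "AE z in ?P. norm (L (fst z \<otimes> snd z)) \<le> norm (L (fst z) + L (snd z))"
      using le by eventually_elim (simp add: nonneg)
  qed simp
  then show "integrable (measure_pmf (map_pmf (\<lambda>(x, y). x \<otimes> y) ?P)) L"
    by (simp add: case_prod_beta')
  have "measure_pmf.expectation ?P (\<lambda>z. L (fst z \<otimes> snd z))
      \<le> measure_pmf.expectation ?P (\<lambda>z. L (fst z) + L (snd z))"
    using 1 2 3 le by (intro integral_mono_AE) auto
  also have "\<dots> = measure_pmf.expectation V L + measure_pmf.expectation V' L" using 1 2 by simp
  finally show "measure_pmf.expectation (map_pmf (\<lambda>(x, y). x \<otimes> y) ?P) L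
         \<le> measure_pmf.expectation V L + measure_pmf.expectation V' L"
    by (simp add: case_prod_beta')
qed

lemma (in group) integrable_subadditive_conv_power:
  fixes L :: "'a \<Rightarrow> real"
  assumes \<mu>: "set_pmf \<mu> \<subseteq> carrier G" and nonneg: "\<And>g. L g \<ge> 0"
    and sub: "\<And>g h. g \<in> carrier G \<Longrightarrow> h \<in> carrier G \<Longrightarrow> L (g \<otimes> h) \<le> L g + L h"
    and int: "integrable (measure_pmf \<mu>) L"
  shows "integrable (measure_pmf (conv_power G \<mu> m)) L"
proof (induction m)
  case 0
  show ?case by (simp add: integrable_measure_pmf_finite)
next
  case (Suc m)
  show ?case
    using expectation_subadditive_conv(1)[OF \<mu> set_conv_power[OF \<mu>] nonneg sub int Suc] by simp
qed

lemma (in group) expectation_subadditive_conv_power: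
  fixes L :: "'a \<Rightarrow> real"
  assumes \<mu>: "set_pmf \<mu> \<subseteq> carrier G" and nonneg: "\<And>g. L g \<ge> 0"
    and sub: "\<And>g h. g \<in> carrier G \<Longrightarrow> h \<in> carrier G \<Longrightarrow> L (g \<otimes> h) \<le> L g + L h"
    and int: "integrable (measure_pmf \<mu>) L"
  shows "measure_pmf.expectation (conv_power G \<mu> (m * N)) L
       \<le> L \<one> + real m * measure_pmf.expectation (conv_power G \<mu> N) L"
proof (induction m)
  case 0
  show ?case by simp
next
  case (Suc m)
  let ?W = "conv_power G \<mu>"
  note W = set_conv_power[OF \<mu>]
  note intW = integrable_subadditive_conv_power[OF \<mu> nonneg sub int]
  have "measure_pmf.expectation (?W (Suc m * N)) L
      \<le> measure_pmf.expectation (?W N) L + measure_pmf.expectation (?W (m * N)) L"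
    using expectation_subadditive_conv(2)[OF W[of N] W[of "m * N"] nonneg sub intW intW]
    by (simp add: conv_power_add[OF \<mu>])
  then show ?case using Suc by (simp add: algebra_simps)
qed

section \<open>The group and its matrix norm\<close>

lemma Z_inv_of_int: "of_int a \<in> Z_inv p"
  unfolding Z_inv_def by (intro CollectI exI[of _ a] exI[of _ 0]) simp

lemma Z_inv_0: "0 \<in> Z_inv p" and Z_inv_1: "1 \<in> Z_inv p"
  using Z_inv_of_int[of 0 p] Z_inv_of_int[of 1 p] by simp_all

lemma Z_inv_add:
  assumes "p > 0" "a \<in> Z_inv p" "b \<in> Z_inv p"
  shows "a + b \<in> Z_inv p"
proof -
  from assms obtain u k v l where "a = of_int u / of_nat p ^ k" "b = of_int v / of_nat p ^ l"
    by (auto simp: Z_inv_def)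
  then have "a + b = of_int (u * int p ^ l + v * int p ^ k) / of_nat p ^ (k + l)"
    using assms(1) by (simp add: add_frac_eq power_add)
  then show ?thesis unfolding Z_inv_def by blast
qed

lemma Z_inv_mult:
  assumes "a \<in> Z_inv p" "b \<in> Z_inv p"
  shows "a * b \<in> Z_inv p"
proof -
  from assms obtain u k v l where "a = of_int u / of_nat p ^ k" "b = of_int v / of_nat p ^ l"
    by (auto simp: Z_inv_def)
  then have "a * b = of_int (u * v) / of_nat p ^ (k + l)"
    by (simp add: power_add)
  then show ?thesis unfolding Z_inv_def by blast
qed

lemma Z_inv_uminus: "a \<in> Z_inv p \<Longrightarrow> - a \<in> Z_inv p"
  using Z_inv_mult[OF Z_inv_of_int[of "-1"]] by simp

lemma Z_inv_sum: "p > 0 \<Longrightarrow> (\<And>i. i \<in> I \<Longrightarrow> f i \<in> Z_inv p) \<Longrightarrow> sum f I \<in> Z_inv p"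
  by (induction I rule: infinite_finite_induct) (auto simp: Z_inv_0 Z_inv_add)

lemma Z_inv_power_int: "of_nat p powi k \<in> Z_inv p"
proof (cases "k \<ge> 0")
  case True
  then have "(of_nat p powi k :: rat) = of_int (int p ^ nat k)" by (simp add: power_int_def)
  then show ?thesis by (simp only: Z_inv_of_int)
next
  case False
  then have "(of_nat p powi k :: rat) = of_int 1 / of_nat p ^ nat (- k)"
    by (simp add: power_int_def inverse_eq_divide power_one_over)
  then show ?thesis unfolding Z_inv_def by blast
qed

lemma UT_iff:
  "f \<in> UT n R \<longleftrightarrow> f \<in> carrier_mat n n \<and> (\<forall>i<n. \<forall>j<n. f $$ (i, j) \<in> R \<and> (j < i \<longrightarrow> f $$ (i, j) = 0))
     \<and> (\<forall>i<n. f $$ (i, i) = 1)"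
  by (auto simp: UT_def upper_triangular_def)

lemma UT_carrier: "f \<in> UT n R \<Longrightarrow> f \<in> carrier_mat n n"
  by (simp add: UT_iff)

lemma mat_mult_entry:
  assumes "A \<in> carrier_mat n n" "B \<in> carrier_mat n n" "i < n" "j < n"
  shows "(A * B) $$ (i, j) = (\<Sum>k<n. A $$ (i, k) * B $$ (k, j))"
  using assms by (auto simp: scalar_prod_def lessThan_atLeast0 intro!: sum.cong)

text \<open>The restriction to \<open>{i..j}\<close> is essential for the norm: the weight
  \<open>wt p 0\<close> is 1, so vanishing terms outside this range would be counted.\<close>

lemma upper_triangular_mult_entry:
  fixes A B :: "'a :: comm_ring_1 mat"
  assumes "A \<in> carrier_mat n n" "B \<in> carrier_mat n n" "i < n" "j < n"
    and "\<And>i j. j < i \<Longrightarrow> i < n \<Longrightarrow> A $$ (i, j) = 0" "\<And>i j. j < i \<Longrightarrow> i < n \<Longrightarrow> B $$ (i, j) = 0"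
  shows "(A * B) $$ (i, j) = (\<Sum>k\<in>{i..j}. A $$ (i, k) * B $$ (k, j))"
proof -
  have "(\<Sum>k<n. A $$ (i, k) * B $$ (k, j)) = (\<Sum>k\<in>{i..j}. A $$ (i, k) * B $$ (k, j))"
  proof (rule sum.mono_neutral_right)
    show "\<forall>k\<in>{..<n} - {i..j}. A $$ (i, k) * B $$ (k, j) = 0"
      using assms(3,4) by (auto simp: assms(5,6) not_le)
  qed (use assms in auto)
  then show ?thesis by (simp only: mat_mult_entry[OF assms(1-4)])
qed

lemma UT_mult_entry:
  fixes f g :: "rat mat"
  assumes "f \<in> UT n R" "g \<in> UT n R" "i < n" "j < n"
  shows "(f * g) $$ (i, j) = (\<Sum>k\<in>{i..j}. f $$ (i, k) * g $$ (k, j))"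
  using assms by (intro upper_triangular_mult_entry) (auto simp: UT_iff)

lemma UT_mult:
  assumes "p > 0" and f: "f \<in> UT n (Z_inv p)" and g: "g \<in> UT n (Z_inv p)"
  shows "f * g \<in> UT n (Z_inv p)"
  unfolding UT_iff
proof (intro conjI allI impI)
  show "f * g \<in> carrier_mat n n" using f g UT_carrier by (intro mult_carrier_mat) auto
  fix i assume i: "i < n"
  show "(f * g) $$ (i, i) = 1" using f g i by (simp add: UT_mult_entry UT_iff)
  fix j assume j: "j < n"
  show "(f * g) $$ (i, j) \<in> Z_inv p"
    unfolding UT_mult_entry[OF f g i j]
    by (intro Z_inv_sum Z_inv_mult) (use f g i j assms(1) in \<open>auto simp: UT_iff\<close>)
  assume "j < i"
  then show "(f * g) $$ (i, j) = 0" using UT_mult_entry[OF f g i j] by simp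
qed

lemma UT_one: "1\<^sub>m n \<in> UT n (Z_inv p)"
  by (auto simp: UT_iff Z_inv_0 Z_inv_1)

text \<open>If \<open>A = g * f\<close> agrees with the identity on the first \<open>k - 1\<close> superdiagonals, then
  \<open>(2 - A) * A\<close> agrees with it on the first \<open>k\<close>.\<close>

lemma UT_left_inverse_approx:
  assumes p: "p > 0" and f: "f \<in> UT n (Z_inv p)"
  shows "\<exists>g \<in> UT n (Z_inv p). \<forall>i<n. \<forall>j<n. i < j \<and> j < i + Suc k \<longrightarrow> (g * f) $$ (i, j) = 0"
proof (induction k)
  case 0
  show ?case by (rule bexI[of _ "1\<^sub>m n"]) (use UT_one in auto)
next
  case (Suc k)
  then obtain g where g: "g \<in> UT n (Z_inv p)"
    and z: "\<And>i j. i < n \<Longrightarrow> j < n \<Longrightarrow> i < j \<Longrightarrow> j < i + Suc k \<Longrightarrow> (g * f) $$ (i, j) = 0" by auto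
  define A where "A = g * f"
  have A: "A \<in> UT n (Z_inv p)" unfolding A_def by (rule UT_mult[OF p g f])
  define C where "C = Matrix.mat n n (\<lambda>(i, j). (if i = j then 2 else 0) - A $$ (i, j))"
  have C: "C \<in> UT n (Z_inv p)"
    using A p Z_inv_of_int[of 2 p] unfolding UT_iff
    by (auto simp: C_def Z_inv_uminus)
       (metis Z_inv_1)+
  show ?case
  proof (intro bexI[of _ "C * g"] allI impI)
    show "C * g \<in> UT n (Z_inv p)" by (rule UT_mult[OF p C g])
    fix i j assume ij: "i < n" "j < n" "i < j \<and> j < i + Suc (Suc k)"
    have "C * g * f = C * A"
      unfolding A_def by (rule assoc_mult_mat) (use C g f UT_carrier in blast)+
    then have "(C * g * f) $$ (i, j) = (\<Sum>l\<in>{i..j}. C $$ (i, l) * A $$ (l, j))"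
      using UT_mult_entry[OF C A ij(1,2)] by simp
    also have "{i..j} = insert i (insert j {i<..<j})" using ij by auto
    also have "(\<Sum>l\<in>insert i (insert j {i<..<j}). C $$ (i, l) * A $$ (l, j))
        = C $$ (i, i) * A $$ (i, j) + C $$ (i, j) * A $$ (j, j) + (\<Sum>l\<in>{i<..<j}. C $$ (i, l) * A $$ (l, j))"
      using ij by (simp add: add.assoc)
    also have "(\<Sum>l\<in>{i<..<j}. C $$ (i, l) * A $$ (l, j)) = 0"
    proof (intro sum.neutral ballI)
      fix l assume l: "l \<in> {i<..<j}"
      then have "A $$ (i, l) = 0" unfolding A_def using ij by (intro z) auto
      then show "C $$ (i, l) * A $$ (l, j) = 0" using l ij by (simp add: C_def)
    qed
    also have "C $$ (i, i) * A $$ (i, j) + C $$ (i, j) * A $$ (j, j) + 0 = 0"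
      using A ij by (simp add: C_def UT_iff)
    finally show "(C * g * f) $$ (i, j) = 0" .
  qed
qed

lemma UT_left_inverse:
  assumes p: "p > 0" and f: "f \<in> UT n (Z_inv p)"
  obtains g where "g \<in> UT n (Z_inv p)" "g * f = 1\<^sub>m n"
proof -
  obtain g where g: "g \<in> UT n (Z_inv p)"
    and z: "\<And>i j. i < n \<Longrightarrow> j < n \<Longrightarrow> i < j \<Longrightarrow> j < i + Suc n \<Longrightarrow> (g * f) $$ (i, j) = 0"
    using UT_left_inverse_approx[OF p f, of n] by auto
  have gf: "g * f \<in> UT n (Z_inv p)" by (rule UT_mult[OF p g f])
  have "g * f = 1\<^sub>m n"
  proof (rule eq_matI)
    fix i j assume "i < dim_row (1\<^sub>m n :: rat mat)" "j < dim_col (1\<^sub>m n :: rat mat)"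
    then show "(g * f) $$ (i, j) = 1\<^sub>m n $$ (i, j)"
      using gf z[of i j] by (cases i j rule: linorder_cases) (auto simp: UT_iff)
  qed (use f g UT_carrier in auto)
  then show ?thesis using that g by blast
qed

lemma p_diag_carrier: "p_diag p n x \<in> carrier_mat n n"
  by (simp add: p_diag_def)

lemma p_diag_add:
  assumes "p > 0" "x \<in> carrier_vec n" "y \<in> carrier_vec n"
  shows "p_diag p n (x + y) = p_diag p n x * p_diag p n y"
  unfolding p_diag_def mat_diag_diag
  by (rule eq_matI) (use assms in \<open>auto simp: mat_diag_def power_int_add\<close>)

lemma p_diag_0: "p_diag p n (0\<^sub>v n) = 1\<^sub>m n"
  by (rule eq_matI) (auto simp: p_diag_def mat_diag_def)

lemma p_diag_uminus:
  assumes "p > 0" "x \<in> carrier_vec n"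
  shows "p_diag p n x * p_diag p n (- x) = 1\<^sub>m n" "p_diag p n (- x) * p_diag p n x = 1\<^sub>m n"
  using p_diag_add[of p x n "- x"] p_diag_add[of p "- x" n x] assms
  by (simp_all add: p_diag_0)

lemma conj_p_diag_entry:
  assumes "g \<in> carrier_mat n n" "x \<in> carrier_vec n" "i < n" "j < n"
  shows "(p_diag p n x * g * p_diag p n (- x)) $$ (i, j)
       = of_nat p powi (x $ i) * g $$ (i, j) * of_nat p powi (- x $ j)"
  using assms unfolding p_diag_def
  by (simp add: mat_diag_mult_left[of g n n] mat_diag_mult_right[of _ n n])

lemma UT_conj_p_diag:
  assumes p: "p > 0" and x: "x \<in> carrier_vec n" and g: "g \<in> UT n (Z_inv p)"
  shows "p_diag p n x * g * p_diag p n (- x) \<in> UT n (Z_inv p)"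
  unfolding UT_iff
proof (intro conjI allI impI)
  note e = conj_p_diag_entry[OF UT_carrier[OF g] x]
  show "p_diag p n x * g * p_diag p n (- x) \<in> carrier_mat n n"
    using UT_carrier[OF g] by (simp add: p_diag_carrier mult_carrier_mat[of _ n n])
  fix i assume i: "i < n"
  show "(p_diag p n x * g * p_diag p n (- x)) $$ (i, i) = 1"
    using g i p by (simp add: e UT_iff power_int_minus)
  fix j assume j: "j < n"
  show "(p_diag p n x * g * p_diag p n (- x)) $$ (i, j) \<in> Z_inv p"
    using g i j by (auto simp: e UT_iff intro!: Z_inv_mult Z_inv_power_int)
  assume "j < i"
  then show "(p_diag p n x * g * p_diag p n (- x)) $$ (i, j) = 0"
    using g i j by (simp add: e UT_iff)
qed

section \<open>The matrix embedding and the group axioms\<close>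

definition to_mat :: "nat \<Rightarrow> nat \<Rightarrow> int Matrix.vec \<times> rat mat \<Rightarrow> rat mat" where
  "to_mat p n g = snd g * p_diag p n (fst g)"

lemma to_mat_carrier: "g \<in> carrier (semidirect_UT p n) \<Longrightarrow> to_mat p n g \<in> carrier_mat n n"
  unfolding to_mat_def
  by (rule mult_carrier_mat[OF _ p_diag_carrier]) (auto simp: semidirect_UT_def UT_carrier)

lemma to_mat_entry:
  assumes "g \<in> carrier (semidirect_UT p n)" "i < n" "j < n"
  shows "to_mat p n g $$ (i, j) = snd g $$ (i, j) * of_nat p powi (fst g $ j)"
  using assms unfolding to_mat_def p_diag_def
  by (subst mat_diag_mult_right[of _ n n]) (auto simp: semidirect_UT_def UT_carrier)

lemma to_mat_diag:
  assumes "g \<in> carrier (semidirect_UT p n)" "i < n"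
  shows "to_mat p n g $$ (i, i) = of_nat p powi (fst g $ i)"
  using assms by (subst to_mat_entry) (auto simp: semidirect_UT_def UT_iff)

lemma to_mat_lower:
  assumes "g \<in> carrier (semidirect_UT p n)" "i < n" "j < i"
  shows "to_mat p n g $$ (i, j) = 0"
  using assms by (subst to_mat_entry) (auto simp: semidirect_UT_def UT_iff)

lemma to_mat_Z_inv:
  assumes "g \<in> carrier (semidirect_UT p n)" "i < n" "j < n"
  shows "to_mat p n g $$ (i, j) \<in> Z_inv p"
  using assms by (subst to_mat_entry) (auto simp: semidirect_UT_def UT_iff intro!: Z_inv_mult Z_inv_power_int)

lemma semidirect_UT_m_closed:
  assumes "p > 0" "g \<in> carrier (semidirect_UT p n)" "h \<in> carrier (semidirect_UT p n)"
  shows "g \<otimes>\<^bsub>semidirect_UT p n\<^esub> h \<in> carrier (semidirect_UT p n)"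
  using assms by (auto simp: semidirect_UT_def intro!: UT_mult UT_conj_p_diag)

lemma to_mat_mult:
  assumes p: "p > 0" and g: "g \<in> carrier (semidirect_UT p n)" and h: "h \<in> carrier (semidirect_UT p n)"
  shows "to_mat p n (g \<otimes>\<^bsub>semidirect_UT p n\<^esub> h) = to_mat p n g * to_mat p n h"
proof -
  obtain x f y k where gh: "g = (x, f)" "h = (y, k)" by (cases g, cases h) auto
  have c: "x \<in> carrier_vec n" "y \<in> carrier_vec n" "f \<in> carrier_mat n n" "k \<in> carrier_mat n n"
    using g h by (auto simp: gh semidirect_UT_def UT_carrier)
  let ?X = "p_diag p n x" and ?X' = "p_diag p n (- x)" and ?Y = "p_diag p n y"
  have X: "?X \<in> carrier_mat n n" "?X' \<in> carrier_mat n n" "?Y \<in> carrier_mat n n"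
    by (rule p_diag_carrier)+
  have "f * (?X * k * ?X') * (?X * ?Y) = f * ((?X * k * ?X') * (?X * ?Y))"
    using c X by (simp add: assoc_mult_mat[of _ n n _ n _ n])
  also have "(?X * k * ?X') * (?X * ?Y) = ?X * k * (?X' * (?X * ?Y))"
    using c X by (intro assoc_mult_mat[of _ n n _ n _ n]) auto
  also have "?X' * (?X * ?Y) = ?X' * ?X * ?Y"
    using X by (simp add: assoc_mult_mat[of _ n n _ n _ n])
  also have "\<dots> = ?Y" using X p c by (simp add: p_diag_uminus)
  also have "f * (?X * k * ?Y) = f * ?X * (k * ?Y)"
    using c X by (simp add: assoc_mult_mat[of _ n n _ n _ n])
  finally show ?thesis
    using p c by (simp add: gh to_mat_def semidirect_UT_def p_diag_add)
qed

text \<open>The diagonal entries are the powers \<open>p powi (x $ i)\<close>, and for p > 1 these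
  determine their exponents.\<close>

lemma to_mat_eq_imp_fst_eq:
  assumes p: "p > 1" and g: "g \<in> carrier (semidirect_UT p n)" and h: "h \<in> carrier (semidirect_UT p n)"
    and eq: "to_mat p n g = to_mat p n h"
  shows "fst g = fst h"
proof (rule eq_vecI)
  show d: "dim_vec (fst g) = dim_vec (fst h)" using g h by (auto simp: semidirect_UT_def)
  fix i assume "i < dim_vec (fst h)"
  then have i: "i < n" using h by (auto simp: semidirect_UT_def)
  have "(of_nat p powi (fst g $ i) :: rat) = of_nat p powi (fst h $ i)"
    using to_mat_diag[OF g i] to_mat_diag[OF h i] eq by simp
  then show "fst g $ i = fst h $ i"
    using p power_int_strict_increasing[of "fst g $ i" "fst h $ i" "of_nat p :: rat"]
      power_int_strict_increasing[of "fst h $ i" "fst g $ i" "of_nat p :: rat"]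
    by (cases "fst g $ i" "fst h $ i" rule: linorder_cases) auto
qed

lemma inj_on_to_mat:
  assumes p: "p > 1"
  shows "inj_on (to_mat p n) (carrier (semidirect_UT p n))"
proof (rule inj_onI)
  fix g h assume g: "g \<in> carrier (semidirect_UT p n)" and h: "h \<in> carrier (semidirect_UT p n)"
    and eq: "to_mat p n g = to_mat p n h"
  have fst: "fst g = fst h" by (rule to_mat_eq_imp_fst_eq[OF p g h eq])
  have "snd g = snd h"
  proof (rule eq_matI)
    fix i j assume "i < dim_row (snd h)" "j < dim_col (snd h)"
    then have ij: "i < n" "j < n" using h by (auto simp: semidirect_UT_def dest!: UT_carrier)
    show "snd g $$ (i, j) = snd h $$ (i, j)"
      using to_mat_entry[OF g ij] to_mat_entry[OF h ij] eq fst p by simp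
  qed (use g h in \<open>auto simp: semidirect_UT_def dest!: UT_carrier\<close>)
  with fst show "g = h" by (rule prod_eqI)
qed

text \<open>The map \<open>to_mat\<close> is injective and turns the twisted product into the matrix
  product, so the axioms are pulled back from matrices.\<close>

lemma group_semidirect_UT:
  assumes p: "p > 1"
  shows "group (semidirect_UT p n)"
proof (rule groupI)
  let ?G = "semidirect_UT p n"
  have p0: "p > 0" using p by simp
  show one: "\<one>\<^bsub>?G\<^esub> \<in> carrier ?G" by (simp add: semidirect_UT_def UT_one)
  have to_mat_one: "to_mat p n \<one>\<^bsub>?G\<^esub> = 1\<^sub>m n"
    by (simp add: to_mat_def semidirect_UT_def p_diag_0)
  fix g assume g: "g \<in> carrier ?G"
  show "\<one>\<^bsub>?G\<^esub> \<otimes>\<^bsub>?G\<^esub> g = g"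
    by (rule inj_onD[OF inj_on_to_mat[OF p, of n]])
       (use g one p0 in \<open>auto simp: to_mat_mult to_mat_one semidirect_UT_m_closed
          left_mult_one_mat[OF to_mat_carrier]\<close>)
  show "g \<otimes>\<^bsub>?G\<^esub> h \<in> carrier ?G" if "h \<in> carrier ?G" for h
    by (rule semidirect_UT_m_closed[OF p0 g that])
  show "g \<otimes>\<^bsub>?G\<^esub> h \<otimes>\<^bsub>?G\<^esub> k = g \<otimes>\<^bsub>?G\<^esub> (h \<otimes>\<^bsub>?G\<^esub> k)"
    if "h \<in> carrier ?G" "k \<in> carrier ?G" for h k
    by (rule inj_onD[OF inj_on_to_mat[OF p, of n]])
       (use g that p0 in \<open>auto simp: to_mat_mult semidirect_UT_m_closed
          intro!: assoc_mult_mat[of _ n n _ n _ n] to_mat_carrier\<close>)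
  obtain x f where xf: "g = (x, f)" by (cases g)
  have x: "x \<in> carrier_vec n" and f: "f \<in> UT n (Z_inv p)" using g by (auto simp: xf semidirect_UT_def)
  obtain f' where f': "f' \<in> UT n (Z_inv p)" "f' * f = 1\<^sub>m n" using UT_left_inverse[OF p0 f] by blast
  \<comment> \<open>The inverse of (x, f) in a semidirect product: f^-1 conjugated by X^-1. The
    double minus is the literal form that conjugation by \<open>p_diag p n (- x)\<close>
    takes.\<close>
  define h where "h = (- x, p_diag p n (- x) * f' * p_diag p n (- (- x)))"
  have h: "h \<in> carrier ?G" using x UT_conj_p_diag[OF p0 _ f'(1), of "- x"] by (simp add: h_def semidirect_UT_def)
  have "h \<otimes>\<^bsub>?G\<^esub> g = \<one>\<^bsub>?G\<^esub>"
  proof (rule inj_onD[OF inj_on_to_mat[OF p, of n]])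
    let ?X = "p_diag p n x" and ?X' = "p_diag p n (- x)"
    have X: "?X \<in> carrier_mat n n" "?X' \<in> carrier_mat n n" by (rule p_diag_carrier)+
    note c = X UT_carrier[OF f] UT_carrier[OF f'(1)]
    have "to_mat p n (h \<otimes>\<^bsub>?G\<^esub> g) = (?X' * f' * ?X) * ?X' * (f * ?X)"
      using to_mat_mult[OF p0 h g] x by (simp add: to_mat_def h_def xf)
    also have "(?X' * f' * ?X) * ?X' = ?X' * f' * (?X * ?X')"
      using c by (intro assoc_mult_mat[of _ n n _ n _ n]) auto
    also have "\<dots> = ?X' * f'" using c x p0 by (simp add: p_diag_uminus)
    also have "?X' * f' * (f * ?X) = ?X' * (f' * f * ?X)"
      using c by (simp add: assoc_mult_mat[of _ n n _ n _ n])
    also have "\<dots> = 1\<^sub>m n" using c x p0 f' by (simp add: p_diag_uminus)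
    finally show "to_mat p n (h \<otimes>\<^bsub>?G\<^esub> g) = to_mat p n \<one>\<^bsub>?G\<^esub>" by (simp add: to_mat_one)
  qed (use h g one p0 in \<open>auto simp: semidirect_UT_m_closed\<close>)
  with h show "\<exists>h\<in>carrier ?G. h \<otimes>\<^bsub>?G\<^esub> g = \<one>\<^bsub>?G\<^esub>" by blast
qed

section \<open>Real and p-adic size on Z[1/p]\<close>

definition den_exp :: "nat \<Rightarrow> rat \<Rightarrow> nat" where
  "den_exp p a = (LEAST k. a * of_nat p ^ k \<in> \<int>)"

text \<open>Sum of the real absolute value and the \<open>p\<close>-adic absolute value, the latter raised to at least 1.\<close>

definition wt :: "nat \<Rightarrow> rat \<Rightarrow> real" where
  "wt p a = \<bar>real_of_rat a\<bar> + real p ^ den_exp p a"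

lemma den_exp_le: "a * of_nat p ^ k \<in> \<int> \<Longrightarrow> den_exp p a \<le> k"
  unfolding den_exp_def by (rule Least_le)

text \<open>Outside Z[1/p] no power of p clears the denominator and the \<open>LEAST\<close> is
  unspecified, so membership in \<open>Z_inv p\<close> accompanies all estimates of
  \<open>wt\<close>.\<close>

lemma den_exp_Ints:
  assumes "p > 0" "a \<in> Z_inv p"
  shows "a * of_nat p ^ den_exp p a \<in> \<int>"
  unfolding den_exp_def
proof (rule LeastI_ex)
  from assms(2) obtain u k where "a = of_int u / of_nat p ^ k" by (auto simp: Z_inv_def)
  then show "\<exists>k. a * of_nat p ^ k \<in> \<int>" using assms(1) by (intro exI[of _ k]) simp
qed

lemma den_exp_Ints_ge:
  assumes "p > 0" "a \<in> Z_inv p" "den_exp p a \<le> k"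
  shows "a * of_nat p ^ k \<in> \<int>"
proof -
  have "a * of_nat p ^ k = (a * of_nat p ^ den_exp p a) * of_nat p ^ (k - den_exp p a)"
    using assms(3) by (simp add: power_add[symmetric])
  also have "\<dots> \<in> \<int>" by (intro Ints_mult den_exp_Ints assms Ints_power Ints_of_nat)
  finally show ?thesis .
qed

lemma wt_nonneg: "wt p a \<ge> 0"
  by (simp add: wt_def)

lemma wt_add:
  assumes p: "p > 0" and a: "a \<in> Z_inv p" and b: "b \<in> Z_inv p"
  shows "wt p (a + b) \<le> wt p a + wt p b"
proof -
  let ?m = "max (den_exp p a) (den_exp p b)"
  have "(a + b) * of_nat p ^ ?m \<in> \<int>"
    using den_exp_Ints_ge[OF p a, of ?m] den_exp_Ints_ge[OF p b, of ?m] by (simp add: distrib_right)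
  then have "real p ^ den_exp p (a + b) \<le> real p ^ ?m"
    using p by (intro power_increasing den_exp_le) auto
  also have "\<dots> \<le> real p ^ den_exp p a + real p ^ den_exp p b" by (simp add: max_def)
  finally show ?thesis
    unfolding wt_def of_rat_add using abs_triangle_ineq[of "real_of_rat a" "real_of_rat b"] by linarith
qed

lemma wt_mult:
  assumes p: "p > 0" and a: "a \<in> Z_inv p" and b: "b \<in> Z_inv p"
  shows "wt p (a * b) \<le> wt p a * wt p b"
proof -
  have "(a * b) * of_nat p ^ (den_exp p a + den_exp p b) \<in> \<int>"
    using Ints_mult[OF den_exp_Ints[OF p a] den_exp_Ints[OF p b]] by (simp add: power_add mult_ac)
  then have "real p ^ den_exp p (a * b) \<le> real p ^ (den_exp p a + den_exp p b)"
    using p by (intro power_increasing den_exp_le) auto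
  moreover have "0 \<le> \<bar>real_of_rat a\<bar> * real p ^ den_exp p b" "0 \<le> \<bar>real_of_rat b\<bar> * real p ^ den_exp p a"
    by simp_all
  moreover have "wt p a * wt p b = \<bar>real_of_rat a\<bar> * \<bar>real_of_rat b\<bar> + \<bar>real_of_rat a\<bar> * real p ^ den_exp p b
      + \<bar>real_of_rat b\<bar> * real p ^ den_exp p a + real p ^ den_exp p a * real p ^ den_exp p b"
    unfolding wt_def by (simp only: distrib_left distrib_right mult_ac add_ac)
  ultimately show ?thesis unfolding wt_def[of p "a * b"] of_rat_mult abs_mult power_add by linarith
qed

text \<open>The index set must be nonempty: an empty sum is 0, and 0 has weight 1.\<close>

lemma wt_sum:
  assumes p: "p > 0" and I: "finite I" "I \<noteq> {}" and f: "\<And>i. i \<in> I \<Longrightarrow> f i \<in> Z_inv p"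
  shows "wt p (sum f I) \<le> (\<Sum>i\<in>I. wt p (f i))"
  using I f
proof (induction I rule: finite_ne_induct)
  case (insert i I)
  have "wt p (f i + sum f I) \<le> wt p (f i) + wt p (sum f I)"
    using insert.prems by (intro wt_add[OF p]) (auto intro: Z_inv_sum[OF p])
  then show ?case using insert by force
qed simp

text \<open>One of the two sizes equals \<open>p ^ nat \<bar>k\<bar>\<close> and the other is at
  most 1, according to the sign of k. The factor 2 covers their sum.\<close>

lemma wt_power_int_le:
  assumes "p > 0"
  shows "wt p (of_nat p powi k) \<le> 2 * real p ^ nat \<bar>k\<bar>"
proof -
  have "(of_nat p powi k :: rat) * of_nat p ^ nat (- k) \<in> \<int>"
  proof (cases "k \<ge> 0")
    case False
    then have "(of_nat p powi k :: rat) * of_nat p ^ nat (- k) = 1"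
      using assms by (simp add: power_int_def power_inverse)
    then show ?thesis by simp
  qed (simp add: power_int_def)
  then have "real p ^ den_exp p (of_nat p powi k) \<le> real p ^ nat \<bar>k\<bar>"
    using assms by (intro power_increasing order_trans[OF den_exp_le]) auto
  moreover have "\<bar>real_of_rat (of_nat p powi k)\<bar> \<le> real p ^ nat \<bar>k\<bar>"
  proof (cases "k \<ge> 0")
    case True
    then show ?thesis by (simp add: power_int_def of_rat_power)
  next
    case False
    have "inverse (real p) ^ nat (- k) \<le> 1" using assms by (intro power_le_one) (auto simp: field_simps)
    also have "1 \<le> real p ^ nat (- k)" using assms by (intro one_le_power) auto
    finally show ?thesis using False by (simp add: power_int_def of_rat_power of_rat_inverse)
  qed
  ultimately show ?thesis by (simp add: wt_def)
qed

text \<open>For negative k, clearing the denominator of \<open>p powi k\<close> leaves a positive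
  integer. This is at least 1, so the exponent used is at least \<open>- k\<close>.\<close>

lemma wt_power_int_ge:
  assumes p: "p > 0"
  shows "real p ^ nat \<bar>k\<bar> \<le> wt p (of_nat p powi k)"
proof (cases "k \<ge> 0")
  case True
  then show ?thesis by (simp add: wt_def power_int_def of_rat_power)
next
  case False
  let ?a = "of_nat p powi k :: rat"
  let ?d = "den_exp p ?a"
  have "?a * of_nat p ^ ?d \<in> \<int>" by (rule den_exp_Ints[OF p Z_inv_power_int])
  then obtain u :: int where u: "?a * of_nat p ^ ?d = of_int u" by (auto elim: Ints_cases)
  have "?a * of_nat p ^ ?d > 0" using p by simp
  then have "u \<ge> 1" by (simp add: u)
  then have "1 \<le> ?a * of_nat p ^ ?d" by (simp add: u)
  then have "(of_nat p ^ nat (- k) :: rat) * 1 \<le> of_nat p ^ nat (- k) * (?a * of_nat p ^ ?d)"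
    by (rule mult_left_mono) simp
  moreover have "(of_nat p ^ nat (- k) :: rat) * ?a = 1"
    using False p by (simp add: power_int_def power_inverse)
  ultimately have "(of_nat p ^ nat (- k) :: rat) \<le> of_nat p ^ ?d"
    by (simp only: mult.assoc[symmetric] mult_1_left mult_1_right)
  then have "p ^ nat (- k) \<le> p ^ ?d" by (metis of_nat_le_iff of_nat_power)
  then have "real p ^ nat (- k) \<le> real p ^ ?d" by (metis of_nat_le_iff of_nat_power)
  moreover have abs_k: "nat \<bar>k\<bar> = nat (- k)" using False by simp
  ultimately show ?thesis unfolding wt_def abs_k using abs_ge_zero[of "real_of_rat ?a"] by linarith
qed

text \<open>Write a = u / p^k with k = \<open>den_exp p a\<close>. Then p^k \<le> t gives k < 2^k
  \<le> t, and \<bar>u\<bar> = \<bar>a\<bar> p^k \<le> t^2. There are (t + 1) (2 t^2 + 1) such pairs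
  (k, u).\<close>

lemma card_wt_le:
  assumes p: "p > 1" and t: "t \<ge> (1::nat)"
  shows "finite {a \<in> Z_inv p. wt p a \<le> real t}" (is "finite ?A")
    and "card {a \<in> Z_inv p. wt p a \<le> real t} \<le> 6 * t ^ 3"
proof -
  let ?F = "\<lambda>(k, u). of_int u / of_nat p ^ k :: rat"
  let ?B = "{..t} \<times> {- int (t\<^sup>2)..int (t\<^sup>2)}"
  have sub: "?A \<subseteq> ?F ` ?B"
  proof
    fix a assume a: "a \<in> ?A"
    let ?k = "den_exp p a"
    have "a * of_nat p ^ ?k \<in> \<int>" using a p by (intro den_exp_Ints) auto
    then obtain u :: int where u: "a * of_nat p ^ ?k = of_int u" by (auto elim: Ints_cases)
    have "\<bar>real_of_rat a\<bar> + real p ^ ?k \<le> real t" using a unfolding wt_def by blast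
    moreover have "0 \<le> real p ^ ?k" by simp
    ultimately have pk: "real p ^ ?k \<le> real t" and absa: "\<bar>real_of_rat a\<bar> \<le> real t"
      using abs_ge_zero[of "real_of_rat a"] by linarith+
    have "?k < 2 ^ ?k" by (rule less_exp)
    also have "(2::nat) ^ ?k \<le> p ^ ?k" using p by (intro power_mono) auto
    also have "p ^ ?k \<le> t" using pk by (metis of_nat_le_iff of_nat_power)
    finally have k: "?k \<le> t" by simp
    have "real_of_int \<bar>u\<bar> = \<bar>real_of_rat (of_int u)\<bar>" by simp
    also have "\<dots> = \<bar>real_of_rat a\<bar> * real p ^ ?k"
      by (simp only: u[symmetric]) (simp add: of_rat_mult of_rat_power abs_mult)
    also have "\<dots> \<le> real t * real t" using pk absa by (intro mult_mono) auto
    also have "\<dots> = real_of_int (int (t\<^sup>2))" by (simp add: power2_eq_square)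
    finally have "\<bar>u\<bar> \<le> int (t\<^sup>2)" by (simp only: of_int_le_iff)
    moreover have "a = of_int u / of_nat p ^ ?k" using u p by (simp add: field_simps)
    ultimately show "a \<in> ?F ` ?B" using k by (intro image_eqI[of _ _ "(?k, u)"]) auto
  qed
  show "finite ?A" by (rule finite_subset[OF sub]) auto
  have "card ?A \<le> card (?F ` ?B)" by (rule card_mono[OF _ sub]) auto
  also have "\<dots> \<le> card ?B" by (rule card_image_le) auto
  also have "\<dots> = (t + 1) * (2 * t\<^sup>2 + 1)" by (simp add: card_cartesian_product nat_add_distrib nat_mult_distrib nat_power_eq)
  also have "\<dots> \<le> (2 * t) * (3 * t\<^sup>2)" using t by (intro mult_mono) (auto simp: Suc_le_eq)
  finally show "card ?A \<le> 6 * t ^ 3" by (simp add: power2_eq_square power3_eq_cube)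
qed

text \<open>The weight \<open>t\<^bsup>j-i\<^esup>\<close> is a conjugation by \<open>diag(1, t, t\<^sup>2, \<dots>)\<close>. It keeps the norm
  submultiplicative and makes the entries off the diagonal negligible as \<open>t\<close> tends to 0.\<close>

definition entry_wt :: "nat \<Rightarrow> real \<Rightarrow> rat mat \<Rightarrow> nat \<Rightarrow> nat \<Rightarrow> real" where
  "entry_wt p t A i j = (if i \<le> j then wt p (A $$ (i, j)) * t ^ (j - i) else 0)"

definition mat_wt :: "nat \<Rightarrow> nat \<Rightarrow> real \<Rightarrow> int Matrix.vec \<times> rat mat \<Rightarrow> real" where
  "mat_wt p n t g = (\<Sum>i<n. \<Sum>j<n. entry_wt p t (to_mat p n g) i j)"

text \<open>Adding 1 makes the logarithm nonnegative and keeps it subadditive, because 1 + a b \<le>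
  (1 + a) (1 + b) for nonnegative a and b.\<close>

definition log_height :: "nat \<Rightarrow> nat \<Rightarrow> real \<Rightarrow> int Matrix.vec \<times> rat mat \<Rightarrow> real" where
  "log_height p n t g = ln (1 + mat_wt p n t g)"

lemma entry_wt_nonneg: "t \<ge> 0 \<Longrightarrow> entry_wt p t A i j \<ge> 0"
  by (simp add: entry_wt_def wt_nonneg)

lemma mat_wt_nonneg: "t \<ge> 0 \<Longrightarrow> mat_wt p n t g \<ge> 0"
  unfolding mat_wt_def by (intro sum_nonneg entry_wt_nonneg)

lemma log_height_nonneg: "t \<ge> 0 \<Longrightarrow> log_height p n t g \<ge> 0"
  unfolding log_height_def using mat_wt_nonneg[of t p n g] by (intro ln_ge_zero) simp

text \<open>For i \<le> k \<le> j the exponents satisfy j - i = (k - i) + (j - k), so the power of t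
  splits between the two factors. Triangularity removes all other k, where truncated subtraction
  would break this identity.\<close>

lemma entry_wt_mult:
  assumes p: "p > 0" and t: "t \<ge> 0" and ij: "i < n" "j < n"
    and g: "g \<in> carrier (semidirect_UT p n)" and h: "h \<in> carrier (semidirect_UT p n)"
  shows "entry_wt p t (to_mat p n g * to_mat p n h) i j
       \<le> (\<Sum>k<n. entry_wt p t (to_mat p n g) i k * entry_wt p t (to_mat p n h) k j)"
proof (cases "i \<le> j")
  case True
  let ?A = "to_mat p n g" and ?B = "to_mat p n h"
  have "wt p ((?A * ?B) $$ (i, j)) = wt p (\<Sum>k\<in>{i..j}. ?A $$ (i, k) * ?B $$ (k, j))"
    by (subst upper_triangular_mult_entry[where n=n])
       (use ij g h in \<open>auto simp: to_mat_carrier to_mat_lower\<close>)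
  also have "\<dots> \<le> (\<Sum>k\<in>{i..j}. wt p (?A $$ (i, k) * ?B $$ (k, j)))"
    using True ij g h by (intro wt_sum[OF p]) (auto intro!: Z_inv_mult to_mat_Z_inv)
  also have "\<dots> \<le> (\<Sum>k\<in>{i..j}. wt p (?A $$ (i, k)) * wt p (?B $$ (k, j)))"
    using ij g h by (intro sum_mono wt_mult[OF p]) (auto intro!: to_mat_Z_inv)
  finally have "entry_wt p t (?A * ?B) i j
      \<le> (\<Sum>k\<in>{i..j}. wt p (?A $$ (i, k)) * wt p (?B $$ (k, j))) * t ^ (j - i)"
    using True t by (simp add: entry_wt_def mult_right_mono)
  also have "\<dots> = (\<Sum>k\<in>{i..j}. entry_wt p t ?A i k * entry_wt p t ?B k j)"
    unfolding sum_distrib_right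
  proof (rule sum.cong[OF refl])
    fix k assume k: "k \<in> {i..j}"
    then have "t ^ (j - i) = t ^ (k - i) * t ^ (j - k)" by (simp add: power_add[symmetric])
    then show "wt p (?A $$ (i, k)) * wt p (?B $$ (k, j)) * t ^ (j - i)
        = entry_wt p t ?A i k * entry_wt p t ?B k j" using k by (simp add: entry_wt_def)
  qed
  also have "\<dots> \<le> (\<Sum>k<n. entry_wt p t ?A i k * entry_wt p t ?B k j)"
    using ij t by (intro sum_mono2) (auto intro!: mult_nonneg_nonneg entry_wt_nonneg)
  finally show ?thesis .
next
  case False
  then show ?thesis
    using t by (auto simp: entry_wt_def[of _ _ _ i j] intro!: sum_nonneg mult_nonneg_nonneg entry_wt_nonneg)
qed

lemma mat_wt_mult:
  assumes p: "p > 0" and t: "t \<ge> 0"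
    and g: "g \<in> carrier (semidirect_UT p n)" and h: "h \<in> carrier (semidirect_UT p n)"
  shows "mat_wt p n t (g \<otimes>\<^bsub>semidirect_UT p n\<^esub> h) \<le> mat_wt p n t g * mat_wt p n t h"
proof -
  let ?a = "entry_wt p t (to_mat p n g)" and ?b = "entry_wt p t (to_mat p n h)"
  have "mat_wt p n t (g \<otimes>\<^bsub>semidirect_UT p n\<^esub> h) \<le> (\<Sum>i<n. \<Sum>j<n. \<Sum>k<n. ?a i k * ?b k j)"
    unfolding mat_wt_def to_mat_mult[OF p g h] by (intro sum_mono entry_wt_mult[OF p t _ _ g h]) auto
  also have "\<dots> = (\<Sum>i<n. \<Sum>k<n. ?a i k * (\<Sum>j<n. ?b k j))"
    unfolding sum_distrib_left by (intro sum.cong refl sum.swap)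
  also have "\<dots> \<le> (\<Sum>i<n. \<Sum>k<n. ?a i k * mat_wt p n t h)"
  proof (intro sum_mono mult_left_mono entry_wt_nonneg[OF t])
    fix k assume "k \<in> {..<n}"
    then show "(\<Sum>j<n. ?b k j) \<le> mat_wt p n t h"
      unfolding mat_wt_def
      by (intro member_le_sum[of k "{..<n}" "\<lambda>i. \<Sum>j<n. ?b i j"] sum_nonneg entry_wt_nonneg t) auto
  qed
  also have "\<dots> = mat_wt p n t g * mat_wt p n t h" by (simp add: mat_wt_def sum_distrib_right)
  finally show ?thesis .
qed

lemma log_height_mult:
  assumes "p > 0" "t \<ge> 0" "g \<in> carrier (semidirect_UT p n)" "h \<in> carrier (semidirect_UT p n)"
  shows "log_height p n t (g \<otimes>\<^bsub>semidirect_UT p n\<^esub> h) \<le> log_height p n t g + log_height p n t h"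
proof -
  note nn = mat_wt_nonneg[OF assms(2), of p n]
  have "1 + mat_wt p n t (g \<otimes>\<^bsub>semidirect_UT p n\<^esub> h) \<le> (1 + mat_wt p n t g) * (1 + mat_wt p n t h)"
    using mat_wt_mult[OF assms] nn[of g] nn[of h] by (simp add: algebra_simps)
  then have "log_height p n t (g \<otimes>\<^bsub>semidirect_UT p n\<^esub> h) \<le> ln ((1 + mat_wt p n t g) * (1 + mat_wt p n t h))"
    unfolding log_height_def using nn[of g] nn[of h] nn[of "g \<otimes>\<^bsub>semidirect_UT p n\<^esub> h"]
    by (subst ln_le_cancel_iff) (auto intro!: add_pos_nonneg mult_pos_pos)
  also have "\<dots> = log_height p n t g + log_height p n t h"
    unfolding log_height_def using nn[of g] nn[of h] by (intro ln_mult_pos) auto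
  finally show ?thesis .
qed

lemma log_height_le_height_1:
  assumes "0 \<le> t" "t \<le> 1"
  shows "log_height p n t g \<le> log_height p n 1 g"
proof -
  have "mat_wt p n t g \<le> mat_wt p n 1 g"
    unfolding mat_wt_def using assms
    by (intro sum_mono) (auto simp: entry_wt_def wt_nonneg power_le_one intro!: mult_left_le)
  then show ?thesis unfolding log_height_def
    using mat_wt_nonneg[of t p n g] assms by (subst ln_le_cancel_iff) auto
qed

text \<open>Every exponent j - i is at most n, so undoing the conjugation costs at most the factor
  (1 / t)^n. The additive cost does not depend on g, so it is negligible per step over long
  times.\<close>

lemma log_height_1_le:
  assumes t: "0 < t" "t \<le> 1"
  shows "log_height p n 1 g \<le> log_height p n t g + real n * ln (1 / t)"
proof -
  note nn = mat_wt_nonneg[of t p n g]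
  have "mat_wt p n 1 g \<le> (1 / t) ^ n * mat_wt p n t g"
    unfolding mat_wt_def sum_distrib_left
  proof (intro sum_mono)
    fix i j assume ij: "i \<in> {..<n}" "j \<in> {..<n}"
    show "entry_wt p 1 (to_mat p n g) i j \<le> (1 / t) ^ n * entry_wt p t (to_mat p n g) i j"
    proof (cases "i \<le> j")
      case True
      have "1 = (1 / t) ^ n * t ^ n" using t by (simp add: power_mult_distrib[symmetric])
      also have "\<dots> \<le> (1 / t) ^ n * t ^ (j - i)"
        using t ij by (intro mult_left_mono power_decreasing) auto
      finally have "wt p (to_mat p n g $$ (i, j)) * 1 \<le> wt p (to_mat p n g $$ (i, j)) * ((1 / t) ^ n * t ^ (j - i))"
        by (rule mult_left_mono) (rule wt_nonneg)
      then show ?thesis using True by (simp add: entry_wt_def mult_ac)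
    qed (simp add: entry_wt_def)
  qed
  moreover have "(1::real) \<le> (1 / t) ^ n" using t by (intro one_le_power) auto
  moreover have "(1 + mat_wt p n t g) * (1 / t) ^ n = (1 / t) ^ n + (1 / t) ^ n * mat_wt p n t g"
    by (simp only: distrib_right mult_1_left mult.commute[of "mat_wt p n t g"])
  ultimately have "1 + mat_wt p n 1 g \<le> (1 + mat_wt p n t g) * (1 / t) ^ n" by linarith
  then have "log_height p n 1 g \<le> ln ((1 + mat_wt p n t g) * (1 / t) ^ n)"
    unfolding log_height_def using nn t mat_wt_nonneg[of 1 p n g]
    by (subst ln_le_cancel_iff) (auto intro!: add_pos_nonneg)
  also have "\<dots> = log_height p n t g + real n * ln (1 / t)"
    unfolding log_height_def using nn t by (subst ln_mult_pos) (auto simp: ln_realpow)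
  finally show ?thesis .
qed

lemma log_height_tendsto:
  "(\<lambda>k. log_height p n (inverse (real (Suc k))) g)
     \<longlonglongrightarrow> ln (1 + (\<Sum>i<n. wt p (to_mat p n g $$ (i, i))))"
proof -
  let ?A = "to_mat p n g"
  have "(\<lambda>k. entry_wt p (inverse (real (Suc k))) ?A i j)
      \<longlonglongrightarrow> (if i = j then wt p (?A $$ (i, i)) else 0)" for i j
  proof -
    \<comment> \<open>The limit \<open>0 ^ (j - i)\<close> is 1 on the diagonal and 0 above it.
      Below the diagonal the truncated exponent is 0 as well, but there \<open>entry_wt\<close> is 0
      by definition.\<close>
    have "(\<lambda>k. wt p (?A $$ (i, j)) * inverse (real (Suc k)) ^ (j - i))
        \<longlonglongrightarrow> wt p (?A $$ (i, j)) * 0 ^ (j - i)"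
      by (intro tendsto_intros LIMSEQ_inverse_real_of_nat)
    then show ?thesis by (cases i j rule: linorder_cases) (auto simp: entry_wt_def power_0_left)
  qed
  then have "(\<lambda>k. mat_wt p n (inverse (real (Suc k))) g)
      \<longlonglongrightarrow> (\<Sum>i<n. \<Sum>j<n. if i = j then wt p (?A $$ (i, i)) else 0)"
    unfolding mat_wt_def by (intro tendsto_sum)
  also have "(\<Sum>i<n. \<Sum>j<n. if i = j then wt p (?A $$ (i, i)) else 0) = (\<Sum>i<n. wt p (?A $$ (i, i)))"
    by (intro sum.cong refl) simp
  finally have lim: "(\<lambda>k. mat_wt p n (inverse (real (Suc k))) g) \<longlonglongrightarrow> (\<Sum>i<n. wt p (?A $$ (i, i)))" .
  have "(\<Sum>i<n. wt p (?A $$ (i, i))) \<ge> 0" by (intro sum_nonneg wt_nonneg)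
  then show ?thesis unfolding log_height_def by (intro tendsto_ln tendsto_add tendsto_const lim) linarith
qed

text \<open>Every diagonal entry has weight at most 2 p^s, where s is the sum of all
  \<bar>x_i\<bar>. Taking the sum in place of the maximum makes the bound additive over the
  coordinates, so that their means can be estimated one at a time.\<close>

lemma ln_diagonal_wt_le:
  assumes p: "p > 0" and g: "g \<in> carrier (semidirect_UT p n)"
  shows "ln (1 + (\<Sum>i<n. wt p (to_mat p n g $$ (i, i))))
       \<le> ln (2 * real n + 1) + ln (real p) * (\<Sum>i<n. \<bar>real_of_int (fst g $ i)\<bar>)"
proof -
  let ?s = "\<Sum>i<n. nat \<bar>fst g $ i\<bar>"
  have s: "real ?s = (\<Sum>i<n. \<bar>real_of_int (fst g $ i)\<bar>)" by simp
  have "(\<Sum>i<n. wt p (to_mat p n g $$ (i, i))) \<le> (\<Sum>i<n. 2 * real p ^ ?s)"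
  proof (rule sum_mono)
    fix i assume i: "i \<in> {..<n}"
    have "wt p (to_mat p n g $$ (i, i)) \<le> 2 * real p ^ nat \<bar>fst g $ i\<bar>"
      using i g p by (simp add: to_mat_diag wt_power_int_le)
    also have "\<dots> \<le> 2 * real p ^ ?s"
      using p i member_le_sum[of i "{..<n}" "\<lambda>i. nat \<bar>fst g $ i\<bar>"]
      by (intro mult_left_mono power_increasing) auto
    finally show "wt p (to_mat p n g $$ (i, i)) \<le> 2 * real p ^ ?s" .
  qed
  moreover have "1 \<le> real p ^ ?s" using p by (intro one_le_power) auto
  ultimately have le: "1 + (\<Sum>i<n. wt p (to_mat p n g $$ (i, i))) \<le> (2 * real n + 1) * real p ^ ?s"
    by (simp add: algebra_simps)
  have "(\<Sum>i<n. wt p (to_mat p n g $$ (i, i))) \<ge> 0" by (intro sum_nonneg wt_nonneg)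
  then have "ln (1 + (\<Sum>i<n. wt p (to_mat p n g $$ (i, i)))) \<le> ln ((2 * real n + 1) * real p ^ ?s)"
    using le p by (subst ln_le_cancel_iff) (auto intro!: mult_pos_pos)
  also have "\<dots> = ln (2 * real n + 1) + real ?s * ln (real p)"
    using p by (subst ln_mult_pos) (auto simp: ln_realpow)
  finally show ?thesis unfolding s by (simp add: mult.commute)
qed

text \<open>This makes the coordinates integrable whenever the height is, so that the results on
  integrable walks apply to them.\<close>

lemma abs_fst_le_log_height:
  assumes p: "p > 0" and i: "i < n" and g: "g \<in> carrier (semidirect_UT p n)"
  shows "\<bar>real_of_int (fst g $ i)\<bar> * ln (real p) \<le> log_height p n 1 g"
proof -
  let ?A = "to_mat p n g"
  have "real p ^ nat \<bar>fst g $ i\<bar> \<le> wt p (?A $$ (i, i))"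
    using i g p by (simp add: to_mat_diag wt_power_int_ge)
  also have "\<dots> = entry_wt p 1 ?A i i" by (simp add: entry_wt_def)
  also have "\<dots> \<le> (\<Sum>j<n. entry_wt p 1 ?A i j)"
    using i by (intro member_le_sum[of i "{..<n}" "entry_wt p 1 ?A i"] entry_wt_nonneg) auto
  also have "\<dots> \<le> mat_wt p n 1 g"
    unfolding mat_wt_def
    using i by (intro member_le_sum[of i "{..<n}" "\<lambda>i. \<Sum>j<n. entry_wt p 1 ?A i j"] sum_nonneg entry_wt_nonneg) auto
  finally have le: "real p ^ nat \<bar>fst g $ i\<bar> \<le> 1 + mat_wt p n 1 g" by simp
  have "\<bar>real_of_int (fst g $ i)\<bar> * ln (real p) = ln (real p ^ nat \<bar>fst g $ i\<bar>)"
    using p by (simp add: ln_realpow)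
  also have "\<dots> \<le> log_height p n 1 g"
    unfolding log_height_def using le p mat_wt_nonneg[of 1 p n g] by (subst ln_le_cancel_iff) auto
  finally show ?thesis .
qed

text \<open>An element is determined by its n^2 matrix entries, each of which lies in the ball of
  radius t of Z[1/p], a set of at most 6 t^3 elements.\<close>

lemma card_mat_wt_fibre:
  assumes p: "p > 1" and t: "t \<ge> (1::nat)"
  shows "finite {g \<in> carrier (semidirect_UT p n). nat \<lceil>1 + mat_wt p n 1 g\<rceil> = t}" (is "finite ?F")
    and "card {g \<in> carrier (semidirect_UT p n). nat \<lceil>1 + mat_wt p n 1 g\<rceil> = t} \<le> (6 * t ^ 3) ^ (n * n)"
proof -
  let ?I = "{..<n} \<times> {..<n}"
  let ?Z = "{a \<in> Z_inv p. wt p a \<le> real t}"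
  let ?e = "\<lambda>g. restrict (\<lambda>ij. to_mat p n g $$ ij) ?I"
  note Z = card_wt_le[OF p t]
  have inj: "inj_on ?e ?F"
  proof (rule inj_onI)
    fix g h assume g: "g \<in> ?F" and h: "h \<in> ?F" and eq: "?e g = ?e h"
    have "to_mat p n g = to_mat p n h"
    proof (rule eq_matI)
      have d: "to_mat p n g \<in> carrier_mat n n" "to_mat p n h \<in> carrier_mat n n"
        using g h by (auto intro: to_mat_carrier)
      then show "dim_row (to_mat p n g) = dim_row (to_mat p n h)"
        and "dim_col (to_mat p n g) = dim_col (to_mat p n h)" by auto
      fix i j assume "i < dim_row (to_mat p n h)" "j < dim_col (to_mat p n h)"
      then show "to_mat p n g $$ (i, j) = to_mat p n h $$ (i, j)"
        using d fun_cong[OF eq, of "(i, j)"] by auto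
    qed
    then show "g = h" using inj_onD[OF inj_on_to_mat[OF p]] g h by blast
  qed
  have sub: "?e ` ?F \<subseteq> ?I \<rightarrow>\<^sub>E ?Z"
  proof (rule image_subsetI, unfold restrict_PiE_iff, rule ballI)
    fix g ij assume gF: "g \<in> ?F" and "ij \<in> ?I"
    then obtain i j where ij_eq: "ij = (i, j)" and ij: "i \<in> {..<n}" "j \<in> {..<n}" by auto
    have g: "g \<in> carrier (semidirect_UT p n)" and tt: "t = nat \<lceil>1 + mat_wt p n 1 g\<rceil>" using gF by auto
    let ?A = "to_mat p n g"
    have mt: "1 + mat_wt p n 1 g \<le> real (nat \<lceil>1 + mat_wt p n 1 g\<rceil>)"
      by (rule real_nat_ceiling_ge)
    have "?A $$ (i, j) \<in> Z_inv p" using g ij by (intro to_mat_Z_inv) auto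
    moreover have "wt p (?A $$ (i, j)) \<le> real (nat \<lceil>1 + mat_wt p n 1 g\<rceil>)"
    proof (cases "i \<le> j")
      case True
      then have "wt p (?A $$ (i, j)) = entry_wt p 1 ?A i j" by (simp add: entry_wt_def)
      also have "\<dots> \<le> (\<Sum>j<n. entry_wt p 1 ?A i j)"
        using ij by (intro member_le_sum[of j "{..<n}" "entry_wt p 1 ?A i"] entry_wt_nonneg) auto
      also have "\<dots> \<le> mat_wt p n 1 g"
        unfolding mat_wt_def
        using ij by (intro member_le_sum[of i "{..<n}" "\<lambda>i. \<Sum>j<n. entry_wt p 1 ?A i j"] sum_nonneg entry_wt_nonneg) auto
      finally show ?thesis using mt by linarith
    next
      \<comment> \<open>A zero below the diagonal has weight 1 and does not contribute to
        \<open>mat_wt\<close>; the summand 1 in the ceiling covers it.\<close>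
      case False
      have "den_exp p 0 = 0" using den_exp_le[of 0 p 0] by simp
      then have "wt p (?A $$ (i, j)) = 1"
        using to_mat_lower[OF g, of i j] ij False by (simp add: wt_def)
      then show ?thesis using mt mat_wt_nonneg[of 1 p n "g"] by linarith
    qed
    ultimately show "to_mat p n g $$ ij \<in> ?Z" by (simp add: ij_eq tt)
  qed
  have finE: "finite (?I \<rightarrow>\<^sub>E ?Z)" using Z by (intro finite_PiE) auto
  show "finite ?F" by (rule inj_on_finite[OF inj sub finE])
  have "card ?F \<le> card (?I \<rightarrow>\<^sub>E ?Z)" by (rule card_inj_on_le[OF inj sub finE])
  also have "\<dots> = card ?Z ^ (n * n)" by (simp add: card_PiE)
  also have "\<dots> \<le> (6 * t ^ 3) ^ (n * n)" by (intro power_mono Z) simp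
  finally show "card ?F \<le> (6 * t ^ 3) ^ (n * n)" .
qed

section \<open>Sublinear entropy\<close>

text \<open>The dimension is part of the induction, since reading an entry of a vector sum requires
  the index to be in range for the tail.\<close>

lemma fst_foldr_semidirect_UT:
  assumes "set ws \<subseteq> carrier (semidirect_UT p n)" "i < n"
  shows "fst (foldr (monoid.mult (semidirect_UT p n)) ws \<one>\<^bsub>semidirect_UT p n\<^esub>) \<in> carrier_vec n \<and>
    fst (foldr (monoid.mult (semidirect_UT p n)) ws \<one>\<^bsub>semidirect_UT p n\<^esub>) $ i
       = sum_list (map (\<lambda>g. fst g $ i) ws)"
  using assms(1)
proof (induction ws)
  case Nil
  then show ?case using assms(2) by (simp add: semidirect_UT_def)
next
  case (Cons w ws)
  then show ?case using assms(2) by (auto simp: semidirect_UT_def case_prod_beta')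
qed

context
  fixes p n :: nat and \<mu> :: "(int Matrix.vec \<times> rat mat) pmf"
  assumes p: "p > 1"
    and supp: "set_pmf \<mu> \<subseteq> carrier (semidirect_UT p n)"
    and int_height: "integrable (measure_pmf \<mu>) (log_height p n 1)"
begin

interpretation group "semidirect_UT p n"
  by (rule group_semidirect_UT[OF p])

private abbreviation "W \<equiv> conv_power (semidirect_UT p n) \<mu>"

lemma integrable_coordinate:
  assumes i: "i < n"
  shows "integrable (measure_pmf \<mu>) (\<lambda>g. real_of_int (fst g $ i))"
proof (rule Bochner_Integration.integrable_bound)
  show "integrable (measure_pmf \<mu>) (\<lambda>g. log_height p n 1 g / ln (real p))" using int_height by simp
  show "AE g in \<mu>. norm (real_of_int (fst g $ i)) \<le> norm (log_height p n 1 g / ln (real p))"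
    unfolding AE_measure_pmf_iff
  proof
    fix g assume "g \<in> set_pmf \<mu>"
    then have "\<bar>real_of_int (fst g $ i)\<bar> * ln (real p) \<le> log_height p n 1 g"
      using supp p i by (intro abs_fst_le_log_height) auto
    moreover have "ln (real p) > 0" using p by simp
    ultimately have "\<bar>real_of_int (fst g $ i)\<bar> \<le> log_height p n 1 g / ln (real p)"
      by (simp add: pos_le_divide_eq)
    then show "norm (real_of_int (fst g $ i)) \<le> norm (log_height p n 1 g / ln (real p))"
      using abs_ge_self[of "log_height p n 1 g / ln (real p)"] unfolding real_norm_def by linarith
  qed
qed simp

lemma integrable_height_conv_power:
  assumes "0 \<le> t" "t \<le> 1"
  shows "integrable (measure_pmf (W m)) (log_height p n t)"
proof (rule integrable_subadditive_conv_power[OF supp])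
  show "integrable (measure_pmf \<mu>) (log_height p n t)"
    by (rule Bochner_Integration.integrable_bound[OF int_height])
       (use log_height_le_height_1[OF assms] log_height_nonneg[OF assms(1)] log_height_nonneg[of 1] in auto)
qed (use assms p in \<open>auto intro: log_height_nonneg log_height_mult\<close>)

text \<open>Subadditivity over the blocks is applied to the height for t, and the comparison with
  the height for 1 happens only at time \<open>m * N\<close>. Thus its cost is not multiplied by
  m.\<close>

lemma expectation_height_conv_power:
  assumes "0 < t" "t \<le> 1"
  shows "measure_pmf.expectation (W (m * N)) (log_height p n 1)
     \<le> real n * ln (1 / t) + log_height p n t \<one>\<^bsub>semidirect_UT p n\<^esub>
        + real m * measure_pmf.expectation (W N) (log_height p n t)"
proof -
  have int: "integrable (measure_pmf (W k)) (log_height p n t)"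
      "integrable (measure_pmf (W k)) (log_height p n 1)" for k
    using assms by (auto intro!: integrable_height_conv_power)
  have int1: "integrable (measure_pmf \<mu>) (log_height p n t)"
    by (rule Bochner_Integration.integrable_bound[OF int_height])
       (use log_height_le_height_1[of t p n] log_height_nonneg[of t p n] log_height_nonneg[of 1] assms in auto)
  have "measure_pmf.expectation (W (m * N)) (log_height p n 1)
      \<le> measure_pmf.expectation (W (m * N)) (\<lambda>g. log_height p n t g + real n * ln (1 / t))"
    using int log_height_1_le[OF assms, of p n] by (intro integral_mono) auto
  also have "\<dots> = measure_pmf.expectation (W (m * N)) (log_height p n t) + real n * ln (1 / t)"
    using int by simp
  also have "measure_pmf.expectation (W (m * N)) (log_height p n t)
      \<le> log_height p n t \<one>\<^bsub>semidirect_UT p n\<^esub> + real m * measure_pmf.expectation (W N) (log_height p n t)"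
    by (rule expectation_subadditive_conv_power[OF supp])
       (use assms p int1 in \<open>auto intro: log_height_nonneg log_height_mult\<close>)
  finally show ?thesis by simp
qed

lemma expectation_abs_coordinate_conv_power:
  assumes i: "i < n"
  shows "measure_pmf.expectation (W N) (\<lambda>g. \<bar>real_of_int (fst g $ i)\<bar>)
       = measure_pmf.expectation (replicate_pmf N \<mu>) (\<lambda>ws. \<bar>sum_list (map (\<lambda>g. real_of_int (fst g $ i)) ws)\<bar>)"
proof -
  have "measure_pmf.expectation (W N) (\<lambda>g. \<bar>real_of_int (fst g $ i)\<bar>)
      = measure_pmf.expectation (replicate_pmf N \<mu>) (\<lambda>ws. \<bar>real_of_int (fst (foldr
          (monoid.mult (semidirect_UT p n)) ws \<one>\<^bsub>semidirect_UT p n\<^esub>) $ i)\<bar>)"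
    by (simp add: conv_power_replicate_pmf)
  also have "\<dots> = measure_pmf.expectation (replicate_pmf N \<mu>)
      (\<lambda>ws. \<bar>sum_list (map (\<lambda>g. real_of_int (fst g $ i)) ws)\<bar>)"
  proof (rule integral_cong_AE)
    have "real_of_int (sum_list (map (\<lambda>g. fst g $ i) ws)) = sum_list (map (\<lambda>g. real_of_int (fst g $ i)) ws)" for ws :: "(int Matrix.vec \<times> rat mat) list"
      by (induction ws) auto
    then show "AE ws in replicate_pmf N \<mu>. \<bar>real_of_int (fst (foldr
          (monoid.mult (semidirect_UT p n)) ws \<one>\<^bsub>semidirect_UT p n\<^esub>) $ i)\<bar>
        = \<bar>sum_list (map (\<lambda>g. real_of_int (fst g $ i)) ws)\<bar>"
      using fst_foldr_semidirect_UT[OF _ i, of _ p] supp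
      by (auto simp: AE_measure_pmf_iff set_replicate_pmf lists_eq_set subset_iff)
  qed auto
  finally show ?thesis .
qed

text \<open>For fixed N, dominated convergence as t tends to 0 leaves the logarithm of the diagonal
  part. Its mean is at most a constant plus ln p times the means of the \<bar>S_i\<bar>, hence at
  most half of \<open>\<epsilon> * real N\<close> for large N. The other half is the slack from
  which t is found.\<close>

lemma expectation_height_block_small:
  assumes mean: "\<And>i. i < n \<Longrightarrow> measure_pmf.expectation \<mu> (\<lambda>g. real_of_int (fst g $ i)) = 0"
    and e: "\<epsilon> > 0"
  obtains N t where "N \<ge> 1" "0 < t" "t \<le> 1"
    "measure_pmf.expectation (W N) (log_height p n t) \<le> \<epsilon> * real N"
proof -
  have lnp: "ln (real p) > 0" using p by simp
  \<comment> \<open>The n coordinates together then contribute at most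
    \<open>\<epsilon> / 4 * real N\<close>. The factor \<open>real n + 1\<close> keeps the
    denominator nonzero for n = 0.\<close>
  define \<delta> where "\<delta> = \<epsilon> / (4 * ln (real p) * (real n + 1))"
  have \<delta>: "\<delta> > 0" using e lnp by (simp add: \<delta>_def)
  have "\<exists>n0. \<forall>N\<ge>n0. measure_pmf.expectation (W N) (\<lambda>g. \<bar>real_of_int (fst g $ i)\<bar>) \<le> \<delta> * real N"
    if i: "i < n" for i
    using expectation_abs_sum_list_sublinear[OF integrable_coordinate[OF i] mean[OF i] \<delta>]
    by (metis expectation_abs_coordinate_conv_power[OF i])
  then obtain n0 where n0: "\<And>i N. i < n \<Longrightarrow> N \<ge> n0 i \<Longrightarrow>
      measure_pmf.expectation (W N) (\<lambda>g. \<bar>real_of_int (fst g $ i)\<bar>) \<le> \<delta> * real N" by metis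
  obtain n1 :: nat where n1: "4 * ln (2 * real n + 1) / \<epsilon> \<le> real n1" using real_arch_simple by blast
  \<comment> \<open>The sum exceeds each single threshold \<open>n0 i\<close>, while
    \<open>n1\<close> lets N absorb the additive constant.\<close>
  define N where "N = Suc n1 + (\<Sum>i<n. n0 i)"
  have N: "N \<ge> 1" by (simp add: N_def)
  have N_n0: "n0 i \<le> N" if "i < n" for i
    using member_le_sum[of i "{..<n}" n0] that by (simp add: N_def)
  let ?D = "\<lambda>g. ln (1 + (\<Sum>i<n. wt p (to_mat p n g $$ (i, i))))"
  let ?b = "\<lambda>g. ln (2 * real n + 1) + ln (real p) * (\<Sum>i<n. \<bar>real_of_int (fst g $ i)\<bar>)"
  have WG: "set_pmf (W N) \<subseteq> carrier (semidirect_UT p n)" by (rule set_conv_power[OF supp])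
  have conv: "(\<lambda>k. measure_pmf.expectation (W N) (log_height p n (inverse (real (Suc k)))))
      \<longlonglongrightarrow> measure_pmf.expectation (W N) ?D"
  proof (rule integral_dominated_convergence[where w="log_height p n 1"])
    show "integrable (measure_pmf (W N)) (log_height p n 1)" by (rule integrable_height_conv_power) auto
    show "AE g in W N. (\<lambda>k. log_height p n (inverse (real (Suc k))) g) \<longlonglongrightarrow> ?D g"
      by (rule AE_I2) (rule log_height_tendsto)
    fix k
    have "inverse (real (Suc k)) \<le> 1" by (simp add: field_simps)
    then show "AE g in W N. norm (log_height p n (inverse (real (Suc k))) g) \<le> log_height p n 1 g"
      using log_height_le_height_1[of "inverse (real (Suc k))" p n] log_height_nonneg[of "inverse (real (Suc k))" p n]
      by (intro AE_I2) (simp del: of_nat_Suc)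
  qed auto
  have int_coord: "integrable (measure_pmf (W N)) (\<lambda>g. \<bar>real_of_int (fst g $ i)\<bar>)" if i: "i < n" for i
  proof (rule Bochner_Integration.integrable_bound)
    show "integrable (measure_pmf (W N)) (\<lambda>g. log_height p n 1 g / ln (real p))"
      using integrable_height_conv_power[of 1 N] by simp
    show "AE g in W N. norm \<bar>real_of_int (fst g $ i)\<bar> \<le> norm (log_height p n 1 g / ln (real p))"
      unfolding AE_measure_pmf_iff
    proof
      fix g assume "g \<in> set_pmf (W N)"
      then have "\<bar>real_of_int (fst g $ i)\<bar> * ln (real p) \<le> log_height p n 1 g"
        using WG p i by (intro abs_fst_le_log_height) auto
      then have "\<bar>real_of_int (fst g $ i)\<bar> \<le> log_height p n 1 g / ln (real p)"
        using lnp by (simp add: pos_le_divide_eq)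
      then show "norm \<bar>real_of_int (fst g $ i)\<bar> \<le> norm (log_height p n 1 g / ln (real p))"
        using abs_ge_self[of "log_height p n 1 g / ln (real p)"] unfolding real_norm_def abs_idempotent by linarith
    qed
  qed simp
  have D_nonneg: "0 \<le> ?D g" for g
    by (intro ln_ge_zero) (simp add: sum_nonneg wt_nonneg)
  have int_b: "integrable (measure_pmf (W N)) ?b"
    using int_coord by (intro Bochner_Integration.integrable_add integrable_const
      Bochner_Integration.integrable_mult_right Bochner_Integration.integrable_sum) auto
  have D_le: "AE g in W N. ?D g \<le> ?b g"
    unfolding AE_measure_pmf_iff using WG p by (auto intro!: ln_diagonal_wt_le)
  have int_D: "integrable (measure_pmf (W N)) ?D"
    by (rule Bochner_Integration.integrable_bound[OF int_b])
       (use D_le in \<open>auto elim!: eventually_mono simp del: sum_abs simp: abs_of_nonneg[OF D_nonneg]\<close>)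
  have "measure_pmf.expectation (W N) ?D \<le> measure_pmf.expectation (W N) ?b"
    by (rule integral_mono_AE[OF int_D int_b D_le])
  also have "\<dots> = ln (2 * real n + 1)
      + ln (real p) * (\<Sum>i<n. measure_pmf.expectation (W N) (\<lambda>g. \<bar>real_of_int (fst g $ i)\<bar>))"
    using int_coord by (subst Bochner_Integration.integral_add) (auto simp: Bochner_Integration.integral_sum)
  also have "\<dots> \<le> ln (2 * real n + 1) + ln (real p) * (\<Sum>i<n. \<delta> * real N)"
    using lnp N_n0 by (intro add_left_mono mult_left_mono sum_mono n0) auto
  also have "\<dots> \<le> \<epsilon> / 4 * real N + \<epsilon> / 4 * real N"
  proof (rule add_mono)
    have "n1 \<le> N" by (simp add: N_def)
    with n1 have "4 * ln (2 * real n + 1) / \<epsilon> \<le> real N" by linarith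
    then show "ln (2 * real n + 1) \<le> \<epsilon> / 4 * real N" using e by (simp add: pos_divide_le_eq mult.commute)
    have "ln (real p) * (\<Sum>i<n. \<delta> * real N) = (\<epsilon> / 4 * real N) * (real n / (real n + 1))"
      using lnp by (simp add: \<delta>_def)
    also have "\<dots> \<le> (\<epsilon> / 4 * real N) * 1" using e by (intro mult_left_mono) auto
    finally show "ln (real p) * (\<Sum>i<n. \<delta> * real N) \<le> \<epsilon> / 4 * real N" by simp
  qed
  also have "\<dots> < \<epsilon> * real N" using e N by simp
  finally have "\<forall>\<^sub>F k in sequentially.
      measure_pmf.expectation (W N) (log_height p n (inverse (real (Suc k)))) < \<epsilon> * real N"
    using conv by (intro order_tendstoD(2))
  then obtain k where "measure_pmf.expectation (W N) (log_height p n (inverse (real (Suc k)))) < \<epsilon> * real N"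
    using eventually_happens[of _ sequentially] by auto
  then show ?thesis
    by (intro that[of N "inverse (real (Suc k))"] N) (auto simp: field_simps)
qed

text \<open>The counting function is the norm rounded up to a natural number, which costs at most ln
  2 in the logarithm. The growth exponent 3 n^2 consists of a cubic count for each of the n^2
  entries.\<close>

lemma pmf_entropy_le_height:
  obtains c C where "c > 0"
    "\<And>m. integrable (measure_pmf (W m)) (\<lambda>x. ln (pmf (W m) x))"
    "\<And>m. pmf_entropy (W m) \<le> c * measure_pmf.expectation (W m) (log_height p n 1) + C"
proof -
  let ?G = "semidirect_UT p n"
  define T where "T g = nat \<lceil>1 + mat_wt p n 1 g\<rceil>" for g
  define r where "r = 3 * (n * n)"
  have mat_wt: "0 \<le> mat_wt p n 1 g" for g by (rule mat_wt_nonneg) simp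
  have T_ge: "1 + mat_wt p n 1 g \<le> real (T g)" for g
    unfolding T_def by (rule real_nat_ceiling_ge)
  have T1: "T g \<ge> 1" for g
    using T_ge[of g] mat_wt[of g] by linarith
  have T_le: "ln (real (T g)) \<le> ln 2 + log_height p n 1 g" for g
  proof -
    have "real (T g) = of_int \<lceil>1 + mat_wt p n 1 g\<rceil>"
      unfolding T_def using mat_wt[of g] by (intro of_nat_nat) linarith
    also have "\<dots> \<le> (1 + mat_wt p n 1 g) + 1" by (rule of_int_ceiling_le_add_one)
    also have "\<dots> \<le> 2 * (1 + mat_wt p n 1 g)" using mat_wt[of g] by simp
    finally have "real (T g) \<le> 2 * (1 + mat_wt p n 1 g)" .
    then have "ln (real (T g)) \<le> ln (2 * (1 + mat_wt p n 1 g))"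
      using T1[of g] mat_wt[of g] by (subst ln_le_cancel_iff) auto
    also have "\<dots> = ln 2 + log_height p n 1 g"
      unfolding log_height_def using mat_wt[of g] by (intro ln_mult_pos) auto
    finally show ?thesis .
  qed
  have fin: "finite {g \<in> carrier ?G. T g = t}" for t
  proof (cases "t = 0")
    case True
    have "{g \<in> carrier ?G. T g = t} = {}"
      unfolding True using T1 by (metis (mono_tags, lifting) Collect_empty_eq not_one_le_zero)
    then show ?thesis by (simp only: finite.emptyI)
  next
    case False
    then show ?thesis using card_mat_wt_fibre(1)[OF p, of t n] by (simp add: T_def)
  qed
  have card: "real (card {g \<in> carrier ?G. T g = t}) \<le> 6 ^ (n * n) * real t ^ r" if "t \<ge> 1" for t
  proof -
    have "real (card {g \<in> carrier ?G. T g = t}) \<le> real ((6 * t ^ 3) ^ (n * n))"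
      using card_mat_wt_fibre(2)[OF p that, of n] unfolding T_def of_nat_le_iff .
    also have "\<dots> = 6 ^ (n * n) * real t ^ r"
      by (simp add: r_def power_mult_distrib power_mult)
    finally show ?thesis .
  qed
  obtain C where C: "\<And>V. set_pmf V \<subseteq> carrier ?G \<Longrightarrow> integrable (measure_pmf V) (\<lambda>x. ln (real (T x))) \<Longrightarrow>
      integrable (measure_pmf V) (\<lambda>x. ln (pmf V x)) \<and>
      pmf_entropy V \<le> (real r + 2) * measure_pmf.expectation V (\<lambda>x. ln (real (T x))) + C"
    using pmf_entropy_le_expectation_ln[of "6 ^ (n * n)" "carrier ?G" T r, OF _ T1 fin card] by auto
  have intH: "integrable (measure_pmf (W m)) (log_height p n 1)" for m
    by (rule integrable_height_conv_power) auto
  have intT: "integrable (measure_pmf (W m)) (\<lambda>x. ln (real (T x)))" for m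
  proof (rule Bochner_Integration.integrable_bound)
    show "integrable (measure_pmf (W m)) (\<lambda>g. ln 2 + log_height p n 1 g)" using intH by simp
    show "AE g in W m. norm (ln (real (T g))) \<le> norm (ln 2 + log_height p n 1 g)"
    proof (rule AE_I2)
      fix g
      have "0 \<le> ln (real (T g))" using T1[of g] by (intro ln_ge_zero) simp
      then show "norm (ln (real (T g))) \<le> norm (ln 2 + log_height p n 1 g)" using T_le[of g] by simp
    qed
  qed simp
  note W = set_conv_power[OF supp]
  show ?thesis
  proof (rule that[of "real r + 2" "(real r + 2) * ln 2 + C"])
    fix m
    show "integrable (measure_pmf (W m)) (\<lambda>x. ln (pmf (W m) x))" using C[OF W intT] by blast
    have "measure_pmf.expectation (W m) (\<lambda>x. ln (real (T x)))
        \<le> measure_pmf.expectation (W m) (\<lambda>x. ln 2 + log_height p n 1 x)"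
      using intT intH T_le by (intro integral_mono) auto
    also have "\<dots> = ln 2 + measure_pmf.expectation (W m) (log_height p n 1)" using intH by simp
    finally have "(real r + 2) * measure_pmf.expectation (W m) (\<lambda>x. ln (real (T x)))
        \<le> (real r + 2) * (ln 2 + measure_pmf.expectation (W m) (log_height p n 1))"
      by (rule mult_left_mono) simp
    then show "pmf_entropy (W m) \<le> (real r + 2) * measure_pmf.expectation (W m) (log_height p n 1)
        + ((real r + 2) * ln 2 + C)"
      using C[OF W intT, of m] by (simp only: distrib_left) linarith
  qed simp
qed

lemma entropy_sublinear:
  assumes mean: "\<And>i. i < n \<Longrightarrow> measure_pmf.expectation \<mu> (\<lambda>g. real_of_int (fst g $ i)) = 0"
    and e: "\<epsilon> > 0"
  shows "\<exists>m\<ge>1. pmf_entropy (W m) \<le> \<epsilon> * real m"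
proof -
  obtain c C where c: "c > 0"
    and H: "\<And>m. pmf_entropy (W m) \<le> c * measure_pmf.expectation (W m) (log_height p n 1) + C"
    using pmf_entropy_le_height by metis
  obtain N t where N: "N \<ge> 1" and t: "0 < t" "t \<le> 1"
    and small: "measure_pmf.expectation (W N) (log_height p n t) \<le> \<epsilon> / (2 * c) * real N"
    using expectation_height_block_small[OF mean, of "\<epsilon> / (2 * c)"] e c by auto
  define K where "K = real n * ln (1 / t) + log_height p n t \<one>\<^bsub>semidirect_UT p n\<^esub>"
  \<comment> \<open>The costs independent of m are \<open>c * K + C\<close>. Enough blocks make them
    at most half of the allowance; the blocks use the other half.\<close>
  obtain m0 :: nat where m0: "2 * (c * K + C) / \<epsilon> \<le> real m0" using real_arch_simple by blast
  define m where "m = Suc m0"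
  have "measure_pmf.expectation (W (m * N)) (log_height p n 1) \<le> K + real m * (\<epsilon> / (2 * c) * real N)"
    using expectation_height_conv_power[OF t, of m N] mult_left_mono[OF small, of "real m"]
    by (simp add: K_def)
  then have "c * measure_pmf.expectation (W (m * N)) (log_height p n 1)
      \<le> c * (K + real m * (\<epsilon> / (2 * c) * real N))"
    using c by (intro mult_left_mono) auto
  also have "\<dots> = c * K + \<epsilon> / 2 * real (m * N)" using c by (simp add: field_simps)
  finally have "pmf_entropy (W (m * N)) \<le> c * K + C + \<epsilon> / 2 * real (m * N)" using H[of "m * N"] by linarith
  moreover have "c * K + C \<le> \<epsilon> / 2 * real (m * N)"
  proof -
    have "m * 1 \<le> m * N" using N by (intro mult_le_mono2)
    then have "m0 \<le> m * N" by (simp add: m_def)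
    with m0 have "2 * (c * K + C) / \<epsilon> \<le> real (m * N)" by linarith
    then show ?thesis using e by (simp add: pos_divide_le_eq mult.commute)
  qed
  ultimately have "pmf_entropy (W (m * N)) \<le> \<epsilon> * real (m * N)" by linarith
  moreover have "m * N \<ge> 1" using N by (simp add: m_def)
  ultimately show ?thesis by blast
qed

end

section \<open>Boundaries\<close>

lemma space_borel_on [simp]: "space (borel_on B) = topspace B"
  unfolding borel_on_def by (rule space_measure_of) (auto dest: openin_subset)

lemma sets_borel_on: "sets (borel_on B) = sigma_sets (topspace B) {U. openin B U}"
  unfolding borel_on_def by (rule sets_measure_of) (auto dest: openin_subset)

lemma openin_sets_borel_on: "openin B U \<Longrightarrow> U \<in> sets (borel_on B)"
  by (auto simp: sets_borel_on)

lemma continuous_map_measurable_borel_on: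
  assumes "continuous_map B C f"
  shows "f \<in> measurable (borel_on B) (borel_on C)"
  unfolding borel_on_def[of C]
proof (rule measurable_measure_of)
  show "f \<in> space (borel_on B) \<rightarrow> topspace C"
    using continuous_map_funspace[OF assms] by simp
  fix U assume "U \<in> {U. openin C U}"
  then have "openin B {x \<in> topspace B. f x \<in> U}"
    using assms by (auto simp: continuous_map_def)
  moreover have "f -` U \<inter> space (borel_on B) = {x \<in> topspace B. f x \<in> U}" by auto
  ultimately show "f -` U \<inter> space (borel_on B) \<in> sets (borel_on B)" by (simp add: openin_sets_borel_on)
qed (auto dest: openin_subset)

lemma continuous_map_borel_measurable:
  fixes \<phi> :: "'b \<Rightarrow> real"
  assumes "continuous_map B euclideanreal \<phi>"
  shows "\<phi> \<in> borel_measurable (borel_on B)"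
proof (rule borel_measurableI)
  fix U :: "real set" assume "open U"
  then have "openin B {x \<in> topspace B. \<phi> x \<in> U}"
    using assms by (auto simp: continuous_map_def)
  moreover have "\<phi> -` U \<inter> space (borel_on B) = {x \<in> topspace B. \<phi> x \<in> U}" by auto
  ultimately show "\<phi> -` U \<inter> space (borel_on B) \<in> sets (borel_on B)" by (simp add: openin_sets_borel_on)
qed

text \<open>Stationarity is a statement about sets and extends to functions by the usual monotone
  class induction. The maps \<open>act s\<close> are known to be measurable for s in the support
  only, so the integrands are identified almost everywhere.\<close>

lemma stationary_nn_integral:
  assumes st: "stationary \<mu> act \<nu>"
    and meas: "\<And>s. s \<in> set_pmf \<mu> \<Longrightarrow> act s \<in> measurable \<nu> \<nu>"
    and f: "f \<in> borel_measurable \<nu>"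
  shows "(\<integral>\<^sup>+s. (\<integral>\<^sup>+b. f (act s b) \<partial>\<nu>) \<partial>measure_pmf \<mu>) = (\<integral>\<^sup>+b. f b \<partial>\<nu>)"
  using f
proof (induction rule: borel_measurable_induct)
  case (cong f g)
  have "(\<integral>\<^sup>+b. f (act s b) \<partial>\<nu>) = (\<integral>\<^sup>+b. g (act s b) \<partial>\<nu>)" if "s \<in> set_pmf \<mu>" for s
    by (intro nn_integral_cong cong.hyps(3)) (rule measurable_space[OF meas[OF that]])
  then have "(\<integral>\<^sup>+s. (\<integral>\<^sup>+b. f (act s b) \<partial>\<nu>) \<partial>measure_pmf \<mu>) = (\<integral>\<^sup>+s. (\<integral>\<^sup>+b. g (act s b) \<partial>\<nu>) \<partial>measure_pmf \<mu>)"
    by (intro nn_integral_cong_AE) (simp add: AE_measure_pmf_iff)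
  moreover have "(\<integral>\<^sup>+b. f b \<partial>\<nu>) = (\<integral>\<^sup>+b. g b \<partial>\<nu>)" by (intro nn_integral_cong cong.hyps(3))
  ultimately show ?case using cong.IH by simp
next
  case (set A)
  have "(\<integral>\<^sup>+b. indicator A (act s b) \<partial>\<nu>) = emeasure (distr \<nu> \<nu> (act s)) A" if "s \<in> set_pmf \<mu>" for s
    using nn_integral_distr[OF meas[OF that], of "indicator A"] set by simp
  then have "(\<integral>\<^sup>+s. (\<integral>\<^sup>+b. indicator A (act s b) \<partial>\<nu>) \<partial>measure_pmf \<mu>)
      = (\<integral>\<^sup>+s. emeasure (distr \<nu> \<nu> (act s)) A \<partial>measure_pmf \<mu>)"
    by (intro nn_integral_cong_AE) (simp add: AE_measure_pmf_iff)
  also have "\<dots> = emeasure \<nu> A" using st set by (simp add: stationary_def)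
  finally show ?case using set by simp
next
  case (mult u c)
  have "(\<integral>\<^sup>+b. c * u (act s b) \<partial>\<nu>) = c * (\<integral>\<^sup>+b. u (act s b) \<partial>\<nu>)" if "s \<in> set_pmf \<mu>" for s
    by (rule nn_integral_cmult) (rule measurable_compose[OF meas[OF that] mult.hyps(2)])
  then have "(\<integral>\<^sup>+s. (\<integral>\<^sup>+b. c * u (act s b) \<partial>\<nu>) \<partial>measure_pmf \<mu>)
      = (\<integral>\<^sup>+s. c * (\<integral>\<^sup>+b. u (act s b) \<partial>\<nu>) \<partial>measure_pmf \<mu>)"
    by (intro nn_integral_cong_AE) (simp add: AE_measure_pmf_iff)
  then show ?case using mult by (simp add: nn_integral_cmult)
next
  case (add u v)
  have "(\<integral>\<^sup>+b. v (act s b) + u (act s b) \<partial>\<nu>) = (\<integral>\<^sup>+b. v (act s b) \<partial>\<nu>) + (\<integral>\<^sup>+b. u (act s b) \<partial>\<nu>)"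
    if "s \<in> set_pmf \<mu>" for s
    by (rule nn_integral_add) (rule measurable_compose[OF meas[OF that]], rule add.hyps)+
  then have "(\<integral>\<^sup>+s. (\<integral>\<^sup>+b. v (act s b) + u (act s b) \<partial>\<nu>) \<partial>measure_pmf \<mu>)
      = (\<integral>\<^sup>+s. (\<integral>\<^sup>+b. v (act s b) \<partial>\<nu>) + (\<integral>\<^sup>+b. u (act s b) \<partial>\<nu>) \<partial>measure_pmf \<mu>)"
    by (intro nn_integral_cong_AE) (simp add: AE_measure_pmf_iff)
  then show ?case using add by (simp add: nn_integral_add)
next
  case (seq U)
  have incs: "incseq (\<lambda>i. (\<integral>\<^sup>+b. U i (act s b) \<partial>\<nu>))" for s
    using seq.hyps(3) by (intro monoI nn_integral_mono) (auto simp: incseq_def le_fun_def)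
  have "(\<integral>\<^sup>+b. (SUP i. U i) (act s b) \<partial>\<nu>) = (SUP i. (\<integral>\<^sup>+b. U i (act s b) \<partial>\<nu>))"
    if "s \<in> set_pmf \<mu>" for s
    unfolding SUP_apply
    by (rule nn_integral_monotone_convergence_SUP)
       (use seq.hyps(3) measurable_compose[OF meas[OF that] seq.hyps(1)] in \<open>auto simp: incseq_def le_fun_def\<close>)
  then have "(\<integral>\<^sup>+s. (\<integral>\<^sup>+b. (SUP i. U i) (act s b) \<partial>\<nu>) \<partial>measure_pmf \<mu>)
      = (\<integral>\<^sup>+s. (SUP i. (\<integral>\<^sup>+b. U i (act s b) \<partial>\<nu>)) \<partial>measure_pmf \<mu>)"
    by (intro nn_integral_cong_AE) (simp add: AE_measure_pmf_iff)
  also have "\<dots> = (SUP i. (\<integral>\<^sup>+s. (\<integral>\<^sup>+b. U i (act s b) \<partial>\<nu>) \<partial>measure_pmf \<mu>))"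
    by (rule nn_integral_monotone_convergence_SUP) (use incs in \<open>auto simp: incseq_def le_fun_def\<close>)
  also have "\<dots> = (SUP i. (\<integral>\<^sup>+b. U i b \<partial>\<nu>))" by (simp add: seq.IH)
  also have "\<dots> = (\<integral>\<^sup>+b. (SUP i. U i b) \<partial>\<nu>)"
    by (rule nn_integral_monotone_convergence_SUP[symmetric]) (use seq.hyps in auto)
  finally show ?case by (simp add: SUP_apply image_comp)
qed

lemma stationary_integral:
  fixes f :: "'b \<Rightarrow> real"
  assumes st: "stationary \<mu> act \<nu>" and "prob_space \<nu>"
    and meas: "\<And>s. s \<in> set_pmf \<mu> \<Longrightarrow> act s \<in> measurable \<nu> \<nu>"
    and f: "f \<in> borel_measurable \<nu>" and bnd: "\<And>b. b \<in> space \<nu> \<Longrightarrow> 0 \<le> f b \<and> f b \<le> 1"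
  shows "measure_pmf.expectation \<mu> (\<lambda>s. \<integral>b. f (act s b) \<partial>\<nu>) = (\<integral>b. f b \<partial>\<nu>)"
proof -
  interpret prob_space \<nu> by fact
  have int: "integrable \<nu> g" if "g \<in> borel_measurable \<nu>" "\<And>b. b \<in> space \<nu> \<Longrightarrow> 0 \<le> g b \<and> g b \<le> 1"
    for g :: "'b \<Rightarrow> real"
    by (rule integrable_const_bound[where B=1]) (use that in auto)
  have fs: "(\<lambda>b. f (act s b)) \<in> borel_measurable \<nu>" "\<And>b. b \<in> space \<nu> \<Longrightarrow> 0 \<le> f (act s b) \<and> f (act s b) \<le> 1"
    if "s \<in> set_pmf \<mu>" for s
    using measurable_compose[OF meas[OF that] f] bnd measurable_space[OF meas[OF that]] by auto
  have fs_le: "(\<integral>b. f (act s b) \<partial>\<nu>) \<le> 1" "0 \<le> (\<integral>b. f (act s b) \<partial>\<nu>)" if "s \<in> set_pmf \<mu>" for s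
  proof -
    show "0 \<le> (\<integral>b. f (act s b) \<partial>\<nu>)" using fs[OF that] by (intro integral_nonneg_AE) auto
    have "(\<integral>b. f (act s b) \<partial>\<nu>) \<le> (\<integral>b. 1 \<partial>\<nu>)"
      using fs[OF that] by (intro integral_mono int) auto
    then show "(\<integral>b. f (act s b) \<partial>\<nu>) \<le> 1" by (simp add: prob_space)
  qed
  have intE: "integrable (measure_pmf \<mu>) (\<lambda>s. \<integral>b. f (act s b) \<partial>\<nu>)"
    by (rule bounded_integrable_pmf[where c=1]) (use fs_le in auto)
  have "ennreal (measure_pmf.expectation \<mu> (\<lambda>s. \<integral>b. f (act s b) \<partial>\<nu>))
      = (\<integral>\<^sup>+s. ennreal (\<integral>b. f (act s b) \<partial>\<nu>) \<partial>measure_pmf \<mu>)"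
    by (rule nn_integral_eq_integral[symmetric, OF intE]) (use fs_le in \<open>auto simp: AE_measure_pmf_iff\<close>)
  also have "\<dots> = (\<integral>\<^sup>+s. (\<integral>\<^sup>+b. ennreal (f (act s b)) \<partial>\<nu>) \<partial>measure_pmf \<mu>)"
  proof (intro nn_integral_cong_AE, simp only: AE_measure_pmf_iff, intro ballI)
    fix s assume s: "s \<in> set_pmf \<mu>"
    show "ennreal (\<integral>b. f (act s b) \<partial>\<nu>) = (\<integral>\<^sup>+b. ennreal (f (act s b)) \<partial>\<nu>)"
      by (rule nn_integral_eq_integral[symmetric, OF int[OF fs[OF s]]]) (use fs[OF s] in auto)
  qed
  also have "\<dots> = (\<integral>\<^sup>+b. ennreal (f b) \<partial>\<nu>)"
    by (rule stationary_nn_integral[OF st meas]) (use f in auto)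
  also have "\<dots> = ennreal (\<integral>b. f b \<partial>\<nu>)"
    by (rule nn_integral_eq_integral[OF int[OF f bnd]]) (use bnd in auto)
  finally show ?thesis
    using bnd fs_le by (subst (asm) ennreal_inj) (auto intro!: integral_nonneg_AE simp: AE_measure_pmf_iff)
qed

section \<open>The Liouville property and its boundaries\<close>

definition liouville :: "('g, 'm) monoid_scheme \<Rightarrow> 'g pmf \<Rightarrow> bool" where
  "liouville G \<mu> \<longleftrightarrow> (\<forall>(h :: 'g \<Rightarrow> real) B.
     (\<forall>g\<in>carrier G. \<bar>h g\<bar> \<le> B) \<longrightarrow>
     (\<forall>g\<in>carrier G. measure_pmf.expectation \<mu> (\<lambda>s. h (g \<otimes>\<^bsub>G\<^esub> s)) = h g) \<longrightarrow>
     (\<forall>g\<in>carrier G. h g = h \<one>\<^bsub>G\<^esub>))"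

lemma liouvilleD:
  fixes h :: "'g \<Rightarrow> real"
  assumes "liouville G \<mu>"
    and "\<And>g. g \<in> carrier G \<Longrightarrow> \<bar>h g\<bar> \<le> B"
    and "\<And>g. g \<in> carrier G \<Longrightarrow> measure_pmf.expectation \<mu> (\<lambda>s. h (g \<otimes>\<^bsub>G\<^esub> s)) = h g"
    and "g \<in> carrier G"
  shows "h g = h \<one>\<^bsub>G\<^esub>"
  using assms unfolding liouville_def by blast

text \<open>Without nonconstant bounded harmonic functions, \<open>g \<mapsto> \<integral>\<phi>(g b) d\<nu>(b)\<close> is constant for every
  bounded continuous \<open>\<phi>\<close>, so its limit \<open>\<phi> (bnd \<omega>)\<close> along almost every path is \<open>\<integral>\<phi> d\<nu>\<close>. The test
  function \<open>\<phi> = min 1 (dist c \<sqdot>)\<close> at \<open>c = bnd \<omega>\<close> then gives \<open>\<nu> = \<delta>\<^sub>c\<close>.\<close>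

lemma mu_boundary_point_mass:
  fixes G (structure) and \<mu> :: "'g pmf" and B :: "'b topology"
  assumes G: "group G" and \<mu>: "set_pmf \<mu> \<subseteq> carrier G"
    and liouville: "liouville G \<mu>"
    and bd: "mu_boundary G \<mu> B act \<nu>"
  obtains c where "c \<in> topspace B" "AE b in \<nu>. b = c" "\<forall>g\<in>carrier G. act g c = c"
proof -
  interpret group G by fact
  from bd have sp: "G_space G B act" and sets: "sets \<nu> = sets (borel_on B)" and pr: "prob_space \<nu>"
    and st: "stationary \<mu> act \<nu>" by (auto simp: mu_boundary_def)
  from bd obtain bnd where bnd: "bnd \<in> increments \<mu> \<rightarrow>\<^sub>M borel_on B"
    and lim: "AE \<omega> in increments \<mu>. \<forall>\<phi>::'b \<Rightarrow> real.
          continuous_map B euclideanreal \<phi> \<and> bounded (\<phi> ` topspace B) \<longrightarrow>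
          (\<lambda>m. \<integral>b. \<phi> (act (random_walk G \<omega> m) b) \<partial>\<nu>) \<longlonglongrightarrow> \<phi> (bnd \<omega>)"
    unfolding mu_boundary_def by blast
  interpret \<nu>: prob_space \<nu> by fact
  interpret group_action G "topspace B" act using sp by (simp add: G_space_def)
  have space: "space \<nu> = topspace B" using sets_eq_imp_space_eq[OF sets] by simp
  have cont: "continuous_map B B (act g)" if "g \<in> carrier G" for g
    using sp that by (simp add: G_space_def)
  have meas: "act g \<in> measurable \<nu> \<nu>" if "g \<in> carrier G" for g
    using continuous_map_measurable_borel_on[OF cont[OF that]]
    by (simp add: measurable_cong_sets[OF sets sets])
  have act_top: "act g b \<in> topspace B" if "g \<in> carrier G" "b \<in> topspace B" for g b
    using element_image[OF that(1) that(2)] by simp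
  have const: "(\<integral>b. \<phi> (act g b) \<partial>\<nu>) = (\<integral>b. \<phi> b \<partial>\<nu>)"
    if \<phi>: "continuous_map B euclideanreal \<phi>" "\<And>b. 0 \<le> \<phi> b \<and> \<phi> b \<le> 1" and g: "g \<in> carrier G"
    for \<phi> :: "'b \<Rightarrow> real" and g
  proof -
    define h where "h g = (\<integral>b. \<phi> (act g b) \<partial>\<nu>)" for g
    have m\<phi>: "\<phi> \<in> borel_measurable \<nu>"
      using continuous_map_borel_measurable[OF \<phi>(1)] by (simp add: measurable_cong_sets[OF sets refl])
    have m\<phi>g: "(\<lambda>b. \<phi> (act g b)) \<in> borel_measurable \<nu>" if "g \<in> carrier G" for g
      using measurable_compose[OF meas[OF that] m\<phi>] .
    have int: "integrable \<nu> (\<lambda>b. \<phi> (act g b))" if "g \<in> carrier G" for g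
      by (rule \<nu>.integrable_const_bound[where B=1]) (use m\<phi>g[OF that] \<phi>(2) in auto)
    have h_bnd: "\<bar>h g\<bar> \<le> 1" if "g \<in> carrier G" for g
    proof -
      have "0 \<le> h g" unfolding h_def using \<phi>(2) by simp
      moreover have "h g \<le> (\<integral>b. 1 \<partial>\<nu>)"
        unfolding h_def using \<phi>(2) by (intro integral_mono int that) auto
      ultimately show ?thesis by (simp add: \<nu>.prob_space)
    qed
    have harm: "measure_pmf.expectation \<mu> (\<lambda>s. h (g \<otimes> s)) = h g" if g: "g \<in> carrier G" for g
    proof -
      have "measure_pmf.expectation \<mu> (\<lambda>s. h (g \<otimes> s))
          = measure_pmf.expectation \<mu> (\<lambda>s. \<integral>b. \<phi> (act g (act s b)) \<partial>\<nu>)"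
      proof (intro integral_cong_AE)
        show "AE s in \<mu>. h (g \<otimes> s) = (\<integral>b. \<phi> (act g (act s b)) \<partial>\<nu>)"
          unfolding AE_measure_pmf_iff h_def
        proof (intro ballI Bochner_Integration.integral_cong refl)
          fix s b assume "s \<in> set_pmf \<mu>" "b \<in> space \<nu>"
          then show "\<phi> (act (g \<otimes> s) b) = \<phi> (act g (act s b))"
            using composition_rule[of b g s] g \<mu> by (auto simp: space)
        qed
      qed auto
      also have "\<dots> = (\<integral>b. \<phi> (act g b) \<partial>\<nu>)"
        by (rule stationary_integral[OF st pr _ m\<phi>g[OF g]]) (use meas \<mu> \<phi>(2) in auto)
      finally show ?thesis by (simp add: h_def)
    qed
    have "h g = h \<one>" by (rule liouvilleD[OF liouville h_bnd harm g])
    also have "h \<one> = (\<integral>b. \<phi> b \<partial>\<nu>)"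
      unfolding h_def by (intro Bochner_Integration.integral_cong refl) (simp add: space id_eq_one[symmetric])
    finally show ?thesis by (simp add: h_def)
  qed
  \<comment> \<open>The increments must lie in the support for the walk to stay in the carrier,
    where the integrals are constant. A single path with this property and with the convergence
    already determines the point c.\<close>
  have \<omega>_ex: "AE \<omega> in increments \<mu>. \<forall>i. \<omega> i \<in> set_pmf \<mu>"
    unfolding AE_all_countable
  proof
    fix i
    show "AE \<omega> in increments \<mu>. \<omega> i \<in> set_pmf \<mu>"
      unfolding increments_def
      by (rule AE_PiM_component) (auto intro: measure_pmf.prob_space_axioms simp: AE_measure_pmf_iff)
  qed
  interpret inc: prob_space "increments \<mu>" by (rule prob_space_increments)
  have "AE \<omega> in increments \<mu>. (\<forall>i. \<omega> i \<in> set_pmf \<mu>) \<and> (\<forall>\<phi>::'b \<Rightarrow> real.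
          continuous_map B euclideanreal \<phi> \<and> bounded (\<phi> ` topspace B) \<longrightarrow>
          (\<lambda>m. \<integral>b. \<phi> (act (random_walk G \<omega> m) b) \<partial>\<nu>) \<longlonglongrightarrow> \<phi> (bnd \<omega>))"
    using \<omega>_ex lim by eventually_elim blast
  then obtain \<omega> where \<omega>: "\<And>i. \<omega> i \<in> set_pmf \<mu>"
    and lim\<omega>: "\<And>\<phi>::'b \<Rightarrow> real. continuous_map B euclideanreal \<phi> \<Longrightarrow> bounded (\<phi> ` topspace B) \<Longrightarrow>
          (\<lambda>m. \<integral>b. \<phi> (act (random_walk G \<omega> m) b) \<partial>\<nu>) \<longlonglongrightarrow> \<phi> (bnd \<omega>)"
    using eventually_happens[of _ "ae_filter (increments \<mu>)"] inc.ae_filter_bot by blast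
  define c where "c = bnd \<omega>"
  have c: "c \<in> topspace B" unfolding c_def using measurable_space[OF bnd, of \<omega>] by simp
  have rw: "random_walk G \<omega> m \<in> carrier G" for m
    by (induction m) (use \<omega> \<mu> in auto)
  have eval: "(\<integral>b. \<phi> b \<partial>\<nu>) = \<phi> c"
    if \<phi>: "continuous_map B euclideanreal \<phi>" "\<And>b. 0 \<le> \<phi> b \<and> \<phi> b \<le> 1" for \<phi> :: "'b \<Rightarrow> real"
  proof -
    have "bounded (\<phi> ` topspace B)" using \<phi>(2) by (intro boundedI[where B=1]) auto
    from lim\<omega>[OF \<phi>(1) this] have "(\<lambda>m. \<integral>b. \<phi> b \<partial>\<nu>) \<longlonglongrightarrow> \<phi> c"
      by (simp add: const[OF \<phi> rw] c_def)
    then show ?thesis using LIMSEQ_unique tendsto_const by blast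
  qed
  from sp obtain M d where M: "Metric_space M d" and B: "B = Metric_space.mtopology M d"
    unfolding G_space_def metrizable_space_def by blast
  interpret M: Metric_space M d by fact
  have topM: "topspace B = M" by (simp add: B)
  define \<phi> where "\<phi> b = min 1 (d c b)" for b
  have \<phi>_bnd: "0 \<le> \<phi> b \<and> \<phi> b \<le> 1" for b by (simp add: \<phi>_def)
  have \<phi>_cont: "continuous_map B euclideanreal \<phi>"
  proof -
    have "continuous_map B euclideanreal (\<lambda>b. mdist (metric (M, d)) c b)"
      by (rule continuous_map_mdist) (use c in \<open>auto simp: B\<close>)
    then show ?thesis unfolding \<phi>_def by (intro continuous_map_real_min) auto
  qed
  have \<phi>0: "\<phi> b = 0 \<longleftrightarrow> b = c" if "b \<in> topspace B" for b
    using that c by (auto simp: \<phi>_def topM min_def)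
  have m\<phi>: "\<phi> \<in> borel_measurable \<nu>"
    using continuous_map_borel_measurable[OF \<phi>_cont] by (simp add: measurable_cong_sets[OF sets refl])
  have int\<phi>: "integrable \<nu> \<phi>"
    by (rule \<nu>.integrable_const_bound[where B=1]) (use m\<phi> \<phi>_bnd in auto)
  have E\<phi>: "(\<integral>b. \<phi> b \<partial>\<nu>) = 0" using eval[OF \<phi>_cont \<phi>_bnd] \<phi>0[OF c] by simp
  then have "AE b in \<nu>. \<phi> b = 0"
    using integral_nonneg_eq_0_iff_AE[OF int\<phi>] \<phi>_bnd by simp
  then have 1: "AE b in \<nu>. b = c"
    using AE_space by eventually_elim (use \<phi>0 space in auto)
  \<comment> \<open>Evaluating the test function composed with \<open>act g\<close> gives \<phi>(g
    c) = 0, and c is the only zero of \<phi>.\<close>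
  have 2: "act g c = c" if g: "g \<in> carrier G" for g
  proof -
    have "continuous_map B euclideanreal (\<lambda>b. \<phi> (act g b))"
      using continuous_map_compose[OF cont[OF g] \<phi>_cont] by (simp add: o_def)
    then have "\<phi> (act g c) = (\<integral>b. \<phi> (act g b) \<partial>\<nu>)" using eval[of "\<lambda>b. \<phi> (act g b)"] \<phi>_bnd by simp
    also have "\<dots> = 0" using const[OF \<phi>_cont \<phi>_bnd g] E\<phi> by simp
    finally show ?thesis using \<phi>0[OF act_top[OF g c]] by simp
  qed
  show ?thesis using that[OF c 1] 2 by blast
qed

lemma return_eq_of_AE_eq:
  assumes pr: "prob_space \<nu>" and c: "c \<in> space \<nu>" and AE: "AE b in \<nu>. b = c"
  shows "return \<nu> c = \<nu>"
proof (rule measure_eqI)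
  interpret prob_space \<nu> by fact
  fix A assume "A \<in> sets (return \<nu> c)"
  then have A: "A \<in> sets \<nu>" by simp
  show "emeasure (return \<nu> c) A = emeasure \<nu> A"
  proof (cases "c \<in> A")
    case True
    have "AE b in \<nu>. b \<in> A" using AE by eventually_elim (use True in auto)
    then show ?thesis using True A by (simp add: emeasure_eq_1_AE)
  next
    case False
    have "AE b in \<nu>. b \<notin> A" using AE by eventually_elim (use False in auto)
    then have "emeasure \<nu> {b \<in> space \<nu>. b \<in> A} = 0" by (rule emeasure_eq_0_AE)
    moreover have "{b \<in> space \<nu>. b \<in> A} = A" using sets.sets_into_space[OF A] by auto
    ultimately show ?thesis using False A by simp
  qed
qed simp

text \<open>Any boundary is a point mass at a fixed point c, so the constant map c is an equivariant
  map onto it, which is maximality. On the one-point space the bounded functions are the real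
  numbers, and the Liouville property says that the bounded harmonic functions are too.\<close>

lemma one_point_poisson_boundary:
  fixes G (structure) and \<mu> :: "'g pmf"
  assumes G: "group G" and \<mu>: "set_pmf \<mu> \<subseteq> carrier G"
    and liouville: "liouville G \<mu>"
  shows "\<exists>(B :: unit topology) act \<nu>. topspace B = {()} \<and> poisson_boundary TYPE('c) G \<mu> B act \<nu>"
proof -
  interpret group G by fact
  define B :: "unit topology" where "B = discrete_topology {()}"
  \<comment> \<open>Taking the unit of \<open>BijGroup\<close> as the value makes \<open>act\<close>
    the trivial homomorphism, so \<open>trivial_hom\<close> yields the action axioms.\<close>
  define act :: "'g \<Rightarrow> unit \<Rightarrow> unit" where "act = (\<lambda>_. \<one>\<^bsub>BijGroup {()}\<^esub>)"
  define \<nu> where "\<nu> = return (borel_on B) ()"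
  have top: "topspace B = {()}" by (simp add: B_def)
  have all_meas: "f \<in> measurable M N" if "space M = {()}" "f () \<in> space N" for f :: "unit \<Rightarrow> 'd" and M :: "unit measure" and N
  proof (rule measurableI)
    fix A assume "A \<in> sets N"
    have "f -` A \<inter> space M = {} \<or> f -` A \<inter> space M = space M" using that by auto
    then show "f -` A \<inter> space M \<in> sets M" by auto
  qed (use that in auto)
  have sets\<nu>: "sets \<nu> = sets (borel_on B)" by (simp add: \<nu>_def)
  have space\<nu>: "space \<nu> = {()}" by (simp add: \<nu>_def top)
  have pr: "prob_space \<nu>" unfolding \<nu>_def by (rule prob_space_return) (simp add: top)
  interpret \<nu>: prob_space \<nu> by (rule pr)
  have int: "(\<integral>b. f b \<partial>\<nu>) = f ()" for f :: "unit \<Rightarrow> real"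
    unfolding \<nu>_def by (rule integral_return) (auto simp: top intro!: all_meas)
  have act_unit: "act g b = b" for g b by (simp add: act_def)
  have action: "group_action G (topspace B) act"
    unfolding group_action_def group_hom_def group_hom_axioms_def top act_def
    using group_BijGroup[of "{()}"] G trivial_hom by blast
  have "mu_boundary G \<mu> B act \<nu>"
    unfolding mu_boundary_def
  proof (intro conjI)
    show "G_space G B act"
      unfolding G_space_def using action
      by (auto simp: B_def second_countable_discrete_topology)
    show "stationary \<mu> act \<nu>"
    proof -
      have "act g = (\<lambda>b. b)" for g by (rule ext) (rule act_unit)
      then have "distr \<nu> \<nu> (act g) = \<nu>" for g by (simp only: distr_id2)
      then show ?thesis unfolding stationary_def by (simp add: measure_pmf.emeasure_space_1)
    qed
    show "\<exists>bnd\<in>increments \<mu> \<rightarrow>\<^sub>M borel_on B. AE \<omega> in increments \<mu>. \<forall>\<phi>::unit \<Rightarrow> real.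
        continuous_map B euclideanreal \<phi> \<and> bounded (\<phi> ` topspace B) \<longrightarrow>
        (\<lambda>m. \<integral>b. \<phi> (act (random_walk G \<omega> m) b) \<partial>\<nu>) \<longlonglongrightarrow> \<phi> (bnd \<omega>)"
      by (rule bexI[of _ "\<lambda>_. ()"]) (auto simp: int top)
  qed (rule sets\<nu> pr)+
  moreover have "equivariant_image G act \<nu> act' \<nu>'"
    if bd: "mu_boundary G \<mu> C act' \<nu>'" for C :: "'c topology" and act' \<nu>'
  proof -
    obtain c where c: "c \<in> topspace C" "AE b in \<nu>'. b = c" "\<forall>g\<in>carrier G. act' g c = c"
      by (rule mu_boundary_point_mass[OF G \<mu> liouville bd]) (rule that)
    have sets\<nu>': "sets \<nu>' = sets (borel_on C)" and pr': "prob_space \<nu>'" using bd by (auto simp: mu_boundary_def)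
    have c': "c \<in> space \<nu>'" using c(1) sets_eq_imp_space_eq[OF sets\<nu>'] by simp
    show ?thesis
      unfolding equivariant_image_def
    proof (intro bexI[of _ "\<lambda>_. c"] conjI ballI)
      have "distr \<nu> \<nu>' (\<lambda>_. c) = return \<nu>' c"
        unfolding \<nu>_def by (rule distr_return) (use c' top in auto)
      then show "distr \<nu> \<nu>' (\<lambda>_. c) = \<nu>'" by (simp add: return_eq_of_AE_eq[OF pr' c' c(2)])
      show "(\<lambda>_. c) \<in> \<nu> \<rightarrow>\<^sub>M \<nu>'" using c' by simp
      show "AE b in \<nu>. c = act' g c" if "g \<in> carrier G" for g using c(3) that by simp
    qed
  qed
  moreover have "poisson_transform_isometric_iso G \<mu> act \<nu>"
  proof -
    have P: "poisson_transform G act \<nu> \<phi> = (\<lambda>g\<in>carrier G. \<phi> ())" for \<phi>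
      by (simp add: poisson_transform_def int act_unit)
    have norm: "Linf_norm \<nu> \<phi> = ereal \<bar>\<phi> ()\<bar>" for \<phi>
    proof -
      have "(\<lambda>b. ereal \<bar>\<phi> b\<bar>) = (\<lambda>_. ereal \<bar>\<phi> ()\<bar>)" by auto
      then show ?thesis unfolding Linf_norm_def using esssup_const[of \<nu> "ereal \<bar>\<phi> ()\<bar>"] \<nu>.emeasure_space_1 by simp
    qed
    have Linf: "Linf \<nu> = UNIV"
      by (auto simp: Linf_def norm intro!: all_meas space\<nu>)
    have "poisson_transform G act \<nu> ` Linf \<nu> = bounded_harmonic G \<mu>"
    proof (intro equalityI subsetI)
      fix h assume "h \<in> poisson_transform G act \<nu> ` Linf \<nu>"
      then obtain a where h: "h = (\<lambda>g\<in>carrier G. a)" unfolding P by auto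
      have "measure_pmf.expectation \<mu> (\<lambda>s. h (g \<otimes> s)) = h g" if g: "g \<in> carrier G" for g
      proof -
        have "measure_pmf.expectation \<mu> (\<lambda>s. h (g \<otimes> s)) = measure_pmf.expectation \<mu> (\<lambda>s. a)"
          by (intro integral_cong_AE) (use g \<mu> in \<open>auto simp: h AE_measure_pmf_iff\<close>)
        then show ?thesis using g by (simp add: h)
      qed
      moreover have "bounded (h ` carrier G)" by (rule boundedI[where B="\<bar>a\<bar>"]) (auto simp: h)
      ultimately show "h \<in> bounded_harmonic G \<mu>" by (auto simp: bounded_harmonic_def h)
    next
      fix h assume h: "h \<in> bounded_harmonic G \<mu>"
      then obtain b where b: "\<And>g. g \<in> carrier G \<Longrightarrow> \<bar>h g\<bar> \<le> b"
        by (auto simp: bounded_harmonic_def bounded_iff)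
      have const: "h g = h \<one>" if "g \<in> carrier G" for g
        by (rule liouvilleD[OF liouville b _ that]) (use h in \<open>auto simp: bounded_harmonic_def\<close>)
      have "h = (\<lambda>g\<in>carrier G. h \<one>)"
      proof (rule extensionalityI)
        show "h \<in> extensional (carrier G)" using h by (simp add: bounded_harmonic_def)
        show "h g = (\<lambda>g\<in>carrier G. h \<one>) g" if "g \<in> carrier G" for g
          unfolding restrict_apply'[OF that] by (rule const[OF that])
      qed (rule restrict_extensional)
      then have "h = poisson_transform G act \<nu> (\<lambda>_. h \<one>)" unfolding P .
      then show "h \<in> poisson_transform G act \<nu> ` Linf \<nu>" unfolding Linf by blast
    qed
    moreover have "carrier G \<noteq> {}" by auto
    ultimately show ?thesis
      unfolding poisson_transform_isometric_iso_def Let_def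
      by (simp add: P norm cong: SUP_cong_simp)
  qed
  ultimately have "poisson_boundary TYPE('c) G \<mu> B act \<nu>"
    unfolding poisson_boundary_def by blast
  with top show ?thesis by blast
qed

section \<open>Passage to the subgroup generated by the support\<close>

lemma conv_power_subgroup_generated: "conv_power (subgroup_generated G A) \<mu> m = conv_power G \<mu> m"
  by (induction m) simp_all

text \<open>The induction over k needs invariance under right translation by k at every g of the
  subgroup. For an inverse generator it is the invariance under the generator, read at
  \<open>g \<otimes> inv x\<close>.\<close>

lemma (in group) right_invariant_generated_constant:
  fixes h :: "'a \<Rightarrow> real"
  assumes A: "A \<subseteq> carrier G"
    and inv: "\<And>g x. g \<in> generate G A \<Longrightarrow> x \<in> A \<Longrightarrow> h (g \<otimes> x) = h g"
    and k: "k \<in> generate G A"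
  shows "h k = h \<one>"
proof -
  have gen: "generate G A \<subseteq> carrier G" using generate_in_carrier[OF A] by auto
  have "\<forall>g \<in> generate G A. h (g \<otimes> k) = h g"
    using k
  proof (induction rule: generate.induct)
    case one
    then show ?case using gen by auto
  next
    case (incl x)
    then show ?case using inv by auto
  next
    case (inv x)
    show ?case
    proof
      fix g assume g: "g \<in> generate G A"
      have gx: "g \<otimes> inv x \<in> generate G A" using g inv by (intro generate.eng generate.inv)
      have "h (g \<otimes> inv x \<otimes> x) = h (g \<otimes> inv x)" by (rule assms(2)[OF gx inv])
      moreover have "g \<otimes> inv x \<otimes> x = g" using g inv A gen by (auto simp: m_assoc subset_iff)
      ultimately show "h (g \<otimes> inv x) = h g" by simp
    qed
  next
    case (eng a b)
    show ?case
    proof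
      fix g assume g: "g \<in> generate G A"
      have "g \<otimes> (a \<otimes> b) = (g \<otimes> a) \<otimes> b" using g eng gen by (auto simp: m_assoc subset_iff)
      then show "h (g \<otimes> (a \<otimes> b)) = h g" using eng generate.eng[OF g eng.hyps(1)] g by simp
    qed
  qed
  then have "h (\<one> \<otimes> k) = h \<one>" by (simp add: generate.one)
  then show ?thesis using k gen by auto
qed

theorem proposition6p5p3:
  fixes p n :: nat
    and S :: "(int Matrix.vec \<times> rat mat) set"
    and \<mu> :: "(int Matrix.vec \<times> rat mat) pmf"
  defines "G \<equiv> semidirect_UT p n"
  assumes "prime p"
    and "set_pmf \<mu> \<subseteq> carrier G"
    and "finite S" and "S \<subseteq> carrier G" and "generate G S = carrier G"
    and "finite_first_moment G S \<mu>"
    and "\<not> comm_group (subgroup_generated G (set_pmf \<mu>))"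
    and "\<And>i. i < n \<Longrightarrow> recurrent_walk integer_group (map_pmf (\<lambda>(x, f). x $ i) \<mu>)"
  shows "poisson_boundary_trivial TYPE('c) G \<mu>"
proof -
  have p: "p > 1" using \<open>prime p\<close> by (rule prime_gt_1_nat)
  interpret group G unfolding G_def by (rule group_semidirect_UT[OF p])
  note supp = \<open>set_pmf \<mu> \<subseteq> carrier G\<close>
  have int: "integrable (measure_pmf \<mu>) (log_height p n 1)"
  proof -
    have sub: "log_height p n 1 (g \<otimes>\<^bsub>G\<^esub> h) \<le> log_height p n 1 g + log_height p n 1 h"
      if "g \<in> carrier G" "h \<in> carrier G" for g h
      using that p unfolding G_def by (intro log_height_mult) auto
    obtain C where C: "\<And>g. g \<in> carrier G \<Longrightarrow>
        log_height p n 1 g \<le> C * real (word_length G S g) + log_height p n 1 \<one>\<^bsub>G\<^esub>"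
      using subadditive_le_word_length[OF \<open>finite S\<close> \<open>S \<subseteq> carrier G\<close> \<open>generate G S = carrier G\<close> sub] by blast
    show ?thesis
    proof (rule Bochner_Integration.integrable_bound)
      show "integrable (measure_pmf \<mu>) (\<lambda>g. C * real (word_length G S g) + log_height p n 1 \<one>\<^bsub>G\<^esub>)"
        using \<open>finite_first_moment G S \<mu>\<close> by (simp add: finite_first_moment_def)
      show "AE g in \<mu>. norm (log_height p n 1 g) \<le> norm (C * real (word_length G S g) + log_height p n 1 \<one>\<^bsub>G\<^esub>)"
        unfolding AE_measure_pmf_iff
      proof
        fix g assume "g \<in> set_pmf \<mu>"
        then have "log_height p n 1 g \<le> C * real (word_length G S g) + log_height p n 1 \<one>\<^bsub>G\<^esub>"
          using C supp by blast
        moreover have "0 \<le> log_height p n 1 g" by (rule log_height_nonneg) simp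
        ultimately show "norm (log_height p n 1 g) \<le> norm (C * real (word_length G S g) + log_height p n 1 \<one>\<^bsub>G\<^esub>)"
          by simp
      qed
    qed simp
  qed
  note supp' = supp[unfolded G_def]
  have mean: "measure_pmf.expectation \<mu> (\<lambda>g. real_of_int (fst g $ i)) = 0" if i: "i < n" for i
    using recurrent_walk_expectation_eq_0[OF assms(9)[OF i]] integrable_coordinate[OF p supp' int i]
    by (simp add: case_prod_beta')
  let ?H = "subgroup_generated G (set_pmf \<mu>)"
  have H: "group ?H" by (rule group_subgroup_generated)
  have carrier_H: "carrier ?H = generate G (set_pmf \<mu>)"
    using supp by (simp add: carrier_subgroup_generated Int_absorb1)
  have supp_H: "set_pmf \<mu> \<subseteq> carrier ?H" unfolding carrier_H by (auto intro: generate.incl)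
  obtain c C where ent: "\<And>m. integrable (measure_pmf (conv_power G \<mu> m)) (\<lambda>x. ln (pmf (conv_power G \<mu> m) x))"
    using pmf_entropy_le_height[OF p supp' int] unfolding G_def by metis
  have sublin: "\<exists>m\<ge>1. pmf_entropy (conv_power G \<mu> m) \<le> \<epsilon> * real m" if "\<epsilon> > 0" for \<epsilon>
    unfolding G_def by (rule entropy_sublinear[OF p supp' int mean that])
  \<comment> \<open>Harmonic functions are considered on the subgroup, where constancy can hold,
    while the entropy estimates were made in the whole group. The two agree because the convolution
    powers do.\<close>
  have "liouville ?H \<mu>"
    unfolding liouville_def
  proof (intro allI impI ballI)
    fix h :: "int Matrix.vec \<times> rat mat \<Rightarrow> real" and B k
    assume bnd: "\<forall>g\<in>carrier ?H. \<bar>h g\<bar> \<le> B"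
      and harm: "\<forall>g\<in>carrier ?H. measure_pmf.expectation \<mu> (\<lambda>s. h (g \<otimes>\<^bsub>?H\<^esub> s)) = h g"
      and k: "k \<in> carrier ?H"
    have "h (g \<otimes>\<^bsub>G\<^esub> x) = h g" if g: "g \<in> generate G (set_pmf \<mu>)" and x: "x \<in> set_pmf \<mu>" for g x
    proof -
      have "h (g \<otimes>\<^bsub>?H\<^esub> x) = h g"
      proof (rule group.harmonic_right_invariant[OF H supp_H _ _ bspec[OF bnd] bspec[OF harm] _ x])
        show "integrable (measure_pmf (conv_power ?H \<mu> m)) (\<lambda>x. ln (pmf (conv_power ?H \<mu> m) x))" for m
          unfolding conv_power_subgroup_generated by (rule ent)
        show "\<exists>m\<ge>1. pmf_entropy (conv_power ?H \<mu> m) \<le> \<epsilon> * real m" if "\<epsilon> > 0" for \<epsilon>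
          unfolding conv_power_subgroup_generated by (rule sublin[OF that])
        show "g \<in> carrier ?H" unfolding carrier_H by (rule g)
      qed
      then show ?thesis by simp
    qed
    then show "h k = h \<one>\<^bsub>?H\<^esub>"
      using right_invariant_generated_constant[OF supp, of h k] k by (simp add: carrier_H)
  qed
  then show ?thesis
    unfolding poisson_boundary_trivial_def by (rule one_point_poisson_boundary[OF H supp_H])
qed

end
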